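(* Let $\sigma\in\mathfrak{S}_n$ and $1\le k<n$, and let $\eta=\eta(\sigma,k)$ be the permutation defined in the context. Then, modulo the ideal identifying every symmetric function of $x_1,\dots,x_n$ with the same symmetric function of $y_1,\dots,y_n$, $$G_{(\sigma)}\,\frac{y_{\sigma_1}\cdots y_{\sigma_k}}{x_1\cdots x_k}\;\equiv\;\sum_{\sigma\le\mu\le\eta}(-1)^{\ell(\mu)-\ell(\sigma)}\,G_{(\mu)},$$ where the sum is over the interval $[\sigma,\eta]$ of the Bruhat order on $\mathfrak{S}_n$.
   Context: Permutations $\sigma\in\mathfrak{S}_n$ are written in one-line notation, $\sigma=[\sigma_1,\dots,\sigma_n]$ with $\sigma_i=\sigma(i)$; products are $(\sigma\tau)(i)=\sigma(\tau(i))$, so right multiplication by a transposition $(a,b)$ exchanges the values in positions $a$ and $b$. $s_i=(i,i+1)$, $\ell$ is the Coxeter length (number of inversions), $\omega=[n,n-1,\dots,1]$, $\le$ is the (strong) Bruhat order, and $\sigma\lessdot\mu$ means that $\mu=\sigma\tau$ for a transposition $\tau$ with $\ell(\mu)=\ell(\sigma)+1$. Double Grothendieck polynomials. Work in Laurent polynomials with integer coefficients in $x_1,\dots,x_n,y_1,\dots,y_n$. Operators act on the right of their arguments: for $1\le i<n$, $f\,\pi_i=\dfrac{x_i f-x_{i+1}f^{s_i}}{x_i-x_{i+1}}$, where $f^{s_i}$ is $f$ with $x_i$ and $x_{i+1}$ exchanged. Define $$G_{(\omega)}=\prod_{i=1}^{n}\prod_{j=1}^{n-i}(1-y_jx_i^{-1}),\qquad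 G_{(\sigma s_i)}=G_{(\sigma)}\pi_i\quad\text{if }\sigma(i)>\sigma(i+1).$$ This defines $G_{(\sigma)}$ consistently for all $\sigma\in\mathfrak{S}_n$. The congruence $\equiv$ is modulo the ideal generated by all $f(x_1,\dots,x_n)-f(y_1,\dots,y_n)$ with $f$ a symmetric polynomial. The permutation $\eta$. Let $(r_1,\dots,r_\ell)$ be the list of transpositions $((1,n),(2,n),\dots,(k,n),(1,n-1),\dots,(k,n-1),\dots,(1,k+1),\dots,(k,k+1))$. Consider subsets $J=\{j_1<j_2<\dots<j_s\}$ of $\{1,\dots,\ell\}$ such that $\sigma\lessdot\sigma r_{j_1}\lessdot\sigma r_{j_1}r_{j_2}\lessdot\cdots\lessdot\sigma r_{j_1}\cdots r_{j_s}=:w(J)$ is a saturated chain in the Bruhat order. Then $\eta(\sigma,k):=w(J_{\max})$ is the permutation of maximal length among the $w(J)$ obtained in this way ($J_{\max}$ being the admissible subset of maximal cardinality, which is unique). *)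

theory Defs
  imports "HOL-Library.Poly_Mapping" "HOL-Combinatorics.Permutations" "HOL-Algebra.Ideal"
begin

section \<open>Permutations and the Bruhat order\<close>

text \<open>
  Elements of the symmetric group are functions \<open>\<sigma>\<close> with \<open>\<sigma> permutes {1..n}\<close>; products are
  compositions, so \<open>\<sigma> \<circ> transpose a b\<close> exchanges the values of \<open>\<sigma>\<close> in positions \<open>a\<close> and \<open>b\<close>.
\<close>

definition perm_length :: "nat \<Rightarrow> (nat \<Rightarrow> nat) \<Rightarrow> nat" where
  "perm_length n \<sigma> = card {(i, j). 1 \<le> i \<and> i < j \<and> j \<le> n \<and> \<sigma> i > \<sigma> j}"

definition longest_perm :: "nat \<Rightarrow> nat \<Rightarrow> nat" where
  "longest_perm n = (\<lambda>i. if i \<in> {1..n} then n + 1 - i else i)"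

definition bruhat_step :: "nat \<Rightarrow> (nat \<Rightarrow> nat) \<Rightarrow> (nat \<Rightarrow> nat) \<Rightarrow> bool" where
  "bruhat_step n \<sigma> \<mu> \<longleftrightarrow>
     (\<exists>a b. 1 \<le> a \<and> a < b \<and> b \<le> n \<and> \<mu> = \<sigma> \<circ> transpose a b) \<and> perm_length n \<sigma> < perm_length n \<mu>"

definition bruhat_le :: "nat \<Rightarrow> (nat \<Rightarrow> nat) \<Rightarrow> (nat \<Rightarrow> nat) \<Rightarrow> bool" where
  "bruhat_le n = (bruhat_step n)\<^sup>*\<^sup>*"

definition bruhat_covers :: "nat \<Rightarrow> (nat \<Rightarrow> nat) \<Rightarrow> (nat \<Rightarrow> nat) \<Rightarrow> bool" where
  "bruhat_covers n \<sigma> \<mu> \<longleftrightarrow>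
     (\<exists>a b. 1 \<le> a \<and> a < b \<and> b \<le> n \<and> \<mu> = \<sigma> \<circ> transpose a b) \<and> perm_length n \<mu> = perm_length n \<sigma> + 1"

definition bruhat_interval :: "nat \<Rightarrow> (nat \<Rightarrow> nat) \<Rightarrow> (nat \<Rightarrow> nat) \<Rightarrow> (nat \<Rightarrow> nat) set" where
  "bruhat_interval n \<sigma> \<eta> = {\<mu>. \<mu> permutes {1..n} \<and> bruhat_le n \<sigma> \<mu> \<and> bruhat_le n \<mu> \<eta>}"


section \<open>The permutation \<open>\<eta>\<close>\<close>

text \<open>The list \<open>(1,n), \<dots>, (k,n), (1,n-1), \<dots>, (k,n-1), \<dots>, (1,k+1), \<dots>, (k,k+1)\<close>.\<close>

definition transp_list :: "nat \<Rightarrow> nat \<Rightarrow> (nat \<times> nat) list" where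
  "transp_list n k = [(a, b). b \<leftarrow> rev [Suc k..<Suc n], a \<leftarrow> [1..<Suc k]]"

fun transp_prod :: "(nat \<Rightarrow> nat) \<Rightarrow> (nat \<times> nat) list \<Rightarrow> nat \<Rightarrow> nat" where
  "transp_prod \<sigma> [] = \<sigma>"
| "transp_prod \<sigma> ((a, b) # rs) = transp_prod (\<sigma> \<circ> transpose a b) rs"

fun saturated_chain :: "nat \<Rightarrow> (nat \<Rightarrow> nat) \<Rightarrow> (nat \<times> nat) list \<Rightarrow> bool" where
  "saturated_chain n \<sigma> [] \<longleftrightarrow> True"
| "saturated_chain n \<sigma> ((a, b) # rs) \<longleftrightarrow>
     bruhat_covers n \<sigma> (\<sigma> \<circ> transpose a b) \<and> saturated_chain n (\<sigma> \<circ> transpose a b) rs"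

text \<open>Subsets of positions in the list are 0-based, as required by \<^const>\<open>nths\<close>.\<close>

definition admissible :: "nat \<Rightarrow> nat \<Rightarrow> (nat \<Rightarrow> nat) \<Rightarrow> nat set \<Rightarrow> bool" where
  "admissible n k \<sigma> J \<longleftrightarrow>
     J \<subseteq> {..<length (transp_list n k)} \<and> saturated_chain n \<sigma> (nths (transp_list n k) J)"

definition eta :: "nat \<Rightarrow> nat \<Rightarrow> (nat \<Rightarrow> nat) \<Rightarrow> nat \<Rightarrow> nat" where
  "eta n k \<sigma> = transp_prod \<sigma> (nths (transp_list n k) (ARG_MAX card J. admissible n k \<sigma> J))"


section \<open>Laurent polynomials\<close>

text \<open>
  A Laurent polynomial is a finitely supported family of integer coefficients indexed by exponent
  vectors in \<open>indet \<Rightarrow>\<^sub>0 int\<close>; the multiplication of \<^theory>\<open>HOL-Library.Poly_Mapping\<close> is the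
  convolution product. The linear order on variables is arbitrary; it serves only to make
  \<open>laurent\<close> an instance of the class \<open>idom\<close>.
\<close>

datatype indet = X nat | Y nat

instantiation indet :: linorder
begin

fun less_eq_indet :: "indet \<Rightarrow> indet \<Rightarrow> bool" where
  "less_eq_indet (X i) (X j) \<longleftrightarrow> i \<le> j"
| "less_eq_indet (X i) (Y j) \<longleftrightarrow> True"
| "less_eq_indet (Y i) (X j) \<longleftrightarrow> False"
| "less_eq_indet (Y i) (Y j) \<longleftrightarrow> i \<le> j"

definition less_indet :: "indet \<Rightarrow> indet \<Rightarrow> bool" where
  "less_indet u v \<longleftrightarrow> u \<le> v \<and> \<not> v \<le> u"

instance
proof
  fix u v w :: indet
  show "u < v \<longleftrightarrow> u \<le> v \<and> \<not> v \<le> u" by (rule less_indet_def)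
  show "u \<le> u" by (cases u) auto
  show "u \<le> v \<Longrightarrow> v \<le> w \<Longrightarrow> u \<le> w" by (cases u; cases v; cases w) auto
  show "u \<le> v \<Longrightarrow> v \<le> u \<Longrightarrow> u = v" by (cases u; cases v) auto
  show "u \<le> v \<or> v \<le> u" by (cases u; cases v) auto
qed

end

type_synonym laurent = "(indet \<Rightarrow>\<^sub>0 int) \<Rightarrow>\<^sub>0 int"

definition var_pow :: "indet \<Rightarrow> int \<Rightarrow> laurent" where
  "var_pow v e = Poly_Mapping.single (Poly_Mapping.single v e) 1"

definition laurent_ring :: "nat \<Rightarrow> laurent ring" where
  "laurent_ring n = \<lparr>carrier = {f. \<forall>m\<in>Poly_Mapping.keys f. Poly_Mapping.keys m \<subseteq> X ` {1..n} \<union> Y ` {1..n}},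
     mult = (*), one = 1, zero = 0, add = (+)\<rparr>"

lemma cring_laurent_ring: "cring (laurent_ring n)"
proof -
  let ?V = "X ` {1..n} \<union> Y ` {1..n}"
  let ?C = "{f :: laurent. \<forall>m\<in>Poly_Mapping.keys f. Poly_Mapping.keys m \<subseteq> ?V}"
  have add: "f + g \<in> ?C" if "f \<in> ?C" "g \<in> ?C" for f g
    using that Poly_Mapping.keys_add[of f g] by (simp only: mem_Collect_eq) (meson UnE subsetD)
  have mult: "f * g \<in> ?C" if f: "f \<in> ?C" and g: "g \<in> ?C" for f g
  proof (standard, standard)
    fix m assume "m \<in> Poly_Mapping.keys (f * g)"
    then obtain a b where ab: "a \<in> Poly_Mapping.keys f" "b \<in> Poly_Mapping.keys g" "m = a + b"
      using keys_mult[of f g] by blast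
    then have "Poly_Mapping.keys a \<subseteq> ?V" "Poly_Mapping.keys b \<subseteq> ?V"
      using f g by (simp_all only: mem_Collect_eq)
    then show "Poly_Mapping.keys m \<subseteq> ?V"
      unfolding ab(3) using Poly_Mapping.keys_add[of a b] by (meson Un_least order_trans)
  qed
  have uminus: "- f \<in> ?C" if "f \<in> ?C" for f
  proof -
    have "Poly_Mapping.keys (- f) = Poly_Mapping.keys f"
      by (auto simp: in_keys_iff)
    with that show ?thesis by (simp only: mem_Collect_eq)
  qed
  have closed0: "0 \<in> ?C" and closed1: "1 \<in> ?C" by simp_all
  define C where "C = ?C"
  have R: "laurent_ring n = \<lparr>carrier = C, mult = (*), one = 1, zero = 0, add = (+)\<rparr>"
    by (simp add: laurent_ring_def C_def)
  note closed = add[folded C_def] mult[folded C_def] closed0[folded C_def] closed1[folded C_def]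
  show ?thesis
  proof (rule cringI)
    show "abelian_group (laurent_ring n)"
    proof (rule abelian_groupI)
      fix f assume "f \<in> carrier (laurent_ring n)"
      then show "\<exists>g\<in>carrier (laurent_ring n). g \<oplus>\<^bsub>laurent_ring n\<^esub> f = \<zero>\<^bsub>laurent_ring n\<^esub>"
        using uminus[folded C_def, of f] by (intro bexI[of _ "- f"]) (simp_all add: R)
    qed (simp_all add: R closed add_ac)
    show "Group.comm_monoid (laurent_ring n)"
      by (rule Group.comm_monoidI) (simp_all add: R closed mult_ac)
  qed (simp add: R distrib_right)
qed

text \<open>A polynomial in \<open>n\<close> indeterminates, evaluated at a family of Laurent polynomials.\<close>

definition poly_at :: "(nat \<Rightarrow> laurent) \<Rightarrow> ((nat \<Rightarrow>\<^sub>0 nat) \<Rightarrow>\<^sub>0 int) \<Rightarrow> laurent" where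
  "poly_at z f = (\<Sum>m\<in>Poly_Mapping.keys f. of_int (Poly_Mapping.lookup f m) *
                    (\<Prod>i\<in>Poly_Mapping.keys m. z i ^ Poly_Mapping.lookup m i))"

definition symmetric_polys :: "nat \<Rightarrow> ((nat \<Rightarrow>\<^sub>0 nat) \<Rightarrow>\<^sub>0 int) set" where
  "symmetric_polys n =
     {f. (\<forall>m\<in>Poly_Mapping.keys f. Poly_Mapping.keys m \<subseteq> {1..n}) \<and>
         (\<forall>\<pi>. \<pi> permutes {1..n} \<longrightarrow> Poly_Mapping.map_key (Poly_Mapping.map_key \<pi>) f = f)}"

definition sym_ideal :: "nat \<Rightarrow> laurent set" where
  "sym_ideal n = genideal (laurent_ring n)
     {poly_at (\<lambda>i. var_pow (X i) 1) f - poly_at (\<lambda>i. var_pow (Y i) 1) f |f. f \<in> symmetric_polys n}"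

definition laurent_cong :: "nat \<Rightarrow> laurent \<Rightarrow> laurent \<Rightarrow> bool" where
  "laurent_cong n f g \<longleftrightarrow> f - g \<in> sym_ideal n"


section \<open>Double Grothendieck polynomials\<close>

definition swap_x :: "nat \<Rightarrow> laurent \<Rightarrow> laurent" where
  "swap_x i f = Poly_Mapping.map_key (Poly_Mapping.map_key (transpose (X i) (X (Suc i)))) f"

text \<open>The operator \<open>f \<mapsto> f \<pi>\<^sub>i\<close>; the exact quotient exists and is unique.\<close>

definition isobaric :: "nat \<Rightarrow> laurent \<Rightarrow> laurent" where
  "isobaric i f =
     (THE g. g * (var_pow (X i) 1 - var_pow (X (Suc i)) 1) =
             var_pow (X i) 1 * f - var_pow (X (Suc i)) 1 * swap_x i f)"

definition groth_top :: "nat \<Rightarrow> laurent" where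
  "groth_top n = (\<Prod>i = 1..n. \<Prod>j = 1..n - i. 1 - var_pow (Y j) 1 * var_pow (X i) (-1))"

inductive groth_rel :: "nat \<Rightarrow> (nat \<Rightarrow> nat) \<Rightarrow> laurent \<Rightarrow> bool" for n where
  top: "groth_rel n (longest_perm n) (groth_top n)"
| step: "groth_rel n \<sigma> g \<Longrightarrow> 1 \<le> i \<Longrightarrow> i < n \<Longrightarrow> \<sigma> i > \<sigma> (Suc i) \<Longrightarrow>
         groth_rel n (\<sigma> \<circ> transpose i (Suc i)) (isobaric i g)"

text \<open>The value is the same along every descending path from the longest permutation to \<open>\<sigma>\<close>.\<close>

definition groth :: "nat \<Rightarrow> (nat \<Rightarrow> nat) \<Rightarrow> laurent" where
  "groth n \<sigma> = (THE g. groth_rel n \<sigma> g)"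

end

theory Submission
  imports Defs
begin

text \<open>
  Membership in \<open>[\<sigma>, \<eta>(\<sigma>, k)]\<close> turns out to be a condition on each position separately: \<open>\<nu>\<close> belongs
  to the interval iff for \<open>c \<le> k\<close> the value \<open>\<nu> c\<close> lies between \<open>\<sigma> c\<close> (included) and the next larger
  value of \<open>\<sigma>\<close> occurring in positions \<open>c + 1, \<dots>, k\<close> (excluded), and dually for \<open>c > k\<close>. The
  greedy chain realises the maximum of this set, and comparing numbers of large values in initial
  segments shows that the set is convex.

  The operators \<open>\<pi>\<^sub>i\<close> do not commute with the factor \<open>1/(x\<^sub>1 \<dots> x\<^sub>k)\<close>, but \<open>G\<^bsub>s\<^sub>i \<sigma>\<^esub>\<close> is also obtained
  from \<open>G\<^bsub>\<sigma>\<^esub>\<close> by an operator of the same kind in \<open>y\<^sub>i, y\<^bsub>i+1\<^esub>\<close>, which does commute with it and which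
  preserves the ideal. Starting from the longest permutation, where \<open>x\<^sub>i G \<equiv> y\<^bsub>n+1-i\<^esub> G\<close>, these
  operators carry the formula for \<open>s\<^sub>i \<sigma>\<close> to that for \<open>\<sigma>\<close>: elements of the interval cancel in pairs
  \<open>\<nu>, s\<^sub>i \<nu>\<close>, as the description by positions shows.
\<close>

section \<open>Demazure operators on Laurent polynomials\<close>

text \<open>The end points \<open>eta n k \<sigma>\<close> and \<open>eta n k\<close> of s_i
  \<sigma> come from greedy chains that bear no evident relation to each other, so a recursion
  cannot be read off from the intervals as such; bounds at single positions can be compared. The
  product of the y is moved to the other side as its inverse, which leaves on the left only
  G_\<sigma> and a factor free of y. Let D be the operator in y_i and y_(i+1). If i and i+1 lie on
  the same side of k in \<sigma>, the inverse product is symmetric in these two variables and D acts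
  on the sum alone. If k separates them, exactly one factor 1/y_(i+1) is asymmetric, and it turns D
  into D - id; this is why there are two recursions for the sums. D takes its arguments in the order
  y_(i+1), y_i, opposite to x_i, x_(i+1): G involves the y but the inverses of the x, and inverting
  both variables exchanges the arguments of such an operator.\<close>

lemma poly_mapping_induct_keys:
  fixes f :: "'a \<Rightarrow>\<^sub>0 'b::comm_monoid_add"
  assumes "Poly_Mapping.keys f \<subseteq> M" and "P 0"
    and "\<And>m c. m \<in> M \<Longrightarrow> P (Poly_Mapping.single m c)"
    and "\<And>g h. P g \<Longrightarrow> P h \<Longrightarrow> P (g + h)"
  shows "P f"
proof -
  have "f = (\<Sum>m\<in>Poly_Mapping.keys f. Poly_Mapping.single m (Poly_Mapping.lookup f m))"
    by (rule poly_mapping_eqI) (auto simp: lookup_sum lookup_single when_def in_keys_iff)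
  moreover have "P (\<Sum>m\<in>S. Poly_Mapping.single m (Poly_Mapping.lookup f m))" if "S \<subseteq> M" "finite S" for S
    using that(2,1) by (induction S rule: finite_induct) (auto intro: assms)
  ultimately show ?thesis using assms(1) by (metis finite_keys)
qed

section \<open>Exchanging two variables\<close>

abbreviation var :: "indet \<Rightarrow> laurent" where
  "var u \<equiv> var_pow u 1"

definition swap_var :: "indet \<Rightarrow> indet \<Rightarrow> laurent \<Rightarrow> laurent" where
  "swap_var u v = Poly_Mapping.map_key (Poly_Mapping.map_key (transpose u v))"

lemma inj_transpose [simp]: "inj (transpose u v)"
  by (simp add: bij_is_inj)

lemma lookup_map_key [simp]: "inj h \<Longrightarrow> Poly_Mapping.lookup (Poly_Mapping.map_key h p) x = Poly_Mapping.lookup p (h x)"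
  by (simp add: map_key.rep_eq)

lemma map_key_transpose_invol [simp]:
  "Poly_Mapping.map_key (transpose u v) (Poly_Mapping.map_key (transpose u v) m) = m"
  by (rule poly_mapping_eqI) simp

lemma inj_map_key_transpose [simp]:
  "inj (Poly_Mapping.map_key (transpose u v) :: ('a \<Rightarrow>\<^sub>0 'c::zero) \<Rightarrow> _)"
  by (rule inj_on_inverseI[where g = "Poly_Mapping.map_key (transpose u v)"]) simp

lemma swap_var_0 [simp]: "swap_var u v 0 = 0"
  unfolding swap_var_def by (rule poly_mapping_eqI) simp

lemma swap_var_add: "swap_var u v (f + g) = swap_var u v f + swap_var u v g"
  unfolding swap_var_def by (rule poly_mapping_eqI) (simp add: lookup_add)

lemma swap_var_diff: "swap_var u v (f - g) = swap_var u v f - swap_var u v g"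
  unfolding swap_var_def by (rule poly_mapping_eqI) (simp add: lookup_minus)

lemma swap_var_single:
  "swap_var u v (Poly_Mapping.single m c) = Poly_Mapping.single (Poly_Mapping.map_key (transpose u v) m) c"
  unfolding swap_var_def
  using map_key_single[OF inj_map_key_transpose, of u v "Poly_Mapping.map_key (transpose u v) m" c]
  by simp

lemma swap_var_mult: "swap_var u v (f * g) = swap_var u v f * swap_var u v g"
proof (rule poly_mapping_induct_keys[of f UNIV])
  fix m :: "indet \<Rightarrow>\<^sub>0 int" and c :: int
  show "swap_var u v (Poly_Mapping.single m c * g) = swap_var u v (Poly_Mapping.single m c) * swap_var u v g"
  proof (rule poly_mapping_induct_keys[of g UNIV])
    fix m' :: "indet \<Rightarrow>\<^sub>0 int" and c' :: int
    show "swap_var u v (Poly_Mapping.single m c * Poly_Mapping.single m' c') =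
        swap_var u v (Poly_Mapping.single m c) * swap_var u v (Poly_Mapping.single m' c')"
      by (simp add: mult_single swap_var_single map_key_plus)
  qed (simp_all add: swap_var_add distrib_left)
qed (simp_all add: swap_var_add distrib_right)

lemma swap_var_one [simp]: "swap_var u v 1 = 1"
proof -
  have "Poly_Mapping.map_key (transpose u v) 0 = (0 :: indet \<Rightarrow>\<^sub>0 int)"
    by (rule poly_mapping_eqI) simp
  then show ?thesis
    unfolding single_one[symmetric] by (simp only: swap_var_single)
qed

lemma swap_var_prod: "swap_var u v (prod f A) = (\<Prod>a\<in>A. swap_var u v (f a))"
  by (induction A rule: infinite_finite_induct) (simp_all add: swap_var_mult)

lemma map_key_transpose_single:
  "Poly_Mapping.map_key (transpose u v) (Poly_Mapping.single w e) = Poly_Mapping.single (transpose u v w) e"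
  by (metis inj_transpose map_key_single transpose_involutory)

lemma swap_var_var_pow [simp]: "swap_var u v (var_pow w e) = var_pow (transpose u v w) e"
  by (simp add: var_pow_def swap_var_single map_key_transpose_single)

lemma swap_var_invol [simp]: "swap_var u v (swap_var u v f) = f"
  unfolding swap_var_def by (rule poly_mapping_eqI) simp

text \<open>Pulling back exponents along a permutation of the variables reverses composition, and
  pulling back coefficients along the resulting map reverses it again, so an identity between
  transpositions carries over in the same order. It yields the commutation and braid
  relations.\<close>

lemma swap_var_conj:
  assumes "\<And>w. transpose u v (transpose u'' v'' w) = transpose u' v' (transpose u v w)"
  shows "swap_var u v (swap_var u'' v'' f) = swap_var u' v' (swap_var u v f)"
proof -
  have "Poly_Mapping.map_key (transpose u'' v'') (Poly_Mapping.map_key (transpose u v) m) =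
      Poly_Mapping.map_key (transpose u v) (Poly_Mapping.map_key (transpose u' v') m)" for m :: "indet \<Rightarrow>\<^sub>0 int"
    by (rule poly_mapping_eqI) (simp add: assms)
  then show ?thesis unfolding swap_var_def by (intro poly_mapping_eqI) simp
qed

lemma var_pow_add: "var_pow u (d + e) = var_pow u d * var_pow u e"
  by (simp add: var_pow_def mult_single single_add)

lemma var_pow_0 [simp]: "var_pow u 0 = 1"
  by (simp add: var_pow_def)

lemma var_inverse [simp]: "var_pow u 1 * var_pow u (-1) = 1" "var_pow u (-1) * var_pow u 1 = 1"
  using var_pow_add[of u 1 "-1"] var_pow_add[of u "-1" 1] by simp_all

lemma var_neq: "u \<noteq> v \<Longrightarrow> var u - var v \<noteq> 0"
proof
  assume "u \<noteq> v" and "var u - var v = 0"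
  then have "Poly_Mapping.single u (1::int) = Poly_Mapping.single v 1"
    unfolding var_pow_def by (metis eq_iff_diff_eq_0 lookup_single_eq lookup_single_not_eq one_neq_zero)
  with \<open>u \<noteq> v\<close> show False
    by (metis lookup_single_eq lookup_single_not_eq one_neq_zero)
qed

section \<open>Laurent polynomials in a prescribed set of variables\<close>

definition laurent_on :: "indet set \<Rightarrow> laurent set" where
  "laurent_on W = {f. \<forall>m\<in>Poly_Mapping.keys f. Poly_Mapping.keys m \<subseteq> W}"

lemma laurent_on_0 [simp]: "0 \<in> laurent_on W" and laurent_on_1 [simp]: "1 \<in> laurent_on W"
  by (simp_all add: laurent_on_def)

lemma laurent_on_add: "f \<in> laurent_on W \<Longrightarrow> g \<in> laurent_on W \<Longrightarrow> f + g \<in> laurent_on W"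
  using Poly_Mapping.keys_add[of f g] by (auto simp: laurent_on_def)

lemma laurent_on_uminus: "f \<in> laurent_on W \<Longrightarrow> - f \<in> laurent_on W"
  by (auto simp: laurent_on_def)

lemma laurent_on_diff: "f \<in> laurent_on W \<Longrightarrow> g \<in> laurent_on W \<Longrightarrow> f - g \<in> laurent_on W"
  using laurent_on_add[of f W "- g"] laurent_on_uminus by simp

lemma laurent_on_mult: "f \<in> laurent_on W \<Longrightarrow> g \<in> laurent_on W \<Longrightarrow> f * g \<in> laurent_on W"
proof -
  assume *: "f \<in> laurent_on W" "g \<in> laurent_on W"
  have "Poly_Mapping.keys m \<subseteq> W" if m: "m \<in> Poly_Mapping.keys (f * g)" for m
  proof -
    obtain a b where "a \<in> Poly_Mapping.keys f" "b \<in> Poly_Mapping.keys g" "m = a + b"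
      using keys_mult[of f g] m by blast
    then show ?thesis
      using * Poly_Mapping.keys_add[of a b] by (fastforce simp: laurent_on_def)
  qed
  then show ?thesis by (simp add: laurent_on_def)
qed

lemma laurent_on_prod: "(\<And>a. a \<in> A \<Longrightarrow> f a \<in> laurent_on W) \<Longrightarrow> prod f A \<in> laurent_on W"
  by (induction A rule: infinite_finite_induct) (auto intro: laurent_on_mult)

lemma laurent_on_sum: "(\<And>a. a \<in> A \<Longrightarrow> f a \<in> laurent_on W) \<Longrightarrow> sum f A \<in> laurent_on W"
  by (induction A rule: infinite_finite_induct) (auto intro: laurent_on_add)

lemma laurent_on_single: "Poly_Mapping.keys m \<subseteq> W \<Longrightarrow> Poly_Mapping.single m c \<in> laurent_on W"
  by (simp add: laurent_on_def)

lemma laurent_on_var_pow: "u \<in> W \<Longrightarrow> var_pow u e \<in> laurent_on W"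
  unfolding var_pow_def by (rule laurent_on_single) simp

lemma laurent_on_power: "f \<in> laurent_on W \<Longrightarrow> f ^ m \<in> laurent_on W"
  by (induction m) (auto intro: laurent_on_mult)

text \<open>Exponents may be negative, so the common power with the smaller exponent is split off;
  up to sign, u^k - v^k with a natural number k remains.\<close>

lemma var_pow_diff_dvd:
  assumes "u \<in> W" "v \<in> W"
  shows "\<exists>g\<in>laurent_on W. g * (var u - var v) = var_pow u d * var_pow v e - var_pow v d * var_pow u e"
proof -
  have mult: "\<exists>g\<in>laurent_on W. g * (var u - var v) = var_pow u a * var_pow v b * h"
    if "\<exists>g\<in>laurent_on W. g * (var u - var v) = h" for a b h
    using that assms by (metis (no_types, lifting) laurent_on_mult laurent_on_var_pow mult.assoc)
  have pow: "var_pow w (int k) = var w ^ k" for w k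
    by (induction k) (simp_all add: var_pow_add)
  have nat: "\<exists>g\<in>laurent_on W. g * (var u - var v) = var_pow u (int k) - var_pow v (int k)" for k
    unfolding pow power_diff_sumr2
    by (intro bexI[of _ "\<Sum>i<k. var v ^ (k - Suc i) * var u ^ i"])
       (auto intro!: laurent_on_sum laurent_on_mult laurent_on_power laurent_on_var_pow assms)
  show ?thesis
  proof (cases "d \<ge> e")
    case True
    then obtain k where k: "d = e + int k" by (metis zle_iff_zadd)
    show ?thesis
      using mult[OF nat[of k], of e e] by (simp add: k var_pow_add algebra_simps)
  next
    case False
    then obtain k where k: "e = d + int k" by (metis linorder_le_cases zle_iff_zadd)
    from mult[OF nat[of k], of d d] obtain g where "g \<in> laurent_on W"
      "g * (var u - var v) = var_pow u d * var_pow v d * (var_pow u (int k) - var_pow v (int k))" by blast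
    then show ?thesis
      by (intro bexI[of _ "- g"]) (simp_all add: k var_pow_add algebra_simps laurent_on_uminus)
  qed
qed

section \<open>Existence of the operators and relations between them\<close>

definition demazure :: "indet \<Rightarrow> indet \<Rightarrow> laurent \<Rightarrow> laurent" where
  "demazure u v f = (THE g. g * (var u - var v) = var u * f - var v * swap_var u v f)"

lemma isobaric_demazure: "isobaric i = demazure (X i) (X (Suc i))"
  by (simp add: fun_eq_iff isobaric_def demazure_def swap_x_def swap_var_def)

text \<open>The defining equation is additive in f, so monomials suffice. The quotient is found
  inside \<open>laurent_on W\<close>; this later keeps the operators within the ring that carries
  the ideal.\<close>

lemma demazure_exists:
  assumes "u \<in> W" "v \<in> W" "u \<noteq> v" "f \<in> laurent_on W"
  shows "\<exists>g\<in>laurent_on W. g * (var u - var v) = var u * f - var v * swap_var u v f"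
proof (rule poly_mapping_induct_keys[of f "{m. Poly_Mapping.keys m \<subseteq> W}"])
  fix m :: "indet \<Rightarrow>\<^sub>0 int" and c :: int
  assume "m \<in> {m. Poly_Mapping.keys m \<subseteq> W}"
  then have m: "Poly_Mapping.keys m \<subseteq> W" by simp
  \<comment> \<open>The part of the monomial free of u and v. The exchange fixes it, so only powers
    of u and v have to be divided.\<close>
  define r where "r = m - Poly_Mapping.single u (Poly_Mapping.lookup m u) - Poly_Mapping.single v (Poly_Mapping.lookup m v)"
  define d e where "d = Poly_Mapping.lookup m u" and "e = Poly_Mapping.lookup m v"
  have mono: "Poly_Mapping.single m c = var_pow u d * var_pow v e * Poly_Mapping.single r c"
    by (simp add: var_pow_def mult_single r_def d_def e_def)
  have r0: "Poly_Mapping.lookup r u = 0" "Poly_Mapping.lookup r v = 0"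
    using \<open>u \<noteq> v\<close> by (simp_all add: r_def lookup_minus lookup_single)
  have "Poly_Mapping.map_key (transpose u v) r = r"
    by (rule poly_mapping_eqI) (simp add: r0 transpose_def)
  then have r: "swap_var u v (Poly_Mapping.single r c) = Poly_Mapping.single r c"
    by (simp add: swap_var_single)
  have "Poly_Mapping.keys r \<subseteq> W"
    using m by (auto simp: r_def in_keys_iff lookup_minus lookup_single when_def split: if_splits)
  then have rW: "Poly_Mapping.single r c \<in> laurent_on W" by (rule laurent_on_single)
  obtain g where g: "g \<in> laurent_on W"
    "g * (var u - var v) = var_pow u (1 + d) * var_pow v e - var_pow v (1 + d) * var_pow u e"
    using var_pow_diff_dvd[OF assms(1,2)] by blast
  have "g * Poly_Mapping.single r c * (var u - var v) =
      (g * (var u - var v)) * Poly_Mapping.single r c" by (simp add: mult_ac)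
  also have "\<dots> = var u * Poly_Mapping.single m c - var v * swap_var u v (Poly_Mapping.single m c)"
    unfolding mono swap_var_mult r g(2) by (simp add: var_pow_add algebra_simps)
  finally show "\<exists>g\<in>laurent_on W. g * (var u - var v) =
      var u * Poly_Mapping.single m c - var v * swap_var u v (Poly_Mapping.single m c)"
    using g(1) rW laurent_on_mult by blast
next
  fix g h
  assume "\<exists>g'\<in>laurent_on W. g' * (var u - var v) = var u * g - var v * swap_var u v g"
    "\<exists>h'\<in>laurent_on W. h' * (var u - var v) = var u * h - var v * swap_var u v h"
  then obtain g' h' where "g' \<in> laurent_on W" "g' * (var u - var v) = var u * g - var v * swap_var u v g"
    "h' \<in> laurent_on W" "h' * (var u - var v) = var u * h - var v * swap_var u v h" by blast
  then show "\<exists>g'\<in>laurent_on W. g' * (var u - var v) = var u * (g + h) - var v * swap_var u v (g + h)"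
    by (intro bexI[of _ "g' + h'"]) (simp_all add: laurent_on_add swap_var_add algebra_simps)
qed (use assms in \<open>auto simp: laurent_on_def intro: bexI[of _ 0]\<close>)

lemma demazure_eq:
  assumes "u \<noteq> v"
  shows "demazure u v f * (var u - var v) = var u * f - var v * swap_var u v f"
proof -
  have "f \<in> laurent_on UNIV" by (simp add: laurent_on_def)
  then obtain g where "g * (var u - var v) = var u * f - var v * swap_var u v f"
    using demazure_exists[of u UNIV v] assms by blast
  then show ?thesis
    unfolding demazure_def by (rule theI) (metis assms mult_cancel_right var_neq \<open>g * _ = _\<close>)
qed

lemma demazure_eqI:
  assumes "u \<noteq> v" "g * (var u - var v) = var u * f - var v * swap_var u v f"
  shows "demazure u v f = g"
  using demazure_eq[OF assms(1)] assms by (metis mult_cancel_right var_neq)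

lemma demazure_closed:
  assumes "u \<in> W" "v \<in> W" "u \<noteq> v" "f \<in> laurent_on W"
  shows "demazure u v f \<in> laurent_on W"
  using demazure_exists[OF assms] demazure_eqI[OF assms(3)] by metis

lemma demazure_add:
  assumes "u \<noteq> v"
  shows "demazure u v (f + g) = demazure u v f + demazure u v g"
  using demazure_eq[OF assms] by (intro demazure_eqI[OF assms]) (simp add: swap_var_add algebra_simps)

text \<open>This linearity lets the operators pass 1/(x_1 ... x_k) and the symmetric part of the
  product of the y.\<close>

lemma demazure_mult_symmetric:
  assumes "u \<noteq> v" "swap_var u v g = g"
  shows "demazure u v (g * f) = g * demazure u v f"
proof (rule demazure_eqI[OF assms(1)])
  have "g * demazure u v f * (var u - var v) = g * (var u * f - var v * swap_var u v f)"
    by (simp add: demazure_eq[OF assms(1)] mult.assoc)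
  then show "g * demazure u v f * (var u - var v) = var u * (g * f) - var v * swap_var u v (g * f)"
    by (simp add: swap_var_mult assms(2) algebra_simps)
qed

lemma demazure_one [simp]: "u \<noteq> v \<Longrightarrow> demazure u v 1 = 1"
  by (rule demazure_eqI) simp_all

lemma demazure_symmetric: "u \<noteq> v \<Longrightarrow> swap_var u v g = g \<Longrightarrow> demazure u v g = g"
  using demazure_mult_symmetric[of u v g 1] by simp

lemma demazure_0 [simp]: "u \<noteq> v \<Longrightarrow> demazure u v 0 = 0"
  by (rule demazure_symmetric) simp_all

lemma demazure_uminus: "u \<noteq> v \<Longrightarrow> demazure u v (- f) = - demazure u v f"
  using demazure_add[of u v f "- f"] by (simp add: eq_neg_iff_add_eq_0 add.commute)

lemma demazure_diff: "u \<noteq> v \<Longrightarrow> demazure u v (f - g) = demazure u v f - demazure u v g"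
  using demazure_add[of u v f "- g"] by (simp add: demazure_uminus)

lemma demazure_sum: "u \<noteq> v \<Longrightarrow> demazure u v (sum f A) = (\<Sum>a\<in>A. demazure u v (f a))"
  by (induction A rule: infinite_finite_induct) (simp_all add: demazure_add)

lemma swap_var_demazure:
  assumes "u \<noteq> v"
  shows "swap_var u v (demazure u v f) = demazure u v f"
proof (rule demazure_eqI[OF assms, symmetric])
  have "swap_var u v (demazure u v f * (var u - var v)) = swap_var u v (var u * f - var v * swap_var u v f)"
    by (simp add: demazure_eq[OF assms])
  then show "swap_var u v (demazure u v f) * (var u - var v) = var u * f - var v * swap_var u v f"
    by (simp add: swap_var_mult swap_var_diff algebra_simps)
qed

lemma demazure_idem: "u \<noteq> v \<Longrightarrow> demazure u v (demazure u v f) = demazure u v f"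
  by (simp add: demazure_symmetric swap_var_demazure)

text \<open>The rule for an asymmetric factor 1/u. It is applied to 1/y_(i+1) when exactly one of
  the values i, i+1 stands in the first k positions, and its term \<open>- f\<close> is the source
  of D - id in that case.\<close>

lemma demazure_inverse_var:
  assumes "u \<noteq> v"
  shows "demazure u v (var_pow u (-1) * f) = var_pow v (-1) * (demazure u v f - f)"
proof (rule demazure_eqI[OF assms])
  have "var_pow v (-1) * (demazure u v f - f) * (var u - var v)
      = var_pow v (-1) * (demazure u v f * (var u - var v)) - var_pow v (-1) * f * (var u - var v)"
    by (simp add: algebra_simps)
  also have "\<dots> = (var_pow v (-1) * var v) * (f - swap_var u v f)"
    unfolding demazure_eq[OF assms] by (simp add: algebra_simps)
  also have "\<dots> = (var u * var_pow u (-1)) * f - (var v * var_pow v (-1)) * swap_var u v f"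
    by simp
  also have "\<dots> = var u * (var_pow u (-1) * f) - var v * swap_var u v (var_pow u (-1) * f)"
    by (simp add: swap_var_mult mult.assoc[symmetric])
  finally show "var_pow v (-1) * (demazure u v f - f) * (var u - var v) = \<dots>" .
qed

text \<open>The effect of the operator in y on the one factor of \<open>groth_top\<close> that is
  not symmetric in y_i and y_(i+1).\<close>

lemma demazure_var_symmetric:
  assumes "u \<noteq> v" "swap_var u v c = c"
  shows "demazure u v (1 - var v * c) = 1"
proof (rule demazure_eqI[OF assms(1)])
  show "1 * (var u - var v) = var u * (1 - var v * c) - var v * swap_var u v (1 - var v * c)"
    by (simp add: swap_var_diff swap_var_mult assms(2) algebra_simps)
qed

lemma swap_var_demazure_disjoint:
  assumes "{u, v} \<inter> {u', v'} = {}" "u \<noteq> v"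
  shows "swap_var u' v' (demazure u v f) = demazure u v (swap_var u' v' f)"
proof (rule demazure_eqI[OF assms(2), symmetric])
  have t: "transpose u' v' u = u" "transpose u' v' v = v"
    using assms by (auto intro: transpose_apply_other)
  have "swap_var u' v' (demazure u v f * (var u - var v)) = swap_var u' v' (var u * f - var v * swap_var u v f)"
    by (simp add: demazure_eq[OF assms(2)])
  moreover have "swap_var u' v' (swap_var u v f) = swap_var u v (swap_var u' v' f)"
    by (rule swap_var_conj) (use assms in \<open>auto simp: transpose_def\<close>)
  ultimately show "swap_var u' v' (demazure u v f) * (var u - var v) =
      var u * swap_var u' v' f - var v * swap_var u v (swap_var u' v' f)"
    by (simp add: swap_var_mult swap_var_diff t)
qed

text \<open>Since u - v is fixed by the exchange of u' and v', the defining equation of one operator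
  can be carried through the other.\<close>

lemma demazure_commute:
  assumes "{u, v} \<inter> {u', v'} = {}" "u \<noteq> v" "u' \<noteq> v'"
  shows "demazure u v (demazure u' v' f) = demazure u' v' (demazure u v f)"
proof (rule demazure_eqI[OF assms(2)])
  have t: "swap_var u' v' (var u) = var u" "swap_var u' v' (var v) = var v"
    "swap_var u' v' (var u - var v) = var u - var v"
    using assms by (auto simp: swap_var_diff transpose_apply_other)
  have "demazure u' v' (demazure u v f) * (var u - var v) = demazure u' v' ((var u - var v) * demazure u v f)"
    by (simp only: demazure_mult_symmetric[OF assms(3) t(3)] mult.commute[of _ "var u - var v"])
  also have "\<dots> = demazure u' v' (var u * f - var v * swap_var u v f)"
    by (simp add: demazure_eq[OF assms(2)] mult.commute)
  also have "\<dots> = var u * demazure u' v' f - var v * demazure u' v' (swap_var u v f)"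
    by (simp only: demazure_diff[OF assms(3)] demazure_mult_symmetric[OF assms(3)] t)
  also have "demazure u' v' (swap_var u v f) = swap_var u v (demazure u' v' f)"
    by (rule swap_var_demazure_disjoint[symmetric]) (use assms in auto)
  finally show "demazure u' v' (demazure u v f) * (var u - var v) =
      var u * demazure u' v' f - var v * swap_var u v (demazure u' v' f)" .
qed

text \<open>Multiplied by the Vandermonde product \<open>D\<close>, either side becomes the
  alternating sum of the images of x^2 y f under the six permutations of the three variables, as in
  Weyl's character formula. The two expansions differ only in how the longest element is written, as
  sts or as tst.\<close>

lemma demazure_braid:
  assumes "u \<noteq> v" "v \<noteq> w" "u \<noteq> w"
  shows "demazure u v (demazure v w (demazure u v f)) = demazure v w (demazure u v (demazure v w f))"
proof -
  let ?x = "var u" and ?y = "var v" and ?z = "var w"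
  let ?s = "swap_var u v" and ?t = "swap_var v w"
  define D where "D = (?x - ?y) * (?x - ?z) * (?y - ?z)"
  have D: "D \<noteq> 0" using var_neq assms by (simp add: D_def)
  have sts: "?s (?t (?s g)) = ?t (?s (?t g))" for g
  proof -
    have "?s (?t (?s g)) = swap_var u w (?s (?s g))"
      by (rule swap_var_conj) (use assms in \<open>auto simp: transpose_def\<close>)
    moreover have "?t (?s (?t g)) = swap_var u w (?t (?t g))"
      by (rule swap_var_conj) (use assms in \<open>auto simp: transpose_def\<close>)
    ultimately show ?thesis by simp
  qed
  have "transpose v w u = u" "transpose u v w = w"
    using assms by (simp_all add: transpose_apply_other)
  note tr = this
  note sw = swap_var_mult swap_var_diff tr
  have st: "demazure u v (demazure v w (demazure u v f)) * D =
      ?x * ?x * ?y * f - ?y * ?y * ?x * ?s f - ?x * ?x * ?z * ?t f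
      + ?y * ?y * ?z * ?s (?t f) + ?z * ?z * ?x * ?t (?s f) - ?z * ?z * ?y * ?s (?t (?s f))"
  proof -
    define a b c where "a = demazure u v f" and "b = demazure v w a" and "c = demazure u v b"
    have a: "a * (?x - ?y) = ?x * f - ?y * ?s f"
      and b: "b * (?y - ?z) = ?y * a - ?z * ?t a"
      and c: "c * (?x - ?y) = ?x * b - ?y * ?s b"
      using assms by (simp_all add: a_def b_def c_def demazure_eq)
    from a have "?t (a * (?x - ?y)) = ?t (?x * f - ?y * ?s f)" by simp
    then have ta: "?t a * (?x - ?z) = ?x * ?t f - ?z * ?t (?s f)" by (simp add: sw)
    have bD: "b * D = ?y * (?x - ?z) * (?x * f - ?y * ?s f) - ?z * (?x - ?y) * (?x * ?t f - ?z * ?t (?s f))"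
    proof -
      have "b * D = (b * (?y - ?z)) * ((?x - ?y) * (?x - ?z))" by (simp add: D_def mult_ac)
      also have "\<dots> = ?y * (?x - ?z) * (a * (?x - ?y)) - ?z * (?x - ?y) * (?t a * (?x - ?z))"
        unfolding b by (simp add: algebra_simps)
      finally show ?thesis unfolding a ta .
    qed
    have sD: "?s D = - D" unfolding D_def sw by (simp add: tr) (simp add: algebra_simps)
    from bD have "?s (b * D) = ?s (?y * (?x - ?z) * (?x * f - ?y * ?s f) - ?z * (?x - ?y) * (?x * ?t f - ?z * ?t (?s f)))"
      by simp
    then have sbD: "- (?s b * D) = ?x * (?y - ?z) * (?y * ?s f - ?x * f) - ?z * (?y - ?x) * (?y * ?s (?t f) - ?z * ?s (?t (?s f)))"
      by (simp add: sw sD)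
    have "c * D * (?x - ?y) = (c * (?x - ?y)) * D" by (simp only: mult_ac)
    also have "\<dots> = ?x * (b * D) + ?y * (- (?s b * D))"
      unfolding c by (simp add: algebra_simps)
    also have "\<dots> = (?x - ?y) * (?x * ?x * ?y * f - ?y * ?y * ?x * ?s f - ?x * ?x * ?z * ?t f
      + ?y * ?y * ?z * ?s (?t f) + ?z * ?z * ?x * ?t (?s f) - ?z * ?z * ?y * ?s (?t (?s f)))"
      unfolding bD sbD by (simp add: algebra_simps)
    finally show ?thesis
      using var_neq[OF assms(1)] by (simp add: a_def b_def c_def mult.commute[of _ "?x - ?y"])
  qed
  have ts: "demazure v w (demazure u v (demazure v w f)) * D =
      ?x * ?x * ?y * f - ?y * ?y * ?x * ?s f - ?x * ?x * ?z * ?t f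
      + ?y * ?y * ?z * ?s (?t f) + ?z * ?z * ?x * ?t (?s f) - ?z * ?z * ?y * ?t (?s (?t f))"
  proof -
    define a b c where "a = demazure v w f" and "b = demazure u v a" and "c = demazure v w b"
    have a: "a * (?y - ?z) = ?y * f - ?z * ?t f"
      and b: "b * (?x - ?y) = ?x * a - ?y * ?s a"
      and c: "c * (?y - ?z) = ?y * b - ?z * ?t b"
      using assms by (simp_all add: a_def b_def c_def demazure_eq)
    from a have "?s (a * (?y - ?z)) = ?s (?y * f - ?z * ?t f)" by simp
    then have sa: "?s a * (?x - ?z) = ?x * ?s f - ?z * ?s (?t f)" by (simp add: sw)
    have bD: "b * D = ?x * (?x - ?z) * (?y * f - ?z * ?t f) - ?y * (?y - ?z) * (?x * ?s f - ?z * ?s (?t f))"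
    proof -
      have "b * D = (b * (?x - ?y)) * ((?y - ?z) * (?x - ?z))" by (simp add: D_def mult_ac)
      also have "\<dots> = ?x * (?x - ?z) * (a * (?y - ?z)) - ?y * (?y - ?z) * (?s a * (?x - ?z))"
        unfolding b by (simp add: algebra_simps)
      finally show ?thesis unfolding a sa .
    qed
    have tD: "?t D = - D" unfolding D_def sw by (simp add: tr) (simp add: algebra_simps)
    from bD have "?t (b * D) = ?t (?x * (?x - ?z) * (?y * f - ?z * ?t f) - ?y * (?y - ?z) * (?x * ?s f - ?z * ?s (?t f)))"
      by simp
    then have tbD: "- (?t b * D) = ?x * (?x - ?y) * (?z * ?t f - ?y * f) - ?z * (?z - ?y) * (?x * ?t (?s f) - ?y * ?t (?s (?t f)))"
      by (simp add: sw tD)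
    have "c * D * (?y - ?z) = (c * (?y - ?z)) * D" by (simp only: mult_ac)
    also have "\<dots> = ?y * (b * D) + ?z * (- (?t b * D))"
      unfolding c by (simp add: algebra_simps)
    also have "\<dots> = (?y - ?z) * (?x * ?x * ?y * f - ?y * ?y * ?x * ?s f - ?x * ?x * ?z * ?t f
      + ?y * ?y * ?z * ?s (?t f) + ?z * ?z * ?x * ?t (?s f) - ?z * ?z * ?y * ?t (?s (?t f)))"
      unfolding bD tbD by (simp add: algebra_simps)
    finally show ?thesis
      using var_neq[OF assms(2)] by (simp add: a_def b_def c_def mult.commute[of _ "?y - ?z"])
  qed
  from trans[OF st[unfolded sts] ts[symmetric]] D show ?thesis by simp
qed

section \<open>Length, and left and right recursions for Grothendieck polynomials\<close>

declare One_nat_def [simp del]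

abbreviation pos :: "(nat \<Rightarrow> nat) \<Rightarrow> nat \<Rightarrow> nat" where
  "pos \<sigma> \<equiv> inv_into UNIV \<sigma>"

section \<open>Inversions, ascents and descending induction\<close>

lemma sum_pair_split:
  fixes h :: "'a \<Rightarrow> 'a \<Rightarrow> nat"
  assumes "finite R" "a \<noteq> b" "a \<notin> R" "b \<notin> R"
  shows "(\<Sum>i\<in>insert a (insert b R). \<Sum>j\<in>insert a (insert b R). h i j) =
    h a a + h a b + h b a + h b b + (\<Sum>j\<in>R. h a j + h b j + h j a + h j b) + (\<Sum>i\<in>R. \<Sum>j\<in>R. h i j)"
  using assms by (simp add: sum.distrib)

lemma perm_length_sum:
  "perm_length n \<sigma> = (\<Sum>i\<in>{1..n}. \<Sum>j\<in>{1..n}. if i < j \<and> \<sigma> i > \<sigma> j then 1 else 0)"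
proof -
  let ?A = "{1..n} \<times> {1..n}" and ?P = "\<lambda>p. fst p < snd p \<and> \<sigma> (fst p) > \<sigma> (snd p)"
  have "{(i, j). 1 \<le> i \<and> i < j \<and> j \<le> n \<and> \<sigma> i > \<sigma> j} = {p \<in> ?A. ?P p}"
    by auto
  then have "perm_length n \<sigma> = (\<Sum>p\<in>{p \<in> ?A. ?P p}. 1)"
    unfolding perm_length_def by simp
  also have "\<dots> = (\<Sum>p\<in>?A. if ?P p then 1 else 0)"
    by (rule sum.inter_filter) simp
  also have "\<dots> = (\<Sum>i\<in>{1..n}. \<Sum>j\<in>{1..n}. if i < j \<and> \<sigma> i > \<sigma> j then 1 else 0)"
    by (simp only: sum.cartesian_product case_prod_unfold)
  finally show ?thesis .
qed

text \<open>Only pairs meeting {a, b} can change. The pair (a, b) becomes an inversion, and a third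
  position affects the count only if it lies between a and b both in position and in value, in which
  case it adds two.\<close>

lemma perm_length_transpose:
  assumes "inj_on \<sigma> {1..n}" "1 \<le> a" "a < b" "b \<le> n" "\<sigma> a < \<sigma> b"
  shows "perm_length n (\<sigma> \<circ> transpose a b) = perm_length n \<sigma> + 1 + 2 * card {j. a < j \<and> j < b \<and> \<sigma> a < \<sigma> j \<and> \<sigma> j < \<sigma> b}"
proof -
  define R where "R = {1..n} - {a, b}"
  define h :: "(nat \<Rightarrow> nat) \<Rightarrow> nat \<Rightarrow> nat \<Rightarrow> nat" where "h \<sigma> i j = (if i < j \<and> \<sigma> i > \<sigma> j then 1 else 0)" for \<sigma> i j
  define \<tau> where "\<tau> = \<sigma> \<circ> transpose a b"
  have ins: "{1..n} = insert a (insert b R)" using assms by (auto simp: R_def)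
  have R: "finite R" "a \<notin> R" "b \<notin> R" "a \<noteq> b" using assms by (auto simp: R_def)
  have \<tau>: "\<tau> a = \<sigma> b" "\<tau> b = \<sigma> a" "\<And>j. j \<in> R \<Longrightarrow> \<tau> j = \<sigma> j"
    using R by (auto simp: \<tau>_def transpose_def)
  have inj: "\<sigma> j \<noteq> \<sigma> a" "\<sigma> j \<noteq> \<sigma> b" if "j \<in> R" for j
    using assms that by (auto simp: R_def inj_on_eq_iff)
  have len: "perm_length n \<rho> = h \<rho> a a + h \<rho> a b + h \<rho> b a + h \<rho> b b
      + (\<Sum>j\<in>R. h \<rho> a j + h \<rho> b j + h \<rho> j a + h \<rho> j b) + (\<Sum>i\<in>R. \<Sum>j\<in>R. h \<rho> i j)" for \<rho>
    unfolding perm_length_sum ins h_def by (rule sum_pair_split) (use R in auto)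
  have "(\<Sum>j\<in>R. h \<tau> a j + h \<tau> b j + h \<tau> j a + h \<tau> j b) =
      (\<Sum>j\<in>R. (h \<sigma> a j + h \<sigma> b j + h \<sigma> j a + h \<sigma> j b) + (if a < j \<and> j < b \<and> \<sigma> a < \<sigma> j \<and> \<sigma> j < \<sigma> b then 2 else 0))"
  proof (rule sum.cong[OF refl])
    fix j assume j: "j \<in> R"
    then have "j \<noteq> a" "j \<noteq> b" using R by auto
    then show "h \<tau> a j + h \<tau> b j + h \<tau> j a + h \<tau> j b = (h \<sigma> a j + h \<sigma> b j + h \<sigma> j a + h \<sigma> j b)
        + (if a < j \<and> j < b \<and> \<sigma> a < \<sigma> j \<and> \<sigma> j < \<sigma> b then 2 else 0)"
      using inj[OF j] assms(3,5) unfolding h_def \<tau>(1,2) \<tau>(3)[OF j] by auto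
  qed
  also have "\<dots> = (\<Sum>j\<in>R. h \<sigma> a j + h \<sigma> b j + h \<sigma> j a + h \<sigma> j b)
      + (\<Sum>j\<in>R. if a < j \<and> j < b \<and> \<sigma> a < \<sigma> j \<and> \<sigma> j < \<sigma> b then 2 else 0)"
    by (rule sum.distrib)
  also have "(\<Sum>j\<in>R. if a < j \<and> j < b \<and> \<sigma> a < \<sigma> j \<and> \<sigma> j < \<sigma> b then 2 else 0) =
      2 * card {j. a < j \<and> j < b \<and> \<sigma> a < \<sigma> j \<and> \<sigma> j < \<sigma> b}"
  proof -
    have "{j \<in> R. a < j \<and> j < b \<and> \<sigma> a < \<sigma> j \<and> \<sigma> j < \<sigma> b} = {j. a < j \<and> j < b \<and> \<sigma> a < \<sigma> j \<and> \<sigma> j < \<sigma> b}"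
      using assms by (auto simp: R_def)
    then show ?thesis using R(1) by (simp add: sum.If_cases Int_def mult.commute)
  qed
  finally have 1: "(\<Sum>j\<in>R. h \<tau> a j + h \<tau> b j + h \<tau> j a + h \<tau> j b) =
      (\<Sum>j\<in>R. h \<sigma> a j + h \<sigma> b j + h \<sigma> j a + h \<sigma> j b)
      + 2 * card {j. a < j \<and> j < b \<and> \<sigma> a < \<sigma> j \<and> \<sigma> j < \<sigma> b}" .
  have 2: "(\<Sum>i\<in>R. \<Sum>j\<in>R. h \<tau> i j) = (\<Sum>i\<in>R. \<Sum>j\<in>R. h \<sigma> i j)"
    by (intro sum.cong refl) (simp add: h_def \<tau>)
  have 3: "h \<tau> a a + h \<tau> a b + h \<tau> b a + h \<tau> b b = 1" "h \<sigma> a a + h \<sigma> a b + h \<sigma> b a + h \<sigma> b b = 0"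
    using assms by (simp_all add: h_def \<tau>)
  show ?thesis using len[of \<tau>] len[of \<sigma>] 1 2 3 by (simp add: \<tau>_def)
qed

lemma transpose_comp_invol [simp]: "\<sigma> \<circ> transpose a b \<circ> transpose a b = \<sigma>"
  by (simp add: comp_assoc)

lemma permutes_comp_transpose:
  "\<sigma> permutes {1..n} \<Longrightarrow> a \<in> {1..n} \<Longrightarrow> b \<in> {1..n} \<Longrightarrow> \<sigma> \<circ> transpose a b permutes {1..n::nat}"
  by (meson permutes_compose permutes_swap_id)

lemma transpose_comp_permutes:
  "\<sigma> permutes {1..n} \<Longrightarrow> a \<in> {1..n} \<Longrightarrow> b \<in> {1..n} \<Longrightarrow> transpose a b \<circ> \<sigma> permutes {1..n::nat}"
  by (meson permutes_compose permutes_swap_id)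

lemma perm_length_less_transpose:
  assumes "\<sigma> permutes {1..n}" "1 \<le> a" "a < b" "b \<le> n" "\<sigma> a < \<sigma> b"
  shows "perm_length n \<sigma> < perm_length n (\<sigma> \<circ> transpose a b)"
  using perm_length_transpose[OF permutes_inj_on[OF assms(1)] assms(2-5)] by simp

lemma perm_length_transpose_less_iff:
  assumes "\<sigma> permutes {1..n}" "1 \<le> a" "a < b" "b \<le> n"
  shows "perm_length n \<sigma> < perm_length n (\<sigma> \<circ> transpose a b) \<longleftrightarrow> \<sigma> a < \<sigma> b"
proof -
  have "\<sigma> a \<noteq> \<sigma> b" using permutes_inj[OF assms(1)] assms(3) by (metis injD less_irrefl)
  moreover have "perm_length n (\<sigma> \<circ> transpose a b) < perm_length n \<sigma>" if "\<sigma> b < \<sigma> a"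
    using perm_length_less_transpose[OF permutes_comp_transpose[OF assms(1)], of a b a b] assms that by simp
  ultimately show ?thesis using perm_length_less_transpose[OF assms] by fastforce
qed

lemma bruhat_covers_transpose_iff:
  assumes "\<sigma> permutes {1..n}" "1 \<le> a" "a < b" "b \<le> n"
  shows "bruhat_covers n \<sigma> (\<sigma> \<circ> transpose a b) \<longleftrightarrow> \<sigma> a < \<sigma> b \<and> (\<forall>j. a < j \<longrightarrow> j < b \<longrightarrow> \<not> (\<sigma> a < \<sigma> j \<and> \<sigma> j < \<sigma> b))"
proof -
  have "finite {j. a < j \<and> j < b \<and> \<sigma> a < \<sigma> j \<and> \<sigma> j < \<sigma> b}" by simp
  then have "card {j. a < j \<and> j < b \<and> \<sigma> a < \<sigma> j \<and> \<sigma> j < \<sigma> b} = 0 \<longleftrightarrow> (\<forall>j. a < j \<longrightarrow> j < b \<longrightarrow> \<not> (\<sigma> a < \<sigma> j \<and> \<sigma> j < \<sigma> b))"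
    by (auto simp: card_eq_0_iff)
  then show ?thesis
    using perm_length_transpose[OF permutes_inj_on[OF assms(1)] assms(2-4)]
      perm_length_transpose_less_iff[OF assms] assms(2-4) unfolding bruhat_covers_def by fastforce
qed

lemma transpose_comp_eq_comp_transpose:
  assumes "inj \<sigma>"
  shows "transpose (\<sigma> p) (\<sigma> q) \<circ> \<sigma> = \<sigma> \<circ> transpose p q"
  by (rule ext) (simp add: transpose_def inj_eq[OF assms])

lemma pos_in: "\<sigma> permutes S \<Longrightarrow> v \<in> S \<Longrightarrow> pos \<sigma> v \<in> S"
  by (simp add: permutes_in_image[OF permutes_inv])

text \<open>Multiplying by s_i on the left exchanges the positions of i and i+1, and no value lies
  strictly between these two.\<close>

lemma perm_length_left_transpose:
  assumes "\<sigma> permutes {1..n}" "1 \<le> i" "i < n" "pos \<sigma> i < pos \<sigma> (Suc i)"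
  shows "perm_length n (transpose i (Suc i) \<circ> \<sigma>) = Suc (perm_length n \<sigma>)"
proof -
  define p q where "p = pos \<sigma> i" and "q = pos \<sigma> (Suc i)"
  have pq: "\<sigma> p = i" "\<sigma> q = Suc i" by (simp_all add: p_def q_def permutes_inverses(1)[OF assms(1)])
  have "p \<in> {1..n}" "q \<in> {1..n}" using pos_in[OF assms(1)] assms by (auto simp: p_def q_def)
  moreover have "p < q" using assms by (simp add: p_def q_def)
  moreover have "transpose i (Suc i) \<circ> \<sigma> = \<sigma> \<circ> transpose p q"
    using transpose_comp_eq_comp_transpose[OF permutes_inj[OF assms(1)], of p q] pq by simp
  moreover have "{j. p < j \<and> j < q \<and> \<sigma> p < \<sigma> j \<and> \<sigma> j < \<sigma> q} = {}" by (auto simp: pq)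
  ultimately show ?thesis
    using perm_length_transpose[OF permutes_inj_on[OF assms(1)], where b = q and a = p] pq
    by (metis One_nat_def add.right_neutral add_Suc_right atLeastAtMost_iff card.empty lessI mult_0_right)
qed

lemma perm_length_le: "perm_length n \<sigma> \<le> n * n"
proof -
  have "{(i, j). 1 \<le> i \<and> i < j \<and> j \<le> n \<and> \<sigma> i > \<sigma> j} \<subseteq> {1..n} \<times> {1..n}" by auto
  from card_mono[OF _ this] show ?thesis by (simp add: perm_length_def)
qed

text \<open>Induction downwards from the longest permutation; the bound n * n on lengths makes it
  well-founded.\<close>

lemma perm_length_induct [consumes 1, case_names longer]:
  assumes "\<sigma> permutes {1..n}"
    and "\<And>\<sigma>. \<sigma> permutes {1..n} \<Longrightarrow> (\<And>\<tau>. \<tau> permutes {1..n} \<Longrightarrow> perm_length n \<sigma> < perm_length n \<tau> \<Longrightarrow> P \<tau>) \<Longrightarrow> P \<sigma>"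
  shows "P \<sigma>"
  using assms(1)
proof (induction "n * n - perm_length n \<sigma>" arbitrary: \<sigma> rule: less_induct)
  case less
  show ?case
  proof (rule assms(2)[OF less.prems])
    fix \<tau> assume "\<tau> permutes {1..n}" "perm_length n \<sigma> < perm_length n \<tau>"
    then show "P \<tau>" using less.hyps[of \<tau>] perm_length_le[of n \<tau>] by simp
  qed
qed

lemma longest_perm_permutes: "longest_perm n permutes {1..n}"
  by (rule bij_imp_permutes, rule bij_betw_byWitness[where f' = "longest_perm n"]) (auto simp: longest_perm_def)

lemma inv_longest_perm: "pos (longest_perm n) = longest_perm n"
  by (rule inv_unique_comp) (auto simp: longest_perm_def fun_eq_iff)

lemma exists_ascent:
  assumes "\<sigma> permutes {1..n}" "\<sigma> \<noteq> longest_perm n"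
  obtains i where "1 \<le> i" "i < n" "\<sigma> i < \<sigma> (Suc i)"
proof (rule ccontr)
  assume "\<not> thesis"
  then have "\<not> \<sigma> i < \<sigma> (Suc i)" if "1 \<le> i" "i < n" for i
    using \<open>\<And>i. 1 \<le> i \<Longrightarrow> i < n \<Longrightarrow> \<sigma> i < \<sigma> (Suc i) \<Longrightarrow> thesis\<close> that by blast
  then have dec: "\<sigma> (Suc i) < \<sigma> i" if "1 \<le> i" "i < n" for i
    using that permutes_inj[OF assms(1)] by (metis injD n_not_Suc_n nat_neq_iff)
  have range: "\<sigma> i \<in> {1..n}" if "i \<in> {1..n}" for i using that permutes_in_image[OF assms(1)] by blast
  \<comment> \<open>Without ascents \<sigma> is strictly decreasing. Counting down from \<sigma> 1
    \<le> n and up from \<sigma> n \<ge> 1 squeezes \<sigma> i to n + 1 - i.\<close>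
  have up: "\<sigma> (Suc i) + Suc i \<le> n + 1" if "Suc i \<le> n" for i
    using that
  proof (induction i)
    case (Suc i)
    then show ?case using dec[of "Suc i"] by simp
  qed (use range[of 1] in \<open>auto simp: One_nat_def\<close>)
  have down: "n + 1 \<le> \<sigma> (n - i) + (n - i)" if "i < n" for i
    using that
  proof (induction i)
    case (Suc i)
    then have "Suc (n - Suc i) = n - i" "1 \<le> n - Suc i" "n - Suc i < n" by auto
    then show ?case using Suc dec[of "n - Suc i"] by simp
  qed (use range[of n] in auto)
  have "\<sigma> i = longest_perm n i" for i
  proof (cases "i \<in> {1..n}")
    case True
    then show ?thesis using up[of "i - 1"] down[of "n - i"] by (simp add: longest_perm_def)
  next
    case False
    then show ?thesis using permutes_not_in[OF assms(1)] by (auto simp: longest_perm_def)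
  qed
  with assms(2) show False by (simp add: fun_eq_iff)
qed

lemma exists_left_ascent:
  assumes "\<sigma> permutes {1..n}" "\<sigma> \<noteq> longest_perm n"
  obtains i where "1 \<le> i" "i < n" "pos \<sigma> i < pos \<sigma> (Suc i)"
proof -
  have "pos \<sigma> \<noteq> longest_perm n" using assms inv_longest_perm by (metis permutes_inv_inv)
  then show ?thesis using exists_ascent[OF permutes_inv[OF assms(1)]] that by blast
qed

section \<open>Independence of the descending path\<close>

lemma groth_rel_permutes: "groth_rel n \<sigma> g \<Longrightarrow> \<sigma> permutes {1..n}"
  by (induction rule: groth_rel.induct) (simp_all add: longest_perm_permutes permutes_comp_transpose del: comp_apply)

lemma groth_rel_step':
  assumes "groth_rel n (\<sigma> \<circ> transpose i (Suc i)) g" "1 \<le> i" "i < n" "\<sigma> i < \<sigma> (Suc i)"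
  shows "groth_rel n \<sigma> (isobaric i g)"
  using groth_rel.step[OF assms(1-3)] assms(4) by simp

lemma groth_rel_inv_step:
  assumes "groth_rel n \<sigma> g" "\<sigma> \<noteq> longest_perm n"
  obtains i h where "1 \<le> i" "i < n" "\<sigma> i < \<sigma> (Suc i)" "groth_rel n (\<sigma> \<circ> transpose i (Suc i)) h" "g = isobaric i h"
  using assms(1)
proof cases
  case (step \<sigma>' h i)
  then show ?thesis using that[of i h] by simp
qed (use assms in auto)

text \<open>
  The value does not depend on the descending path: two last steps can be completed to a common
  longer permutation, where they agree by commutation or by the braid relation.
\<close>

lemma groth_rel_confluent:
  assumes \<sigma>: "\<sigma> permutes {1..n}"
    and IH: "\<And>\<tau>. \<tau> permutes {1..n} \<Longrightarrow> perm_length n \<sigma> < perm_length n \<tau> \<Longrightarrow> \<exists>!g. groth_rel n \<tau> g"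
    and i: "1 \<le> i" "\<sigma> i < \<sigma> (Suc i)" "groth_rel n (\<sigma> \<circ> transpose i (Suc i)) g"
    and j: "j < n" "\<sigma> j < \<sigma> (Suc j)" "groth_rel n (\<sigma> \<circ> transpose j (Suc j)) h"
    and "i < j"
  shows "isobaric i g = isobaric j h"
proof -
  let ?si = "transpose i (Suc i)" and ?sj = "transpose j (Suc j)"
  have perm: "\<tau> \<circ> ?si permutes {1..n}" "\<tau> \<circ> ?sj permutes {1..n}" if "\<tau> permutes {1..n}" for \<tau>
    using that assms by (simp_all add: permutes_comp_transpose)
  have len: "perm_length n \<tau> < perm_length n (\<tau> \<circ> transpose k (Suc k))"
    if "\<tau> permutes {1..n}" "\<tau> k < \<tau> (Suc k)" "1 \<le> k" "k < n" for \<tau> k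
    using that by (intro perm_length_less_transpose) auto
  have uniq: "g1 = g2" if "groth_rel n (\<sigma> \<circ> transpose k (Suc k)) g1" "groth_rel n (\<sigma> \<circ> transpose k (Suc k)) g2"
    "k = i \<or> k = j" for k g1 g2
  proof -
    have "\<exists>!g. groth_rel n (\<sigma> \<circ> transpose k (Suc k)) g"
      using \<open>k = i \<or> k = j\<close> perm[OF \<sigma>] len[OF \<sigma>, of k] assms by (intro IH) auto
    with that(1,2) show ?thesis by blast
  qed
  show ?thesis
  proof (cases "j = Suc i")
    case False
    define \<rho> where "\<rho> = \<sigma> \<circ> ?si \<circ> ?sj"
    have \<rho>': "\<rho> = \<sigma> \<circ> ?sj \<circ> ?si"
      using False \<open>i < j\<close> by (auto simp: \<rho>_def fun_eq_iff transpose_def)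
    have v: "(\<sigma> \<circ> ?si) j = \<sigma> j" "(\<sigma> \<circ> ?si) (Suc j) = \<sigma> (Suc j)" "(\<sigma> \<circ> ?sj) i = \<sigma> i" "(\<sigma> \<circ> ?sj) (Suc i) = \<sigma> (Suc i)"
      using False \<open>i < j\<close> by (auto simp: transpose_def)
    have "perm_length n \<sigma> < perm_length n \<rho>"
      unfolding \<rho>_def using len[OF \<sigma>, of i] len[OF perm(1)[OF \<sigma>], of j] assms v by auto
    then obtain g0 where g0: "groth_rel n \<rho> g0"
      using IH[of \<rho>] perm \<sigma> by (metis \<rho>_def)
    have "groth_rel n (\<sigma> \<circ> ?si) (isobaric j g0)"
      by (rule groth_rel_step') (use g0 v assms in \<open>auto simp: \<rho>_def\<close>)
    moreover have "groth_rel n (\<sigma> \<circ> ?sj) (isobaric i g0)"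
      by (rule groth_rel_step') (use g0 v assms in \<open>auto simp: \<rho>'\<close>)
    ultimately have "g = isobaric j g0" "h = isobaric i g0"
      using uniq i j by blast+
    then show ?thesis
      using False \<open>i < j\<close> by (auto simp: isobaric_demazure intro: demazure_commute)
  next
    case True
    \<comment> \<open>The three ascending values in positions i, i+1, i+2 are reversed; the two
      reduced words for this reversal pass through the two given permutations.\<close>
    define \<rho> where "\<rho> = \<sigma> \<circ> ?si \<circ> ?sj \<circ> ?si"
    have \<rho>': "\<rho> = \<sigma> \<circ> ?sj \<circ> ?si \<circ> ?sj"
      by (auto simp: \<rho>_def fun_eq_iff transpose_def True)
    have v: "(\<sigma> \<circ> ?si) j = \<sigma> i" "(\<sigma> \<circ> ?si) (Suc j) = \<sigma> (Suc j)" "(\<sigma> \<circ> ?sj) i = \<sigma> i" "(\<sigma> \<circ> ?sj) (Suc i) = \<sigma> (Suc j)"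
      "(\<sigma> \<circ> ?si \<circ> ?sj) i = \<sigma> (Suc i)" "(\<sigma> \<circ> ?si \<circ> ?sj) (Suc i) = \<sigma> (Suc j)"
      "(\<sigma> \<circ> ?sj \<circ> ?si) j = \<sigma> i" "(\<sigma> \<circ> ?sj \<circ> ?si) (Suc j) = \<sigma> j"
      by (auto simp: transpose_def True)
    have lt: "\<sigma> i < \<sigma> (Suc j)" using i j True by simp
    have "perm_length n \<sigma> < perm_length n \<rho>"
      unfolding \<rho>_def using len[OF \<sigma>, of i] len[OF perm(1)[OF \<sigma>], of j] len[OF perm(2)[OF perm(1)[OF \<sigma>]], of i]
        assms v lt True by auto
    then obtain g0 where g0: "groth_rel n \<rho> g0"
      using IH[of \<rho>] perm \<sigma> by (metis \<rho>_def)
    have "groth_rel n (\<sigma> \<circ> ?si \<circ> ?sj) (isobaric i g0)"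
      by (rule groth_rel_step') (use g0 v assms True in \<open>auto simp: \<rho>_def\<close>)
    then have "groth_rel n (\<sigma> \<circ> ?si) (isobaric j (isobaric i g0))"
      by (rule groth_rel_step') (use v assms lt True in auto)
    moreover have "groth_rel n (\<sigma> \<circ> ?sj \<circ> ?si) (isobaric j g0)"
      by (rule groth_rel_step') (use g0 v assms True in \<open>auto simp: \<rho>'\<close>)
    then have "groth_rel n (\<sigma> \<circ> ?sj) (isobaric i (isobaric j g0))"
      by (rule groth_rel_step') (use v assms lt True in auto)
    ultimately have "g = isobaric j (isobaric i g0)" "h = isobaric i (isobaric j g0)"
      using uniq i j by blast+
    then show ?thesis
      unfolding isobaric_demazure True by simp (rule demazure_braid; simp)
  qed
qed

lemma groth_rel_ex1:
  assumes "\<sigma> permutes {1..n}"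
  shows "\<exists>!g. groth_rel n \<sigma> g"
  using assms
proof (induction rule: perm_length_induct)
  case (longer \<sigma>)
  show ?case
  proof (cases "\<sigma> = longest_perm n")
    case True
    \<comment> \<open>No descending step ends at the longest permutation, as it has no
      ascent.\<close>
    have "g = groth_top n" if "groth_rel n \<sigma> g" for g
      using that
    proof cases
      case (step \<sigma>' h i)
      then have "longest_perm n i < longest_perm n (Suc i)" by (simp flip: True)
      then show ?thesis using step by (simp add: longest_perm_def)
    qed simp
    then show ?thesis using True groth_rel.top by blast
  next
    case False
    obtain i where i: "1 \<le> i" "i < n" "\<sigma> i < \<sigma> (Suc i)"
      using exists_ascent[OF longer.hyps False] by blast
    have "\<sigma> \<circ> transpose i (Suc i) permutes {1..n}"
      using i longer.hyps by (intro permutes_comp_transpose) auto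
    moreover have "perm_length n \<sigma> < perm_length n (\<sigma> \<circ> transpose i (Suc i))"
      using i by (intro perm_length_less_transpose[OF longer.hyps]) auto
    ultimately obtain g where "groth_rel n (\<sigma> \<circ> transpose i (Suc i)) g"
      using longer.IH by blast
    then have ex: "groth_rel n \<sigma> (isobaric i g)"
      using i by (intro groth_rel_step')
    have "g1 = g2" if g: "groth_rel n \<sigma> g1" "groth_rel n \<sigma> g2" for g1 g2
    proof -
      obtain i h where i: "1 \<le> i" "i < n" "\<sigma> i < \<sigma> (Suc i)" "groth_rel n (\<sigma> \<circ> transpose i (Suc i)) h" "g1 = isobaric i h"
        using groth_rel_inv_step[OF g(1) False] by blast
      obtain j h' where j: "1 \<le> j" "j < n" "\<sigma> j < \<sigma> (Suc j)" "groth_rel n (\<sigma> \<circ> transpose j (Suc j)) h'" "g2 = isobaric j h'"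
        using groth_rel_inv_step[OF g(2) False] by blast
      consider "i < j" | "j < i" | "i = j" by linarith
      then show ?thesis
      proof cases
        case 1
        then show ?thesis using groth_rel_confluent[OF longer.hyps longer.IH] i j by blast
      next
        case 2
        then show ?thesis using groth_rel_confluent[OF longer.hyps longer.IH] i j by metis
      next
        case 3
        have "perm_length n \<sigma> < perm_length n (\<sigma> \<circ> transpose i (Suc i))"
          using i by (intro perm_length_less_transpose[OF longer.hyps]) auto
        then have "h = h'"
          using longer.IH[of "\<sigma> \<circ> transpose i (Suc i)"] i j 3 groth_rel_permutes by blast
        then show ?thesis using i j 3 by simp
      qed
    qed
    with ex show ?thesis by blast
  qed
qed

lemma groth_rel_groth: "\<sigma> permutes {1..n} \<Longrightarrow> groth_rel n \<sigma> (groth n \<sigma>)"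
  unfolding groth_def using theI'[OF groth_rel_ex1] .

lemma groth_eqI: "groth_rel n \<sigma> g \<Longrightarrow> groth n \<sigma> = g"
  using groth_rel_groth groth_rel_ex1 groth_rel_permutes by blast

lemma groth_longest: "groth n (longest_perm n) = groth_top n"
  by (rule groth_eqI) (rule groth_rel.top)

lemma isobaric_groth_descent:
  assumes "\<sigma> permutes {1..n}" "1 \<le> i" "i < n" "\<sigma> i > \<sigma> (Suc i)"
  shows "isobaric i (groth n \<sigma>) = groth n (\<sigma> \<circ> transpose i (Suc i))"
  by (rule groth_eqI[symmetric]) (intro groth_rel.step groth_rel_groth assms)

text \<open>At an ascent G_\<sigma> is itself an image under \<pi>_i, and \<pi>_i is
  idempotent.\<close>

lemma isobaric_groth_ascent:
  assumes "\<sigma> permutes {1..n}" "1 \<le> i" "i < n" "\<sigma> i < \<sigma> (Suc i)"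
  shows "isobaric i (groth n \<sigma>) = groth n \<sigma>"
proof -
  have "isobaric i (groth n (\<sigma> \<circ> transpose i (Suc i))) = groth n \<sigma>"
    using isobaric_groth_descent[OF permutes_comp_transpose[OF assms(1)], of i "Suc i" i] assms by simp
  then show ?thesis
    by (metis demazure_idem indet.inject(1) isobaric_demazure n_not_Suc_n)
qed

text \<open>The factors are indexed by the staircase of cells (a, b) with a + b \<le> n. Without the
  corner (n - i, i) its rows n - i and n - i + 1 have equal length, and so have its columns i and i
  + 1; hence the rest is symmetric in both pairs of variables.\<close>

lemma groth_top_factor:
  assumes "1 \<le> i" "i < n"
  obtains S where "groth_top n = S * (1 - var (Y i) * var_pow (X (n - i)) (-1))"
    "swap_var (X (n - i)) (X (Suc (n - i))) S = S" "swap_var (Y (Suc i)) (Y i) S = S"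
proof -
  let ?m = "n - i"
  define T where "T = (SIGMA a:{1..n}. {1..n - a}) - {(?m, i)}"
  define c where "c p = 1 - var (Y (snd p)) * var_pow (X (fst p)) (-1)" for p :: "nat \<times> nat"
  have fin: "finite T" "(?m, i) \<notin> T" by (auto simp: T_def)
  have "groth_top n = (\<Prod>p\<in>(SIGMA a:{1..n}. {1..n - a}). c p)"
    unfolding groth_top_def c_def by (subst prod.Sigma) (auto simp: case_prod_unfold)
  also have "(SIGMA a:{1..n}. {1..n - a}) = insert (?m, i) T"
    using assms by (auto simp: T_def)
  also have "(\<Prod>p\<in>insert (?m, i) T. c p) = prod c T * c (?m, i)"
    using fin by (simp add: mult.commute)
  finally have "groth_top n = prod c T * (1 - var (Y i) * var_pow (X ?m) (-1))"
    by (simp add: c_def)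
  moreover have "swap_var (X ?m) (X (Suc ?m)) (prod c T) = prod c T"
  proof -
    let ?f = "\<lambda>p. (transpose ?m (Suc ?m) (fst p), snd p)"
    have "transpose (X ?m) (X (Suc ?m)) (X a) = X (transpose ?m (Suc ?m) a)" for a
      by (simp add: transpose_def)
    moreover have "transpose (X ?m) (X (Suc ?m)) (Y a) = Y a" for a
      by (simp add: transpose_def)
    ultimately have "swap_var (X ?m) (X (Suc ?m)) (prod c T) = (\<Prod>p\<in>T. c (?f p))"
      by (simp add: swap_var_prod swap_var_diff swap_var_mult c_def)
    also have "\<dots> = prod c T"
      by (rule prod.reindex_bij_witness[where i = ?f and j = ?f])
        (use assms in \<open>auto simp: T_def transpose_def split: if_splits\<close>)
    finally show ?thesis .
  qed
  moreover have "swap_var (Y (Suc i)) (Y i) (prod c T) = prod c T"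
  proof -
    let ?f = "\<lambda>p. (fst p, transpose (Suc i) i (snd p))"
    have "transpose (Y (Suc i)) (Y i) (Y a) = Y (transpose (Suc i) i a)" for a
      by (simp add: transpose_def)
    moreover have "transpose (Y (Suc i)) (Y i) (X a) = X a" for a
      by (simp add: transpose_def)
    ultimately have "swap_var (Y (Suc i)) (Y i) (prod c T) = (\<Prod>p\<in>T. c (?f p))"
      by (simp add: swap_var_prod swap_var_diff swap_var_mult c_def)
    also have "\<dots> = prod c T"
      by (rule prod.reindex_bij_witness[where i = ?f and j = ?f])
        (use assms in \<open>auto simp: T_def transpose_def split: if_splits\<close>)
    finally show ?thesis .
  qed
  ultimately show ?thesis using that by blast
qed

text \<open>
  Left multiplication by simple transpositions is realised by operators acting on the variables
  \<open>y\<close>; these commute with the operators \<open>\<pi>\<^sub>i\<close>, so it suffices to compare the two at the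
  longest permutation.
\<close>

lemma demazure_Y_groth:
  assumes "\<sigma> permutes {1..n}" and i: "1 \<le> i" "i < n"
  shows "demazure (Y (Suc i)) (Y i) (groth n \<sigma>) =
    (if pos \<sigma> i < pos \<sigma> (Suc i) then groth n \<sigma> else groth n (transpose i (Suc i) \<circ> \<sigma>))"
  using assms(1)
proof (induction rule: perm_length_induct)
  case (longer \<sigma>)
  let ?D = "demazure (Y (Suc i)) (Y i)" and ?s = "transpose i (Suc i)"
  show ?case
  proof (cases "\<sigma> = longest_perm n")
    case True
    let ?m = "n - i"
    obtain S where S: "groth_top n = S * (1 - var (Y i) * var_pow (X ?m) (-1))"
      "swap_var (X ?m) (X (Suc ?m)) S = S" "swap_var (Y (Suc i)) (Y i) S = S"
      using groth_top_factor[OF i] by blast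
    \<comment> \<open>At the top, the operators in x and in y both strip off the corner factor and
      leave \<open>S\<close>; this matches s_i \<omega> = \<omega> s_(n-i).\<close>
    have "?D (1 - var (Y i) * var_pow (X ?m) (-1)) = 1"
      by (rule demazure_var_symmetric) (simp_all add: transpose_def)
    then have D: "?D (groth_top n) = S"
      by (simp add: S(1) demazure_mult_symmetric[OF _ S(3)])
    have "demazure (X ?m) (X (Suc ?m)) (var_pow (X ?m) (-1) * var (Y i)) = 0"
      by (simp add: demazure_inverse_var demazure_symmetric transpose_def)
    then have "isobaric ?m (groth_top n) = S"
      unfolding isobaric_demazure
      by (simp add: S(1) demazure_mult_symmetric[OF _ S(2)] demazure_diff mult.commute[of "var (Y i)"])
    moreover have "isobaric ?m (groth n \<sigma>) = groth n (\<sigma> \<circ> transpose ?m (Suc ?m))"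
      using i by (intro isobaric_groth_descent longer.hyps) (auto simp: True longest_perm_def)
    moreover have "\<sigma> \<circ> transpose ?m (Suc ?m) = ?s \<circ> \<sigma>"
      using i by (auto simp: True longest_perm_def transpose_def fun_eq_iff)
    moreover have "\<not> pos \<sigma> i < pos \<sigma> (Suc i)"
      using i by (simp add: True inv_longest_perm) (simp add: longest_perm_def)
    ultimately show ?thesis using D by (simp add: True groth_longest)
  next
    case False
    obtain j where j: "1 \<le> j" "j < n" "\<sigma> j < \<sigma> (Suc j)"
      using exists_ascent[OF longer.hyps False] by blast
    let ?t = "transpose j (Suc j)"
    define \<tau> where "\<tau> = \<sigma> \<circ> ?t"
    have \<tau>: "\<tau> permutes {1..n}"
      using j longer.hyps by (simp add: \<tau>_def permutes_comp_transpose)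
    have "perm_length n \<sigma> < perm_length n \<tau>"
      unfolding \<tau>_def using j by (intro perm_length_less_transpose[OF longer.hyps]) auto
    note IH = longer.IH[OF \<tau> this]
    have iso: "isobaric j (groth n \<tau>) = groth n \<sigma>"
      using isobaric_groth_descent[OF \<tau>, of j] j by (simp add: \<tau>_def)
    have comm: "?D (groth n \<sigma>) = isobaric j (?D (groth n \<tau>))"
      unfolding iso[symmetric] isobaric_demazure by (rule demazure_commute) auto
    have pos\<tau>: "pos \<tau> v = ?t (pos \<sigma> v)" for v
      unfolding \<tau>_def using permutes_bij[OF longer.hyps]
      by (simp add: o_inv_distrib)
    have posinj: "pos \<sigma> i \<noteq> pos \<sigma> (Suc i)"
      by (metis n_not_Suc_n permutes_inverses(1)[OF longer.hyps])
    show ?thesis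
    proof (cases "\<sigma> j = i \<and> \<sigma> (Suc j) = Suc i")
      case True
      then have p: "pos \<sigma> i = j" "pos \<sigma> (Suc i) = Suc j"
        using permutes_inverses(2)[OF longer.hyps] by metis+
      \<comment> \<open>Here left and right multiplication coincide: D already sends G_\<tau> to
        G_\<sigma>, which \<pi>_j fixes because j is an ascent.\<close>
      have "?s \<circ> \<tau> = \<sigma>"
        using transpose_comp_eq_comp_transpose[OF permutes_inj[OF longer.hyps], of j "Suc j"] True
        by (metis \<tau>_def comp_assoc transpose_comp_invol)
      then have "?D (groth n \<tau>) = groth n \<sigma>"
        using IH by (simp add: pos\<tau> p)
      then have "?D (groth n \<sigma>) = groth n \<sigma>"
        using comm isobaric_groth_ascent[OF longer.hyps j] by simp
      then show ?thesis by (simp add: p)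
    next
      case False
      have "pos \<tau> i < pos \<tau> (Suc i) \<longleftrightarrow> pos \<sigma> i < pos \<sigma> (Suc i)"
      proof -
        have "\<not> (pos \<sigma> i = j \<and> pos \<sigma> (Suc i) = Suc j)" "\<not> (pos \<sigma> i = Suc j \<and> pos \<sigma> (Suc i) = j)"
          using False j(3) permutes_inverses(1)[OF longer.hyps] by (metis, metis less_not_sym lessI)
        then show ?thesis using posinj by (auto simp: pos\<tau> transpose_def)
      qed
      note IH' = IH[unfolded this]
      show ?thesis
      proof (cases "pos \<sigma> i < pos \<sigma> (Suc i)")
        case True
        then show ?thesis using IH' comm iso by simp
      next
        case desc: False
        have "?s (\<sigma> j) < ?s (\<sigma> (Suc j))"
          using False j(3) by (auto simp: transpose_def)
        then have "isobaric j (groth n (?s \<circ> \<tau>)) = groth n (?s \<circ> \<tau> \<circ> ?t)"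
          using j i by (intro isobaric_groth_descent transpose_comp_permutes \<tau>) (auto simp: \<tau>_def)
        moreover have "?s \<circ> \<tau> \<circ> ?t = ?s \<circ> \<sigma>"
          by (simp add: \<tau>_def comp_assoc[symmetric])
        ultimately show ?thesis using IH' comm desc by simp
      qed
    qed
  qed
qed

section \<open>The ideal of symmetric differences\<close>

definition vars :: "nat \<Rightarrow> indet set" where
  "vars n = X ` {1..n} \<union> Y ` {1..n}"

lemma carrier_laurent_ring: "carrier (laurent_ring n) = laurent_on (vars n)"
  by (simp add: laurent_ring_def laurent_on_def vars_def)

lemma var_pow_closed:
  "1 \<le> i \<Longrightarrow> i \<le> n \<Longrightarrow> var_pow (X i) e \<in> laurent_on (vars n)"
  "1 \<le> i \<Longrightarrow> i \<le> n \<Longrightarrow> var_pow (Y i) e \<in> laurent_on (vars n)"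
  by (simp_all add: laurent_on_var_pow vars_def)

lemma laurent_on_of_int: "of_int c \<in> laurent_on W"
proof -
  have "of_int c = (Poly_Mapping.single 0 c :: laurent)" by (metis of_int_eq_id id_apply single_of_int)
  then show ?thesis by (simp add: laurent_on_single)
qed

lemma poly_at_closed:
  assumes "f \<in> symmetric_polys n" "\<And>i. i \<in> {1..n} \<Longrightarrow> z i \<in> laurent_on W"
  shows "poly_at z f \<in> laurent_on W"
  using assms unfolding poly_at_def symmetric_polys_def
  by (intro laurent_on_sum laurent_on_mult laurent_on_prod laurent_on_power laurent_on_of_int) blast

definition sym_gens :: "nat \<Rightarrow> laurent set" where
  "sym_gens n = {poly_at (\<lambda>i. var (X i)) f - poly_at (\<lambda>i. var (Y i)) f |f. f \<in> symmetric_polys n}"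

lemma sym_ideal_gens: "sym_ideal n = genideal (laurent_ring n) (sym_gens n)"
  by (simp add: sym_ideal_def sym_gens_def)

lemma sym_gens_closed: "sym_gens n \<subseteq> laurent_on (vars n)"
  by (auto simp: sym_gens_def intro!: laurent_on_diff poly_at_closed var_pow_closed)

lemma ring_laurent_ring: "ring (laurent_ring n)"
  using cring_laurent_ring cring.axioms(1) by blast

lemma ideal_sym_ideal: "ideal (sym_ideal n) (laurent_ring n)"
  unfolding sym_ideal_gens
  by (rule ring.genideal_ideal[OF ring_laurent_ring]) (simp add: carrier_laurent_ring sym_gens_closed)

lemma sym_gens_subset: "sym_gens n \<subseteq> sym_ideal n"
  unfolding sym_ideal_gens
  by (rule ring.genideal_self[OF ring_laurent_ring]) (simp add: carrier_laurent_ring sym_gens_closed)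

lemma sym_ideal_0: "0 \<in> sym_ideal n"
  using additive_subgroup.zero_closed[OF ideal.axioms(1)[OF ideal_sym_ideal]] by (simp add: laurent_ring_def)

lemma sym_ideal_add: "f \<in> sym_ideal n \<Longrightarrow> g \<in> sym_ideal n \<Longrightarrow> f + g \<in> sym_ideal n"
  using additive_subgroup.a_closed[OF ideal.axioms(1)[OF ideal_sym_ideal], of f n g] by (simp add: laurent_ring_def)

lemma sym_ideal_mult: "c \<in> laurent_on (vars n) \<Longrightarrow> f \<in> sym_ideal n \<Longrightarrow> c * f \<in> sym_ideal n"
  using ideal.I_l_closed[OF ideal_sym_ideal, of f n c] by (simp add: carrier_laurent_ring) (simp add: laurent_ring_def)

lemma sym_ideal_uminus: "f \<in> sym_ideal n \<Longrightarrow> - f \<in> sym_ideal n"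
  using sym_ideal_mult[of "- 1" n f] by (simp add: laurent_on_uminus)

lemma sym_ideal_diff: "f \<in> sym_ideal n \<Longrightarrow> g \<in> sym_ideal n \<Longrightarrow> f - g \<in> sym_ideal n"
  using sym_ideal_add[of f n "- g"] sym_ideal_uminus by simp

lemma sym_ideal_sum: "(\<And>a. a \<in> A \<Longrightarrow> f a \<in> sym_ideal n) \<Longrightarrow> sum f A \<in> sym_ideal n"
  by (induction A rule: infinite_finite_induct) (auto intro: sym_ideal_add sym_ideal_0)

text \<open>Turns minimality of \<open>genideal\<close> into closure conditions on ordinary Laurent
  polynomials. Closure under negation comes from multiplying by -1.\<close>

lemma sym_ideal_minimal:
  assumes "J \<subseteq> laurent_on (vars n)" "sym_gens n \<subseteq> J" "0 \<in> J"
    and add: "\<And>f g. f \<in> J \<Longrightarrow> g \<in> J \<Longrightarrow> f + g \<in> J"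
    and mult: "\<And>c f. c \<in> laurent_on (vars n) \<Longrightarrow> f \<in> J \<Longrightarrow> c * f \<in> J"
  shows "sym_ideal n \<subseteq> J"
proof -
  have R: "laurent_ring n = \<lparr>carrier = laurent_on (vars n), mult = (*), one = 1, zero = 0, add = (+)\<rparr>"
    by (simp add: laurent_ring_def laurent_on_def vars_def)
  have mult': "f * c \<in> J" if "c \<in> laurent_on (vars n)" "f \<in> J" for c f
    using mult[OF that] by (simp add: mult.commute)
  have um: "- f \<in> J" if "f \<in> J" for f
    using mult[of "- 1" f] that by (simp add: laurent_on_uminus)
  have ainv: "\<ominus>\<^bsub>laurent_ring n\<^esub> f = - f" if "f \<in> laurent_on (vars n)" for f
    by (rule abelian_group.minus_equality[OF ring.is_abelian_group[OF ring_laurent_ring]])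
       (use that in \<open>simp_all add: R laurent_on_uminus\<close>)
  have "subgroup J (add_monoid (laurent_ring n))"
  proof (rule group.subgroupI[OF abelian_group.a_group[OF ring.is_abelian_group[OF ring_laurent_ring]]])
    fix f assume "f \<in> J"
    then show "inv\<^bsub>add_monoid (laurent_ring n)\<^esub> f \<in> J"
      using ainv[of f] um assms(1) by (auto simp: a_inv_def)
  qed (use assms in \<open>auto simp: R\<close>)
  then have "ideal J (laurent_ring n)"
    by (intro idealI ring_laurent_ring) (simp_all add: R mult mult')
  then show ?thesis
    unfolding sym_ideal_gens by (rule ring.genideal_minimal[OF ring_laurent_ring]) (rule assms(2))
qed

lemma swap_var_of_int [simp]: "swap_var u v (of_int c) = of_int c"
proof -
  have "of_int c = (Poly_Mapping.single 0 c :: laurent)" by (metis of_int_eq_id id_apply single_of_int)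
  moreover have "Poly_Mapping.map_key (transpose u v) 0 = (0 :: indet \<Rightarrow>\<^sub>0 int)"
    by (rule poly_mapping_eqI) simp
  ultimately show ?thesis by (simp add: swap_var_single)
qed

lemma swap_var_sum: "swap_var u v (sum f A) = (\<Sum>a\<in>A. swap_var u v (f a))"
  by (induction A rule: infinite_finite_induct) (simp_all add: swap_var_add)

lemma swap_var_power: "swap_var u v (f ^ m) = swap_var u v f ^ m"
  by (induction m) (simp_all add: swap_var_mult)

lemma swap_var_poly_at: "swap_var u v (poly_at z f) = poly_at (\<lambda>i. swap_var u v (z i)) f"
  by (simp add: poly_at_def swap_var_sum swap_var_mult swap_var_prod swap_var_power)

lemma poly_at_transpose:
  assumes "f \<in> symmetric_polys n" "a \<in> {1..n}" "b \<in> {1..n}"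
  shows "poly_at (\<lambda>i. z (transpose a b i)) f = poly_at z f"
proof -
  let ?t = "transpose a b" and ?T = "Poly_Mapping.map_key (transpose a b) :: (nat \<Rightarrow>\<^sub>0 nat) \<Rightarrow> _"
  have "?t permutes {1..n}" using assms by (simp add: permutes_swap_id)
  then have "Poly_Mapping.map_key ?T f = f"
    using assms(1) by (simp add: symmetric_polys_def)
  then have f: "Poly_Mapping.lookup f (?T m) = Poly_Mapping.lookup f m" for m
    by (metis inj_map_key_transpose lookup_map_key)
  have "(\<Prod>i\<in>Poly_Mapping.keys (?T m). z i ^ Poly_Mapping.lookup (?T m) i) =
      (\<Prod>i\<in>Poly_Mapping.keys m. z (?t i) ^ Poly_Mapping.lookup m i)" for m
    by (rule prod.reindex_bij_witness[where i = ?t and j = ?t]) (simp_all add: keys_map_key)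
  then show ?thesis
    unfolding poly_at_def
    by (intro sum.reindex_bij_witness[where i = ?T and j = ?T]) (simp_all add: f in_keys_iff)
qed

text \<open>A generator g is symmetric in the y, so D(c g) = D(c) g for every c. As D is not linear
  over the whole ring, the set \<open>J\<close> asks for D(c f) with all multipliers c at once; this
  makes it closed under multiplication and lets minimality of the ideal apply.\<close>

lemma demazure_Y_sym_ideal:
  assumes "1 \<le> i" "i < n" "f \<in> sym_ideal n"
  shows "demazure (Y (Suc i)) (Y i) f \<in> sym_ideal n"
proof -
  let ?D = "demazure (Y (Suc i)) (Y i)"
  define J where "J = {f \<in> laurent_on (vars n). \<forall>c\<in>laurent_on (vars n). ?D (c * f) \<in> sym_ideal n}"
  have "sym_ideal n \<subseteq> J"
  proof (rule sym_ideal_minimal)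
    show "sym_gens n \<subseteq> J"
    proof
      fix g assume g: "g \<in> sym_gens n"
      then obtain f where f: "f \<in> symmetric_polys n"
        "g = poly_at (\<lambda>i. var (X i)) f - poly_at (\<lambda>i. var (Y i)) f"
        by (auto simp: sym_gens_def)
      have "poly_at (\<lambda>j. var (Y (transpose (Suc i) i j))) f = poly_at (\<lambda>i. var (Y i)) f"
        using poly_at_transpose[OF f(1), of "Suc i" i "\<lambda>j. var (Y j)"] assms by simp
      moreover have "transpose (Y (Suc i)) (Y i) (Y j) = Y (transpose (Suc i) i j)"
        "transpose (Y (Suc i)) (Y i) (X j) = X j" for j
        by (simp_all add: transpose_def)
      ultimately have swap: "swap_var (Y (Suc i)) (Y i) g = g"
        unfolding f(2) by (simp add: swap_var_diff swap_var_poly_at)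
      have "?D (c * g) \<in> sym_ideal n" if "c \<in> laurent_on (vars n)" for c
      proof -
        have "?D c \<in> laurent_on (vars n)"
          using assms that by (intro demazure_closed) (auto simp: vars_def)
        moreover have "?D (c * g) = ?D c * g"
          using demazure_mult_symmetric[OF _ swap, of c] by (simp add: mult.commute)
        moreover have "g \<in> sym_ideal n" using g sym_gens_subset by blast
        ultimately show ?thesis by (simp add: sym_ideal_mult)
      qed
      then show "g \<in> J" using g sym_gens_closed by (auto simp: J_def)
    qed
  next
    fix c f assume "c \<in> laurent_on (vars n)" "f \<in> J"
    then show "c * f \<in> J"
      by (auto simp: J_def laurent_on_mult mult.assoc[symmetric])
  qed (auto simp: J_def sym_ideal_0 laurent_on_add distrib_left demazure_add sym_ideal_add)
  with assms(3) have "f \<in> J" by blast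
  then have "?D (1 * f) \<in> sym_ideal n" unfolding J_def using laurent_on_1 by blast
  then show ?thesis by simp
qed

section \<open>Elementary symmetric functions and the longest permutation\<close>

definition elem_sym :: "nat \<Rightarrow> 'a set \<Rightarrow> ('a \<Rightarrow> 'b::comm_ring_1) \<Rightarrow> 'b" where
  "elem_sym m A z = (\<Sum>S | S \<in> Pow A \<and> card S = m. \<Prod>i\<in>S. z i)"

lemma elem_sym_0: "finite A \<Longrightarrow> elem_sym 0 A z = 1"
proof -
  assume "finite A"
  then have "{S. S \<in> Pow A \<and> card S = 0} = {{}}" by (auto dest: finite_subset)
  then show ?thesis by (simp add: elem_sym_def)
qed

lemma elem_sym_insert:
  assumes "finite A" "a \<notin> A"
  shows "elem_sym (Suc m) (insert a A) z = elem_sym (Suc m) A z + z a * elem_sym m A z"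
proof -
  let ?S = "\<lambda>m. {S. S \<in> Pow A \<and> card S = m}"
  have "{S. S \<in> Pow (insert a A) \<and> card S = Suc m} = ?S (Suc m) \<union> insert a ` ?S m" (is "?L = ?R")
  proof
    show "?L \<subseteq> ?R"
    proof
      fix S assume S: "S \<in> ?L"
      show "S \<in> ?R"
      proof (cases "a \<in> S")
        case True
        then have "S = insert a (S - {a})" "S - {a} \<in> ?S m"
          using S assms(1) by (auto simp: finite_subset)
        then show ?thesis by blast
      qed (use S in auto)
    qed
    show "?R \<subseteq> ?L"
    proof
      fix S assume "S \<in> ?R"
      then show "S \<in> ?L" using assms by (auto simp: card_insert_if finite_subset)
    qed
  qed
  moreover have "inj_on (insert a) (?S m)"
    using assms(2) by (auto intro!: inj_onI)
  moreover have "(\<Prod>i\<in>insert a S. z i) = z a * (\<Prod>i\<in>S. z i)" if "S \<in> ?S m" for S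
    using that assms by (subst prod.insert) (auto simp: finite_subset)
  moreover have "?S (Suc m) \<inter> insert a ` ?S m = {}" using assms(2) by auto
  ultimately show ?thesis
    using assms(1) by (simp add: elem_sym_def sum.union_disjoint sum.reindex sum_distrib_left)
qed

lemma prod_one_plus_elem_sym:
  assumes "finite A"
  shows "(\<Prod>i\<in>A. 1 + t * z i) = (\<Sum>m\<le>card A. t ^ m * elem_sym m A z)"
proof -
  have "(\<Prod>i\<in>A. t * z i + 1) = (\<Sum>S\<in>Pow A. (\<Prod>i\<in>S. t * z i) * (\<Prod>i\<in>A - S. 1))"
    by (rule prod_add[OF assms])
  also have "\<dots> = (\<Sum>S\<in>Pow A. t ^ card S * (\<Prod>i\<in>S. z i))"
    by (simp add: prod.distrib)
  also have "\<dots> = (\<Sum>m\<in>{..card A}. \<Sum>S | S \<in> Pow A \<and> card S = m. t ^ card S * (\<Prod>i\<in>S. z i))"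
    using assms by (intro sum.group[symmetric]) (auto simp: card_mono)
  also have "\<dots> = (\<Sum>m\<le>card A. t ^ m * elem_sym m A z)"
    unfolding elem_sym_def sum_distrib_left by (intro sum.cong refl) auto
  finally show ?thesis by (simp add: add.commute)
qed

text \<open>The exponent vector of the squarefree monomial with support S. It turns elementary
  symmetric functions into polynomials in the sense of \<open>poly_at\<close> and
  \<open>symmetric_polys\<close>.\<close>

definition indicator_exponent :: "nat set \<Rightarrow> nat \<Rightarrow>\<^sub>0 nat" where
  "indicator_exponent S = (\<Sum>i\<in>S. Poly_Mapping.single i 1)"

lemma lookup_indicator_exponent:
  "finite S \<Longrightarrow> Poly_Mapping.lookup (indicator_exponent S) i = (if i \<in> S then 1 else 0)"
  by (simp add: indicator_exponent_def lookup_sum lookup_single when_def)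

lemma keys_indicator_exponent: "finite S \<Longrightarrow> Poly_Mapping.keys (indicator_exponent S) = S"
  by (auto simp: in_keys_iff lookup_indicator_exponent split: if_splits)

lemma elem_sym_diff_in_sym_ideal:
  "elem_sym m {1..n} (\<lambda>i. var (X i)) - elem_sym m {1..n} (\<lambda>i. var (Y i)) \<in> sym_ideal n"
proof -
  define P where "P = {S. S \<in> Pow {1..n} \<and> card S = m}"
  have fin: "finite P" "\<And>S. S \<in> P \<Longrightarrow> finite S" by (auto simp: P_def finite_subset)
  have inj: "inj_on indicator_exponent P"
    by (rule inj_onI) (metis fin(2) keys_indicator_exponent)
  define f where "f = (\<Sum>S\<in>P. Poly_Mapping.single (indicator_exponent S) (1::int))"
  have lf: "Poly_Mapping.lookup f k = (if k \<in> indicator_exponent ` P then 1 else 0)" for k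
  proof (cases "k \<in> indicator_exponent ` P")
    case True
    then obtain S where S: "S \<in> P" "k = indicator_exponent S" by blast
    have "Poly_Mapping.lookup f k = (\<Sum>S'\<in>P. if S' = S then 1 else 0)"
      unfolding f_def lookup_sum lookup_single S(2)
      by (rule sum.cong) (use inj S in \<open>auto simp: when_def inj_on_eq_iff\<close>)
    then show ?thesis using True S fin by simp
  qed (auto simp: f_def lookup_sum lookup_single when_def intro!: sum.neutral)
  have kf: "Poly_Mapping.keys f = indicator_exponent ` P" by (auto simp: in_keys_iff lf split: if_splits)
  have at: "poly_at z f = elem_sym m {1..n} z" for z
    unfolding poly_at_def kf elem_sym_def P_def[symmetric]
    by (simp add: sum.reindex[OF inj] lf)
       (simp add: keys_indicator_exponent lookup_indicator_exponent fin(2))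
  have map: "Poly_Mapping.map_key \<pi> k \<in> indicator_exponent ` P"
    if \<pi>: "\<pi> permutes {1..n}" and k: "k \<in> indicator_exponent ` P" for \<pi> k
  proof -
    obtain S where S: "S \<in> P" "k = indicator_exponent S" using k by blast
    have \<pi>': "pos \<pi> permutes {1..n}" by (rule permutes_inv[OF \<pi>])
    have S': "pos \<pi> ` S \<in> P"
      using S permutes_image[OF \<pi>'] card_image[OF permutes_inj_on[OF \<pi>']] by (auto simp: P_def)
    \<comment> \<open>\<open>map_key\<close> pulls exponents back along \<pi>, so the support moves
      by the inverse of \<pi>.\<close>
    have "Poly_Mapping.map_key \<pi> k = indicator_exponent (pos \<pi> ` S)"
    proof (rule poly_mapping_eqI)
      fix i
      have "i \<in> pos \<pi> ` S \<longleftrightarrow> \<pi> i \<in> S"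
        using permutes_inverses[OF \<pi>] by (metis image_iff)
      then show "Poly_Mapping.lookup (Poly_Mapping.map_key \<pi> k) i =
          Poly_Mapping.lookup (indicator_exponent (pos \<pi> ` S)) i"
        using permutes_inj[OF \<pi>] by (simp add: S(2) lookup_indicator_exponent fin(2)[OF S(1)] fin(2)[OF S'])
    qed
    then show ?thesis using S' by blast
  qed
  have "Poly_Mapping.map_key (Poly_Mapping.map_key \<pi>) f = f" if \<pi>: "\<pi> permutes {1..n}" for \<pi>
  proof (rule poly_mapping_eqI)
    fix k
    have \<pi>': "pos \<pi> permutes {1..n}" by (rule permutes_inv[OF \<pi>])
    have inverse: "Poly_Mapping.map_key (pos \<pi>) (Poly_Mapping.map_key \<pi> k) = k" for k :: "nat \<Rightarrow>\<^sub>0 nat"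
      by (rule poly_mapping_eqI) (simp add: permutes_inj[OF \<pi>] permutes_inj[OF \<pi>'] permutes_inverses[OF \<pi>])
    then have "inj (Poly_Mapping.map_key \<pi> :: (nat \<Rightarrow>\<^sub>0 nat) \<Rightarrow> _)" by (rule inj_on_inverseI)
    moreover have "Poly_Mapping.map_key \<pi> k \<in> indicator_exponent ` P \<longleftrightarrow> k \<in> indicator_exponent ` P"
      using map[OF \<pi>] map[OF \<pi>', of "Poly_Mapping.map_key \<pi> k"] inverse by auto
    ultimately show "Poly_Mapping.lookup (Poly_Mapping.map_key (Poly_Mapping.map_key \<pi>) f) k = Poly_Mapping.lookup f k"
      by (simp add: lf)
  qed
  moreover have "Poly_Mapping.keys k \<subseteq> {1..n}" if "k \<in> Poly_Mapping.keys f" for k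
    using that unfolding kf by (auto simp: keys_indicator_exponent fin(2)) (auto simp: P_def)
  ultimately have "f \<in> symmetric_polys n" by (simp add: symmetric_polys_def)
  then have "poly_at (\<lambda>i. var (X i)) f - poly_at (\<lambda>i. var (Y i)) f \<in> sym_gens n"
    unfolding sym_gens_def by blast
  then show ?thesis using sym_gens_subset by (auto simp: at)
qed

definition groth_rows :: "nat \<Rightarrow> nat \<Rightarrow> laurent" where
  "groth_rows n p = (\<Prod>i = 1..p. \<Prod>j = 1..n - i. 1 - var (Y j) * var_pow (X i) (-1))"

lemma groth_rows_Suc:
  "groth_rows n (Suc p) = groth_rows n p * (\<Prod>j = 1..n - Suc p. 1 - var (Y j) * var_pow (X (Suc p)) (-1))"
  by (simp add: groth_rows_def)

lemma groth_factor_closed: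
  "1 \<le> i \<Longrightarrow> i \<le> n \<Longrightarrow> 1 \<le> j \<Longrightarrow> j \<le> n \<Longrightarrow> 1 - var (Y j) * var_pow (X i) (-1) \<in> laurent_on (vars n)"
  by (intro laurent_on_diff laurent_on_mult var_pow_closed laurent_on_1)

lemma elem_sym_closed:
  "(\<And>i. i \<in> A \<Longrightarrow> z i \<in> laurent_on W) \<Longrightarrow> elem_sym m A z \<in> laurent_on W"
  unfolding elem_sym_def by (intro laurent_on_sum laurent_on_prod) auto

text \<open>
  The first \<open>p\<close> rows of the product force \<open>x\<^sub>i \<equiv> y\<^bsub>n+1-i\<^esub>\<close> for \<open>i \<le> p\<close>, so the remaining
  variables \<open>x\<close> and \<open>y\<close> have the same elementary symmetric functions.
\<close>

lemma groth_rows_vanishing: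
  assumes "p < n"
    and H: "\<And>m. groth_rows n p * (elem_sym m {Suc p..n} (\<lambda>i. var (X i)) - elem_sym m {1..n - p} (\<lambda>i. var (Y i))) \<in> sym_ideal n"
  shows "groth_rows n (Suc p) * (1 - var (Y (n - p)) * var_pow (X (Suc p)) (-1)) \<in> sym_ideal n"
proof -
  \<comment> \<open>At this t the product of the 1 + t x_j over j > p vanishes through its factor j
    = p + 1, while the product of the 1 + t y_j over j \<le> n - p is row p + 1 of the staircase
    times the factor in question.\<close>
  let ?t = "- var_pow (X (Suc p)) (-1)"
  let ?ex = "\<lambda>m. elem_sym m {Suc p..n} (\<lambda>i. var (X i))" and ?ey = "\<lambda>m. elem_sym m {1..n - p} (\<lambda>i. var (Y i))"
  have "{1..n - p} = insert (n - p) {1..n - Suc p}" "n - p \<notin> {1..n - Suc p}" using assms by auto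
  then have "(\<Prod>j\<in>{1..n - p}. 1 + ?t * var (Y j)) =
      (1 + ?t * var (Y (n - p))) * (\<Prod>j\<in>{1..n - Suc p}. 1 + ?t * var (Y j))"
    using assms by simp
  then have eq: "groth_rows n (Suc p) * (1 - var (Y (n - p)) * var_pow (X (Suc p)) (-1)) =
      groth_rows n p * (\<Prod>j\<in>{1..n - p}. 1 + ?t * var (Y j))"
    by (simp add: groth_rows_Suc mult_ac)
  have "1 + ?t * var (X (Suc p)) = 0" by simp
  then have 0: "(\<Prod>j\<in>{Suc p..n}. 1 + ?t * var (X j)) = 0"
    using assms by (intro prod_zero bexI[of _ "Suc p"]) auto
  have c: "card {Suc p..n} = n - p" "card {1..n - p} = n - p" by auto
  have "groth_rows n p * (\<Prod>j\<in>{1..n - p}. 1 + ?t * var (Y j)) =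
      groth_rows n p * ((\<Prod>j\<in>{1..n - p}. 1 + ?t * var (Y j)) - (\<Prod>j\<in>{Suc p..n}. 1 + ?t * var (X j)))"
    unfolding 0 by simp
  also have "\<dots> = groth_rows n p * (\<Sum>m\<le>n - p. ?t ^ m * ?ey m - ?t ^ m * ?ex m)"
    by (simp only: prod_one_plus_elem_sym finite_atLeastAtMost c sum_subtractf)
  also have "\<dots> = (\<Sum>m\<le>n - p. (- (?t ^ m)) * (groth_rows n p * (?ex m - ?ey m)))"
    unfolding sum_distrib_left by (rule sum.cong) (simp_all add: algebra_simps)
  also have "\<dots> \<in> sym_ideal n"
    using assms by (intro sym_ideal_sum sym_ideal_mult H laurent_on_uminus laurent_on_power var_pow_closed) auto
  finally show ?thesis unfolding eq .
qed

text \<open>This and the preceding lemma alternate: the statement at p gives the vanishing that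
  removes x_(p+1) and y_(n-p), which gives the statement at p + 1. The inner induction on m is due
  to the recursion of elementary symmetric functions, which expresses degree m + 1 in the remaining
  variables through degree m.\<close>

lemma groth_rows_elem_sym:
  assumes "p \<le> n"
  shows "groth_rows n p * (elem_sym m {Suc p..n} (\<lambda>i. var (X i)) - elem_sym m {1..n - p} (\<lambda>i. var (Y i))) \<in> sym_ideal n"
  using assms
proof (induction p arbitrary: m)
  case 0
  then show ?case using elem_sym_diff_in_sym_ideal[of m n] by (simp add: groth_rows_def One_nat_def)
next
  case step: (Suc p)
  let ?x = "var (X (Suc p))" and ?y = "var (Y (n - p))" and ?P = "groth_rows n (Suc p)"
  let ?ex = "\<lambda>m. elem_sym m {Suc (Suc p)..n} (\<lambda>i. var (X i))" and ?ey = "\<lambda>m. elem_sym m {1..n - Suc p} (\<lambda>i. var (Y i))"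
  from step.prems have p: "p < n" by simp
  have van: "?P * (1 - ?y * var_pow (X (Suc p)) (-1)) \<in> sym_ideal n"
    by (rule groth_rows_vanishing[OF p step.IH]) (use p in simp)
  have row: "(\<Prod>j = 1..n - Suc p. 1 - var (Y j) * var_pow (X (Suc p)) (-1)) \<in> laurent_on (vars n)"
    using p by (intro laurent_on_prod groth_factor_closed) auto
  show ?case
  proof (induction m)
    case 0
    then show ?case by (simp add: elem_sym_0 sym_ideal_0)
  next
    case (Suc m)
    have "{Suc p..n} = insert (Suc p) {Suc (Suc p)..n}" "{1..n - p} = insert (n - p) {1..n - Suc p}"
      "n - p \<notin> {1..n - Suc p}"
      using p by auto
    then have ex: "elem_sym (Suc m) {Suc p..n} (\<lambda>i. var (X i)) = ?ex (Suc m) + ?x * ?ex m"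
      and ey: "elem_sym (Suc m) {1..n - p} (\<lambda>i. var (Y i)) = ?ey (Suc m) + ?y * ?ey m"
      using p by (simp_all add: elem_sym_insert)
    \<comment> \<open>The relation for p in degree m + 1. Subtracting \<open>2\<close>, the inner
      hypothesis times x, and \<open>3\<close>, the congruence of x and y on \<open>?P\<close>,
      leaves the claim.\<close>
    have 1: "(\<Prod>j = 1..n - Suc p. 1 - var (Y j) * var_pow (X (Suc p)) (-1)) * (groth_rows n p *
        (?ex (Suc m) + ?x * ?ex m - (?ey (Suc m) + ?y * ?ey m))) \<in> sym_ideal n"
      unfolding ex[symmetric] ey[symmetric] using p by (intro sym_ideal_mult[OF row] step.IH) simp
    have 2: "?x * (?P * (?ex m - ?ey m)) \<in> sym_ideal n"
      by (rule sym_ideal_mult[OF _ Suc]) (use p in \<open>simp add: var_pow_closed\<close>)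
    have "?x * ?ey m \<in> laurent_on (vars n)"
      using p by (intro laurent_on_mult var_pow_closed elem_sym_closed) auto
    from sym_ideal_mult[OF this van]
    have "(?x * ?ey m) * (?P * (1 - ?y * var_pow (X (Suc p)) (-1))) \<in> sym_ideal n" .
    also have "(?x * ?ey m) * (?P * (1 - ?y * var_pow (X (Suc p)) (-1))) =
        ?P * ?ey m * (?x - (?x * var_pow (X (Suc p)) (-1)) * ?y)"
      by (simp add: algebra_simps del: var_inverse)
    finally have 3: "?P * ?ey m * (?x - ?y) \<in> sym_ideal n" by simp
    show ?case
      using sym_ideal_diff[OF sym_ideal_diff[OF 1 2] 3] by (simp add: groth_rows_Suc algebra_simps)
  qed
qed

lemma groth_top_vanishing:
  assumes "1 \<le> i" "i \<le> n"
  shows "groth_top n * (1 - var (Y (n + 1 - i)) * var_pow (X i) (-1)) \<in> sym_ideal n"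
proof -
  let ?rest = "\<Prod>i \<in> {Suc i..n}. \<Prod>j = 1..n - i. 1 - var (Y j) * var_pow (X i) (-1)"
  obtain p where p: "i = Suc p" using assms by (cases i) auto
  have "{1..n} = {1..i} \<union> {Suc i..n}" using assms by auto
  then have "groth_top n = groth_rows n i * ?rest"
    by (simp add: groth_top_def groth_rows_def prod.union_disjoint)
  moreover have "?rest \<in> laurent_on (vars n)"
    by (intro laurent_on_prod groth_factor_closed) auto
  moreover have "groth_rows n i * (1 - var (Y (n + 1 - i)) * var_pow (X i) (-1)) \<in> sym_ideal n"
    using groth_rows_vanishing[OF _ groth_rows_elem_sym, of p n] assms by (simp add: p)
  ultimately show ?thesis
    using sym_ideal_mult[of ?rest n "groth_rows n i * (1 - var (Y (n + 1 - i)) * var_pow (X i) (-1))"]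
    by (simp add: mult_ac)
qed

text \<open>Telescoping: 1 - c d = (1 - c) + c (1 - d).\<close>

lemma groth_top_prod:
  assumes "k \<le> n"
  shows "groth_top n * (1 - (\<Prod>i = 1..k. var (Y (n + 1 - i)) * var_pow (X i) (-1))) \<in> sym_ideal n"
  using assms
proof (induction k)
  case 0
  then show ?case by (simp add: sym_ideal_0)
next
  case (Suc k)
  let ?c = "\<Prod>i = 1..k. var (Y (n + 1 - i)) * var_pow (X i) (-1)"
  have "?c \<in> laurent_on (vars n)"
    using Suc by (intro laurent_on_prod laurent_on_mult var_pow_closed) auto
  from sym_ideal_mult[OF this groth_top_vanishing[of "Suc k" n]] Suc
  have "?c * (groth_top n * (1 - var (Y (n + 1 - Suc k)) * var_pow (X (Suc k)) (-1))) \<in> sym_ideal n" by simp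
  from sym_ideal_add[OF Suc.IH this] Suc.prems show ?case by (simp add: algebra_simps)
qed

section \<open>Position-wise description of the interval\<close>

text \<open>
  \<open>allowed k 1 n \<sigma> c v\<close> is the condition for the value \<open>v\<close> to stand in position \<open>c\<close> of an element of
  the interval. For general \<open>a\<close> and \<open>b\<close> it is the invariant of the greedy construction of \<open>\<eta>\<close>, where
  \<open>\<sigma>\<close> is the permutation reached when the transposition \<open>(a, b)\<close> is considered.
\<close>

definition allowed :: "nat \<Rightarrow> nat \<Rightarrow> nat \<Rightarrow> (nat \<Rightarrow> nat) \<Rightarrow> nat \<Rightarrow> nat \<Rightarrow> bool" where
  "allowed k a b \<sigma> c v \<longleftrightarrow>
    (if c \<le> k then \<sigma> c \<le> v \<and> (\<forall>j. c < j \<and> j \<le> k \<and> \<sigma> c < \<sigma> j \<longrightarrow> v < \<sigma> j) \<and>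
       (c < a \<and> \<sigma> c < \<sigma> b \<and> (\<forall>j. k < j \<and> j < b \<longrightarrow> \<not> (\<sigma> c < \<sigma> j \<and> \<sigma> j < \<sigma> b)) \<longrightarrow> v < \<sigma> b)
     else v \<le> \<sigma> c \<and> (\<forall>j. k < j \<and> j < c \<and> \<sigma> j < \<sigma> c \<longrightarrow> \<sigma> j < v))"

text \<open>Beyond b the permutation \<nu> must already agree with \<sigma>, since no later
  transposition touches these positions. The clause of \<open>allowed\<close> for c < a remembers
  that (c, b) has been passed: later exchanges with b may move the entries that bounded \<nu> c, so
  the bound by \<sigma> b is kept separately. For a = 1 this clause is vacuous.\<close>

definition pieri_part :: "nat \<Rightarrow> nat \<Rightarrow> nat \<Rightarrow> nat \<Rightarrow> (nat \<Rightarrow> nat) \<Rightarrow> (nat \<Rightarrow> nat) set" where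
  "pieri_part n k a b \<sigma> =
    {\<nu>. \<nu> permutes {1..n} \<and> (\<forall>j>b. \<nu> j = \<sigma> j) \<and> (\<forall>c\<in>{1..b}. allowed k a b \<sigma> c (\<nu> c))}"

abbreviation pieri_set :: "nat \<Rightarrow> nat \<Rightarrow> (nat \<Rightarrow> nat) \<Rightarrow> (nat \<Rightarrow> nat) set" where
  "pieri_set n k \<sigma> \<equiv> pieri_part n k 1 n \<sigma>"

lemma allowed_le: "c \<le> k \<Longrightarrow> allowed k a b \<sigma> c v \<longleftrightarrow> \<sigma> c \<le> v \<and> (\<forall>j. c < j \<and> j \<le> k \<and> \<sigma> c < \<sigma> j \<longrightarrow> v < \<sigma> j) \<and>
    (c < a \<and> \<sigma> c < \<sigma> b \<and> (\<forall>j. k < j \<and> j < b \<longrightarrow> \<not> (\<sigma> c < \<sigma> j \<and> \<sigma> j < \<sigma> b)) \<longrightarrow> v < \<sigma> b)"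
  by (simp add: allowed_def)

lemma allowed_gt: "k < c \<Longrightarrow> allowed k a b \<sigma> c v \<longleftrightarrow> v \<le> \<sigma> c \<and> (\<forall>j. k < j \<and> j < c \<and> \<sigma> j < \<sigma> c \<longrightarrow> \<sigma> j < v)"
  by (simp add: allowed_def)

lemma permutes_eq_iff: "\<sigma> permutes S \<Longrightarrow> \<sigma> x = \<sigma> y \<longleftrightarrow> x = y"
  by (simp add: inj_eq permutes_inj)

lemma pieri_part_swap:
  assumes "\<nu> \<in> pieri_part n k a b \<sigma>" "x \<in> {1..b}" "y \<in> {1..b}" "b \<le> n"
    and "allowed k a b \<sigma> x (\<nu> y)" "allowed k a b \<sigma> y (\<nu> x)"
  shows "\<nu> \<circ> transpose x y \<in> pieri_part n k a b \<sigma>"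
proof -
  have "\<nu> \<circ> transpose x y permutes {1..n}"
    using assms by (intro permutes_comp_transpose) (auto simp: pieri_part_def)
  then show ?thesis
    using assms by (auto simp: pieri_part_def transpose_def)
qed

section \<open>Following the greedy construction through the sets\<close>

lemma bruhat_le_refl [simp]: "bruhat_le n \<sigma> \<sigma>"
  by (simp add: bruhat_le_def)

lemma bruhat_le_trans: "bruhat_le n \<sigma> \<mu> \<Longrightarrow> bruhat_le n \<mu> \<nu> \<Longrightarrow> bruhat_le n \<sigma> \<nu>"
  unfolding bruhat_le_def by (rule rtranclp_trans)

lemma bruhat_step_transpose:
  assumes "\<sigma> permutes {1..n}" "1 \<le> a" "a < b" "b \<le> n" "\<sigma> a < \<sigma> b"
  shows "bruhat_step n \<sigma> (\<sigma> \<circ> transpose a b)"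
  using perm_length_less_transpose[OF assms] assms unfolding bruhat_step_def by blast

lemma bruhat_le_transpose:
  assumes "\<sigma> permutes {1..n}" "1 \<le> a" "a < b" "b \<le> n" "\<sigma> a < \<sigma> b"
  shows "bruhat_le n \<sigma> (\<sigma> \<circ> transpose a b)"
  using bruhat_step_transpose[OF assms] by (simp add: bruhat_le_def)

text \<open>A substitute for the maximum of S, whose existence is the goal at this stage: above
  every element there is one that no ascending exchange inside S can enlarge, and this local
  property suffices.\<close>

lemma exists_swap_maximal_above:
  assumes "\<nu> \<in> S" "\<And>\<nu>. \<nu> \<in> S \<Longrightarrow> \<nu> permutes {1..n}"
  shows "\<exists>\<mu>\<in>S. bruhat_le n \<nu> \<mu> \<and> (\<forall>x y. 1 \<le> x \<and> x < y \<and> y \<le> n \<and> \<mu> x < \<mu> y \<longrightarrow> \<mu> \<circ> transpose x y \<notin> S)"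
proof -
  have "\<nu> permutes {1..n}" using assms by blast
  then show ?thesis using assms(1)
  proof (induction rule: perm_length_induct)
    case (longer \<nu>)
    show ?case
    proof (cases "\<exists>x y. 1 \<le> x \<and> x < y \<and> y \<le> n \<and> \<nu> x < \<nu> y \<and> \<nu> \<circ> transpose x y \<in> S")
      case True
      then obtain x y where xy: "1 \<le> x" "x < y" "y \<le> n" "\<nu> x < \<nu> y" "\<nu> \<circ> transpose x y \<in> S" by blast
      then obtain \<mu> where "\<mu> \<in> S" "bruhat_le n (\<nu> \<circ> transpose x y) \<mu>"
        "\<forall>x y. 1 \<le> x \<and> x < y \<and> y \<le> n \<and> \<mu> x < \<mu> y \<longrightarrow> \<mu> \<circ> transpose x y \<notin> S"
        using longer.IH[of "\<nu> \<circ> transpose x y"] perm_length_less_transpose[OF longer.hyps] assms(2) by blast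
      then show ?thesis
        using bruhat_le_trans[OF bruhat_le_transpose[OF longer.hyps xy(1-4)]] by blast
    next
      case False
      then show ?thesis using longer.prems bruhat_le_refl by blast
    qed
  qed
qed

text \<open>
  The values \<open>\<sigma> b\<close> and \<open>\<sigma> a\<close> occupy positions of \<open>\<nu>\<close> that would allow an ascending exchange
  unless \<open>\<nu> a \<ge> \<sigma> b\<close> and \<open>\<nu> b \<le> \<sigma> a\<close>.
\<close>

lemma pieri_part_cover:
  assumes \<sigma>: "\<sigma> permutes {1..n}" and ab: "1 \<le> a" "a \<le> k" "k < b" "b \<le> n"
    and lt: "\<sigma> a < \<sigma> b" and cover: "\<And>j. a < j \<Longrightarrow> j < b \<Longrightarrow> \<not> (\<sigma> a < \<sigma> j \<and> \<sigma> j < \<sigma> b)"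
    and \<nu>: "\<nu> \<in> pieri_part n k a b \<sigma>"
    and max: "\<And>x y. 1 \<le> x \<Longrightarrow> x < y \<Longrightarrow> y \<le> n \<Longrightarrow> \<nu> x < \<nu> y \<Longrightarrow> \<nu> \<circ> transpose x y \<notin> pieri_part n k a b \<sigma>"
  shows "\<nu> \<in> pieri_part n k (Suc a) b (\<sigma> \<circ> transpose a b)"
proof -
  have perm: "\<nu> permutes {1..n}" and fixed: "\<And>j. b < j \<Longrightarrow> \<nu> j = \<sigma> j"
    and al: "\<And>c. 1 \<le> c \<Longrightarrow> c \<le> b \<Longrightarrow> allowed k a b \<sigma> c (\<nu> c)"
    using \<nu> by (auto simp: pieri_part_def)
  have lower: "\<sigma> c \<le> \<nu> c" if "1 \<le> c" "c \<le> k" for c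
    using al[of c] that ab by (simp add: allowed_def)
  have upper: "\<nu> c < \<sigma> j" if "1 \<le> c" "c < j" "j \<le> k" "\<sigma> c < \<sigma> j" for c j
    using al[of c] that ab by (simp add: allowed_def)
  have upper': "\<nu> c < \<sigma> b" if "1 \<le> c" "c < a" "\<sigma> c < \<sigma> b" "\<And>j. k < j \<Longrightarrow> j < b \<Longrightarrow> \<not> (\<sigma> c < \<sigma> j \<and> \<sigma> j < \<sigma> b)" for c
    using al[of c] that ab by (simp add: allowed_def)
  have tail: "\<nu> d \<le> \<sigma> d" if "k < d" "d \<le> b" for d
    using al[of d] that ab by (simp add: allowed_def)
  have tail': "\<sigma> j < \<nu> d" if "k < j" "j < d" "d \<le> b" "\<sigma> j < \<sigma> d" for j d
    using al[of d] that ab by (simp add: allowed_def)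
  note ne = permutes_eq_iff[OF \<sigma>]
  have between: "\<sigma> j < \<sigma> a \<or> \<sigma> b < \<sigma> j" if "a < j" "j < b" for j
    using cover[OF that] ne[of j a] ne[of j b] that by (metis nat_neq_iff)
  have between': "\<sigma> b < \<sigma> j" if "a < j" "j \<le> k" "\<sigma> a < \<sigma> j" for j
    using between[of j] that ab by auto
  have position: "\<exists>c\<in>{1..n}. \<nu> c = v" if "v \<in> {1..n}" for v
    using that pos_in[OF perm, of v] permutes_inverses(1)[OF perm, of v] by blast
  have in_range: "\<sigma> a \<in> {1..n}" "\<sigma> b \<in> {1..n}"
    using ab permutes_in_image[OF \<sigma>, of a] permutes_in_image[OF \<sigma>, of b] by auto
  have A: "\<sigma> b \<le> \<nu> a"
  proof (rule ccontr)
    assume "\<not> \<sigma> b \<le> \<nu> a"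
    then have less: "\<nu> a < \<sigma> b" by simp
    obtain c where c: "1 \<le> c" "c \<le> n" "\<nu> c = \<sigma> b" using position[OF in_range(2)] by auto
    have cb: "c \<le> b" using c fixed[of c] ne[of c b] by (cases "c \<le> b") auto
    have "c \<noteq> a" using c less by auto
    \<comment> \<open>If \<sigma> b stood at c < a, then \<sigma> c would lie strictly between
      \<sigma> a and \<sigma> b by the bound from position a, and the clause of
      \<open>allowed\<close> for passed positions would keep \<nu> c below \<sigma> b.\<close>
    moreover have "\<not> c < a"
    proof
      assume "c < a"
      then have "\<sigma> c < \<sigma> b" using lower[of c] c ab ne[of c b] by (simp add: order_less_le)
      moreover have "\<not> \<sigma> c < \<sigma> a" using upper[of c a] c \<open>c < a\<close> ab lt by auto
      then have "\<sigma> a < \<sigma> c" using ne[of a c] \<open>c < a\<close> by auto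
      then have "\<not> (\<sigma> c < \<sigma> j \<and> \<sigma> j < \<sigma> b)" if "k < j" "j < b" for j
        using cover[of j] that ab by auto
      ultimately show False using upper'[of c] c \<open>c < a\<close> by auto
    qed
    ultimately have ac: "a < c" by simp
    have "allowed k a b \<sigma> a (\<nu> c)"
      using ab lt between' c(3) by (auto simp: allowed_le)
    moreover have "allowed k a b \<sigma> c (\<nu> a)"
    proof (cases "c \<le> k")
      case True
      then have "\<sigma> c < \<sigma> a" using lower[of c] c between[of c] ac ab by auto
      then have "\<sigma> c \<le> \<nu> a" using lower[of a] ab by simp
      moreover have "\<nu> a < \<sigma> j" if "c < j" "j \<le> k" "\<sigma> c < \<sigma> j" for j
        using upper[of c j] that c less by simp
      ultimately show ?thesis using True ac by (simp add: allowed_le)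
    next
      case False
      have "\<sigma> j < \<nu> a" if "k < j" "j < c" "\<sigma> j < \<sigma> c" for j
        using tail'[of j c] that cb c between[of j] lower[of a] ab by auto
      then show ?thesis using False tail[of c] cb c less by (simp add: allowed_gt)
    qed
    ultimately have "\<nu> \<circ> transpose a c \<in> pieri_part n k a b \<sigma>"
      using ab ac cb by (intro pieri_part_swap[OF \<nu>]) auto
    with max[of a c] show False using ab ac c less by simp
  qed
  have B: "\<nu> b \<le> \<sigma> a"
  proof (rule ccontr)
    assume "\<not> \<nu> b \<le> \<sigma> a"
    then have less: "\<sigma> a < \<nu> b" by simp
    obtain c where c: "1 \<le> c" "c \<le> n" "\<nu> c = \<sigma> a" using position[OF in_range(1)] by auto
    have "c \<le> b" using c fixed[of c] ne[of c a] ab by (cases "c \<le> b") auto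
    moreover have "c \<noteq> b" "c \<noteq> a" using c less A lt by auto
    moreover have "\<not> c < a"
    proof
      assume "c < a"
      then have "\<sigma> c < \<sigma> a" using lower[of c] c ab ne[of c a] by (simp add: order_less_le)
      then show False using upper[of c a] c \<open>c < a\<close> ab by auto
    qed
    ultimately have acb: "a < c" "c < b" by simp_all
    have "allowed k a b \<sigma> c (\<nu> b)"
    proof (cases "c \<le> k")
      case True
      have "\<nu> b < \<sigma> j" if "c < j" "j \<le> k" "\<sigma> c < \<sigma> j" for j
        using upper[of c j] that c between[of j] acb ab tail[of b] by fastforce
      moreover have "\<sigma> c \<le> \<nu> b" using lower[of c] True c less by simp
      ultimately show ?thesis using True acb by (simp add: allowed_le)
    next
      case False
      have "\<nu> b \<le> \<sigma> c"
        using tail[of c] tail[of b] between[of c] False c acb ab by fastforce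
      moreover have "\<sigma> j < \<nu> b" if "k < j" "j < c" "\<sigma> j < \<sigma> c" for j
        using tail'[of j c] that acb c less by simp
      ultimately show ?thesis using False by (simp add: allowed_gt)
    qed
    moreover have "\<sigma> j < \<sigma> a" if "k < j" "j < b" "\<sigma> j < \<sigma> b" for j
      using between[of j] that ab by auto
    then have "allowed k a b \<sigma> b (\<nu> c)"
      using ab c lt by (simp add: allowed_gt)
    ultimately have "\<nu> \<circ> transpose c b \<in> pieri_part n k a b \<sigma>"
      using ab acb c by (intro pieri_part_swap[OF \<nu>]) auto
    with max[of c b] show False using ab acb c less by simp
  qed
  let ?\<sigma> = "\<sigma> \<circ> transpose a b"
  have \<sigma>': "?\<sigma> a = \<sigma> b" "?\<sigma> b = \<sigma> a" "\<And>j. j \<noteq> a \<Longrightarrow> j \<noteq> b \<Longrightarrow> ?\<sigma> j = \<sigma> j"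
    by (simp_all add: transpose_apply_other)
  have "allowed k (Suc a) b ?\<sigma> c (\<nu> c)" if c: "1 \<le> c" "c \<le> b" for c
  proof (cases "c \<le> k")
    case True
    have l: "?\<sigma> c \<le> \<nu> c"
      using A lower[of c] c True \<sigma>' ab by (metis order_le_less_trans order_less_irrefl)
    have u: "\<nu> c < ?\<sigma> j" if j: "c < j" "j \<le> k" "?\<sigma> c < ?\<sigma> j" for j
    proof (cases "c = a \<or> j = a")
      case False
      then show ?thesis using upper[of c j] j c ab \<sigma>' by auto
    next
      case True
      show ?thesis
      proof (cases "c = a")
        case True
        then have "\<sigma> b < \<sigma> j" using j ab \<sigma>' by auto
        then show ?thesis using upper[of a j] True j ab lt \<sigma>' by auto
      next
        case False
        then have ja: "j = a" using \<open>c = a \<or> j = a\<close> by simp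
        have "\<sigma> c < \<sigma> b" using j ja ab \<sigma>'(1) \<sigma>'(3)[of c] by auto
        \<comment> \<open>After the exchange position a carries \<sigma> b as bound. When \<sigma> c
          already exceeds \<sigma> a, the old bound says nothing and the clause for passed positions
          supplies the new one.\<close>
        have "\<nu> c < \<sigma> b"
        proof (cases "\<sigma> c < \<sigma> a")
          case True
          then show ?thesis using upper[of c a] ja j c ab lt by auto
        next
          case False
          then have "\<sigma> a < \<sigma> c" using ne[of a c] j ja by auto
          then show ?thesis
            using upper'[of c] c j ja \<open>\<sigma> c < \<sigma> b\<close> cover ab by (meson less_trans order_le_less_trans)
        qed
        then show ?thesis using ja \<sigma>' by simp
      qed
    qed
    have w: "\<nu> c < ?\<sigma> b" if "c < Suc a" "?\<sigma> c < ?\<sigma> b"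
      using that \<sigma>' lt upper[of c a] c ab True by (cases "c = a") auto
    show ?thesis using l u w True by (simp add: allowed_le)
  next
    case False
    show ?thesis
    proof (cases "c = b")
      case True
      have "\<sigma> j < \<nu> b" if "k < j" "j < b" "\<sigma> j < \<sigma> a" for j
        using tail'[of j b] that lt by simp
      then show ?thesis using False True B \<sigma>' ab by (auto simp: allowed_gt)
    next
      case cb: False
      have "\<sigma> j < \<nu> c" if "k < j" "j < c" "\<sigma> j < \<sigma> c" for j
        using tail'[of j c] that c cb by simp
      then show ?thesis using False cb tail[of c] c \<sigma>' ab by (auto simp: allowed_gt)
    qed
  qed
  then show ?thesis using perm fixed ab \<sigma>' by (auto simp: pieri_part_def)
qed

text \<open>Only the clause at c = a is new. If \<sigma> a < \<sigma> b and no intermediate value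
  sits in positions k+1, ..., b-1, then failure to be a cover provides one at a position j \<le> k,
  and the bound \<nu> a < \<sigma> j is even stronger.\<close>

lemma pieri_part_not_cover:
  assumes \<sigma>: "\<sigma> permutes {1..n}" and ab: "1 \<le> a" "a \<le> k" "k < b"
    and cover: "\<not> (\<sigma> a < \<sigma> b \<and> (\<forall>j. a < j \<longrightarrow> j < b \<longrightarrow> \<not> (\<sigma> a < \<sigma> j \<and> \<sigma> j < \<sigma> b)))"
    and \<nu>: "\<nu> \<in> pieri_part n k a b \<sigma>"
  shows "\<nu> \<in> pieri_part n k (Suc a) b \<sigma>"
proof -
  have al: "allowed k a b \<sigma> c (\<nu> c)" if "1 \<le> c" "c \<le> b" for c
    using \<nu> that by (auto simp: pieri_part_def)
  have "\<nu> a < \<sigma> b" if less: "\<sigma> a < \<sigma> b" and tail: "\<forall>j. k < j \<and> j < b \<longrightarrow> \<not> (\<sigma> a < \<sigma> j \<and> \<sigma> j < \<sigma> b)"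
  proof -
    obtain j where "a < j" "j < b" "\<sigma> a < \<sigma> j" "\<sigma> j < \<sigma> b" using cover less by blast
    moreover from this tail have "j \<le> k" by (meson not_le_imp_less)
    ultimately show ?thesis using al[of a] ab by (auto simp: allowed_le dest: less_trans)
  qed
  then have "allowed k (Suc a) b \<sigma> c (\<nu> c)" if "1 \<le> c" "c \<le> b" for c
    using al[OF that] by (cases "c = a") (auto simp: allowed_def)
  then show ?thesis using \<nu> by (auto simp: pieri_part_def)
qed

text \<open>Pigeonhole: if \<nu> b < \<sigma> b, let S be the positions where \<sigma> takes values
  in [\<nu> b, \<sigma> b). All bounds together show that \<nu> maps S into the same interval, hence
  onto it, so b itself lies in S; but \<sigma> b is excluded from the interval.\<close>

lemma pieri_part_block_end:
  assumes \<sigma>: "\<sigma> permutes {1..n}" and kb: "k < b" "b \<le> n"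
    and \<nu>: "\<nu> \<in> pieri_part n k (Suc k) b \<sigma>"
  shows "\<nu> \<in> pieri_part n k 1 (b - 1) \<sigma>"
proof -
  have perm: "\<nu> permutes {1..n}" and fixed: "\<And>j. b < j \<Longrightarrow> \<nu> j = \<sigma> j"
    and al: "\<And>c. 1 \<le> c \<Longrightarrow> c \<le> b \<Longrightarrow> allowed k (Suc k) b \<sigma> c (\<nu> c)"
    using \<nu> by (auto simp: pieri_part_def)
  have "\<nu> b = \<sigma> b"
  proof (rule ccontr)
    assume "\<nu> b \<noteq> \<sigma> b"
    moreover have "\<nu> b \<le> \<sigma> b" and tail: "\<And>j. k < j \<Longrightarrow> j < b \<Longrightarrow> \<sigma> j < \<sigma> b \<Longrightarrow> \<sigma> j < \<nu> b"
      using al[of b] kb by (auto simp: allowed_gt)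
    ultimately have less: "\<nu> b < \<sigma> b" by simp
    define S where "S = {c. \<nu> b \<le> \<sigma> c \<and> \<sigma> c < \<sigma> b}"
    have vals: "{\<nu> b..<\<sigma> b} \<subseteq> {1..n}"
      using permutes_in_image[OF perm, of b] permutes_in_image[OF \<sigma>, of b] kb by auto
    have img: "\<sigma> ` S = {\<nu> b..<\<sigma> b}"
    proof
      show "{\<nu> b..<\<sigma> b} \<subseteq> \<sigma> ` S"
      proof
        fix v assume v: "v \<in> {\<nu> b..<\<sigma> b}"
        then have "pos \<sigma> v \<in> S" "\<sigma> (pos \<sigma> v) = v"
          by (simp_all add: S_def permutes_inverses(1)[OF \<sigma>])
        then show "v \<in> \<sigma> ` S" by (metis imageI)
      qed
    qed (auto simp: S_def)
    have "S \<subseteq> {1..n}"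
    proof
      fix c assume "c \<in> S"
      then have "\<sigma> c \<in> {1..n}" using img vals by blast
      then show "c \<in> {1..n}" by (simp only: permutes_in_image[OF \<sigma>])
    qed
    then have fin: "finite S" using finite_subset by blast
    have sub: "\<nu> ` S \<subseteq> {\<nu> b..<\<sigma> b}"
    proof
      fix v assume "v \<in> \<nu> ` S"
      then obtain c where c: "c \<in> S" "v = \<nu> c" by blast
      then have cn: "1 \<le> c" "c \<le> n" "\<nu> b \<le> \<sigma> c" "\<sigma> c < \<sigma> b" using \<open>S \<subseteq> {1..n}\<close> by (auto simp: S_def)
      consider "c \<le> k" | "k < c" "c < b" | "c = b" | "b < c" by linarith
      then show "v \<in> {\<nu> b..<\<sigma> b}"
      proof cases
        case 1
        \<comment> \<open>At the end of the block every c \<le> k has been passed, so the clause for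
          passed positions applies and gives \<nu> c < \<sigma> b.\<close>
        have "\<not> (\<sigma> c < \<sigma> j \<and> \<sigma> j < \<sigma> b)" if "k < j" "j < b" for j
          using tail[OF that] cn by auto
        then have "\<nu> c < \<sigma> b" "\<sigma> c \<le> \<nu> c"
          using al[of c] 1 cn kb by (auto simp: allowed_le)
        then show ?thesis using c cn by simp
      next
        case 2
        then show ?thesis using tail[of c] cn by simp
      next
        case 3
        then show ?thesis using cn by simp
      next
        case 4
        then show ?thesis using fixed[of c] c cn by simp
      qed
    qed
    have "card (\<nu> ` S) = card (\<sigma> ` S)"
      by (simp add: card_image permutes_inj_on[OF perm] permutes_inj_on[OF \<sigma>])
    then have "\<nu> ` S = {\<nu> b..<\<sigma> b}"
      using sub by (intro card_subset_eq) (simp_all add: img)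
    then have "\<nu> b \<in> \<nu> ` S" using less by simp
    then have "b \<in> S" using permutes_eq_iff[OF perm] by auto
    then show False by (simp add: S_def)
  qed
  moreover have "allowed k 1 (b - 1) \<sigma> c (\<nu> c)" if "1 \<le> c" "c \<le> b - 1" for c
    using al[of c] that by (auto simp: allowed_def)
  moreover have "j = b \<or> b < j" if "b - 1 < j" for j using that by auto
  ultimately show ?thesis using perm fixed by (auto simp: pieri_part_def)
qed

text \<open>Both permutations have the same sum over S, so inequalities in one direction are
  equalities.\<close>

lemma permutes_eqI_le:
  assumes \<sigma>: "\<sigma> permutes S" and \<nu>: "\<nu> permutes S" and "finite S"
    and eq: "\<And>x. x \<in> S \<Longrightarrow> x \<notin> T \<Longrightarrow> \<nu> x = \<sigma> x" and le: "\<And>x. x \<in> S \<Longrightarrow> x \<in> T \<Longrightarrow> \<sigma> x \<le> (\<nu> x :: nat)"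
  shows "\<nu> = \<sigma>"
proof
  have le': "\<sigma> x \<le> \<nu> x" if "x \<in> S" for x using eq le that by (cases "x \<in> T") auto
  have "sum \<sigma> S = sum \<nu> S"
    using sum.permute[OF \<sigma>, of id] sum.permute[OF \<nu>, of id] by (simp add: comp_def)
  then have "\<sigma> x = \<nu> x" if "x \<in> S" for x
    by (rule sum_mono_inv[OF _ le' that \<open>finite S\<close>])
  then show "\<nu> x = \<sigma> x" for x
    using permutes_not_in[OF \<sigma>] permutes_not_in[OF \<nu>] by (cases "x \<in> S") auto
qed

lemma pieri_part_empty:
  assumes "\<sigma> permutes {1..n}" "\<nu> \<in> pieri_part n k 1 k \<sigma>"
  shows "\<nu> = \<sigma>"
  by (rule permutes_eqI_le[where T = "{1..k}", OF assms(1)])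
     (use assms(2) in \<open>auto simp: pieri_part_def allowed_le\<close>)

section \<open>The greedy chain and its maximality\<close>

fun greedy_chain :: "nat \<Rightarrow> (nat \<Rightarrow> nat) \<Rightarrow> (nat \<times> nat) list \<Rightarrow> nat \<Rightarrow> nat" where
  "greedy_chain n \<sigma> [] = \<sigma>"
| "greedy_chain n \<sigma> ((a, b) # rs) =
    greedy_chain n (if bruhat_covers n \<sigma> (\<sigma> \<circ> transpose a b) then \<sigma> \<circ> transpose a b else \<sigma>) rs"

lemma transp_list_Suc:
  "k \<le> b \<Longrightarrow> transp_list (Suc b) k = map (\<lambda>a. (a, Suc b)) [1..<Suc k] @ transp_list b k"
  by (simp add: transp_list_def)

lemma transp_list_self: "transp_list k k = []"
  by (simp add: transp_list_def)

text \<open>The induction runs along the list, the outer one over the blocks of constant b and the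
  inner one over a. At a cover, \<nu> is first raised to an element admitting no ascending exchange,
  because only such elements are known to survive the exchange made in \<sigma>.\<close>

lemma pieri_set_le_greedy:
  assumes "\<sigma> permutes {1..n}" "k \<le> b" "b \<le> n" "\<nu> \<in> pieri_part n k 1 b \<sigma>"
  shows "bruhat_le n \<nu> (greedy_chain n \<sigma> (transp_list b k))"
  using assms(2,1,3,4)
proof (induction b arbitrary: \<sigma> \<nu> rule: dec_induct)
  case base
  then have "\<nu> = \<sigma>" by (intro pieri_part_empty)
  then show ?case by (simp add: transp_list_self)
next
  case (step b)
  have "bruhat_le n \<nu> (greedy_chain n \<sigma> (map (\<lambda>a. (a, Suc b)) [a..<Suc k] @ transp_list b k))"
    if "1 \<le> a" "a \<le> Suc k" "\<sigma> permutes {1..n}" "\<nu> \<in> pieri_part n k a (Suc b) \<sigma>" for a \<sigma> \<nu>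
    using that(2,1,3,4)
  proof (induction a arbitrary: \<sigma> \<nu> rule: inc_induct)
    case base
    then have "\<nu> \<in> pieri_part n k 1 b \<sigma>"
      using pieri_part_block_end[of \<sigma> n k "Suc b" \<nu>] step by simp
    then show ?case using step base by simp
  next
    case (step a)
    let ?b = "Suc b"
    have kb: "k < ?b" "?b \<le> n" using \<open>k \<le> b\<close> \<open>Suc b \<le> n\<close> by auto
    have upt: "[a..<Suc k] = a # [Suc a..<Suc k]" using step by (simp add: upt_conv_Cons)
    have iff: "bruhat_covers n \<sigma> (\<sigma> \<circ> transpose a ?b) \<longleftrightarrow>
        \<sigma> a < \<sigma> ?b \<and> (\<forall>j. a < j \<longrightarrow> j < ?b \<longrightarrow> \<not> (\<sigma> a < \<sigma> j \<and> \<sigma> j < \<sigma> ?b))"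
      using step kb by (intro bruhat_covers_transpose_iff) auto
    show ?case
    proof (cases "bruhat_covers n \<sigma> (\<sigma> \<circ> transpose a ?b)")
      case True
      obtain \<mu> where \<mu>: "\<mu> \<in> pieri_part n k a ?b \<sigma>" "bruhat_le n \<nu> \<mu>"
        "\<forall>x y. 1 \<le> x \<and> x < y \<and> y \<le> n \<and> \<mu> x < \<mu> y \<longrightarrow> \<mu> \<circ> transpose x y \<notin> pieri_part n k a ?b \<sigma>"
        using exists_swap_maximal_above[OF \<open>\<nu> \<in> _\<close>, of n] by (auto simp: pieri_part_def)
      have "\<mu> \<in> pieri_part n k (Suc a) ?b (\<sigma> \<circ> transpose a ?b)"
        by (rule pieri_part_cover) (use step kb \<mu> True iff in auto)
      moreover have "\<sigma> \<circ> transpose a ?b permutes {1..n}"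
        using step kb by (intro permutes_comp_transpose) auto
      ultimately have "bruhat_le n \<mu> (greedy_chain n (\<sigma> \<circ> transpose a ?b) (map (\<lambda>a. (a, ?b)) [Suc a..<Suc k] @ transp_list b k))"
        using step by simp
      then show ?thesis using bruhat_le_trans[OF \<mu>(2)] True by (simp only: upt) simp
    next
      case False
      have "\<nu> \<in> pieri_part n k (Suc a) ?b \<sigma>"
        by (rule pieri_part_not_cover) (use step kb False iff in auto)
      then show ?thesis using step False by (simp only: upt) simp
    qed
  qed
  from this[of 1 \<sigma> \<nu>] show ?case using step by (simp add: transp_list_Suc)
qed

text \<open>The order in which \<^const>\<open>transp_list\<close> enumerates its transpositions.\<close>

definition transp_before :: "nat \<times> nat \<Rightarrow> nat \<times> nat \<Rightarrow> bool" where
  "transp_before r s \<longleftrightarrow> snd s < snd r \<or> snd r = snd s \<and> fst r < fst s"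

lemma transp_list_sorted:
  assumes "k \<le> b"
  shows "sorted_wrt transp_before (transp_list b k) \<and> set (transp_list b k) \<subseteq> {1..k} \<times> {k<..b}"
  using assms
proof (induction b rule: dec_induct)
  case base
  then show ?case by (simp add: transp_list_self)
next
  case (step b)
  have "sorted_wrt transp_before (map (\<lambda>a. (a, Suc b)) [1..<Suc k])"
    by (simp add: sorted_wrt_map transp_before_def del: upt_Suc)
  moreover have sub: "set (transp_list b k) \<subseteq> {1..k} \<times> {k<..b}"
    and sorted: "sorted_wrt transp_before (transp_list b k)"
    using step.IH by simp_all
  have "transp_before r s" if "r \<in> set (map (\<lambda>a. (a, Suc b)) [1..<Suc k])" "s \<in> set (transp_list b k)" for r s
  proof -
    have "snd s \<le> b" using sub that(2) by auto
    then show ?thesis using that(1) by (auto simp: transp_before_def)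
  qed
  moreover have "set (map (\<lambda>a. (a, Suc b)) [1..<Suc k]) \<subseteq> {1..k} \<times> {k<..Suc b}"
    using step.hyps by (auto simp del: upt_Suc)
  moreover have "{1..k} \<times> {k<..b} \<subseteq> {1..k} \<times> {k<..Suc b}" by auto
  ultimately show ?case
    unfolding transp_list_Suc[OF step.hyps(1)] sorted_wrt_append set_append
    using sub sorted by blast
qed

text \<open>
  The invariant of a saturated chain whose last transposition was \<open>r\<close>: later transpositions cannot
  make the value in a position \<open>j \<le> k\<close> jump over a value to its right that it has not yet passed.
\<close>

definition chain_inv :: "nat \<Rightarrow> nat \<Rightarrow> (nat \<Rightarrow> nat) \<Rightarrow> nat \<times> nat \<Rightarrow> (nat \<Rightarrow> nat) \<Rightarrow> bool" where
  "chain_inv n k \<sigma> r \<mu> \<longleftrightarrow> \<mu> \<in> pieri_set n k \<sigma> \<and>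
    (\<forall>j. k < j \<and> j < snd r \<longrightarrow> \<mu> j = \<sigma> j) \<and>
    (\<forall>j j'. 1 \<le> j \<and> j \<le> k \<and> k < j' \<and> j' < snd r \<and> \<sigma> j < \<sigma> j' \<longrightarrow> \<mu> j < \<sigma> j') \<and>
    (\<forall>j. fst r < j \<and> j \<le> k \<and> \<sigma> j \<le> \<mu> (snd r) \<longrightarrow> \<mu> j < \<mu> (snd r))"

text \<open>For a = 1 and b = n only four families of inequalities remain, two for positions up to k
  and two for the others; from here on the set is handled through these.\<close>

lemma pieri_setD:
  assumes "\<mu> \<in> pieri_set n k \<sigma>" "k \<le> n"
  shows "\<mu> permutes {1..n}"
    and "\<And>c. 1 \<le> c \<Longrightarrow> c \<le> k \<Longrightarrow> \<sigma> c \<le> \<mu> c"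
    and "\<And>c j. 1 \<le> c \<Longrightarrow> c < j \<Longrightarrow> j \<le> k \<Longrightarrow> \<sigma> c < \<sigma> j \<Longrightarrow> \<mu> c < \<sigma> j"
    and "\<And>d. k < d \<Longrightarrow> d \<le> n \<Longrightarrow> \<mu> d \<le> \<sigma> d"
    and "\<And>j d. k < j \<Longrightarrow> j < d \<Longrightarrow> d \<le> n \<Longrightarrow> \<sigma> j < \<sigma> d \<Longrightarrow> \<sigma> j < \<mu> d"
proof -
  have al: "allowed k 1 n \<sigma> c (\<mu> c)" if "1 \<le> c" "c \<le> n" for c
    using assms(1) that by (auto simp: pieri_part_def)
  show "\<mu> permutes {1..n}" using assms(1) by (simp add: pieri_part_def)
  show "\<sigma> c \<le> \<mu> c" if "1 \<le> c" "c \<le> k" for c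
    using al[of c] that assms(2) by (simp add: allowed_le)
  show "\<mu> c < \<sigma> j" if "1 \<le> c" "c < j" "j \<le> k" "\<sigma> c < \<sigma> j" for c j
    using al[of c] that assms(2) by (simp add: allowed_le)
  show "\<mu> d \<le> \<sigma> d" if "k < d" "d \<le> n" for d
    using al[of d] that by (simp add: allowed_gt)
  show "\<sigma> j < \<mu> d" if "k < j" "j < d" "d \<le> n" "\<sigma> j < \<sigma> d" for j d
    using al[of d] that by (simp add: allowed_gt)
qed

lemma pieri_setI:
  assumes "\<mu> permutes {1..n}" "\<sigma> permutes {1..n}"
    and "\<And>c. 1 \<le> c \<Longrightarrow> c \<le> k \<Longrightarrow> \<sigma> c \<le> \<mu> c"
    and "\<And>c j. 1 \<le> c \<Longrightarrow> c < j \<Longrightarrow> j \<le> k \<Longrightarrow> \<sigma> c < \<sigma> j \<Longrightarrow> \<mu> c < \<sigma> j"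
    and "\<And>d. k < d \<Longrightarrow> d \<le> n \<Longrightarrow> \<mu> d \<le> \<sigma> d"
    and "\<And>j d. k < j \<Longrightarrow> j < d \<Longrightarrow> d \<le> n \<Longrightarrow> \<sigma> j < \<sigma> d \<Longrightarrow> \<sigma> j < \<mu> d"
  shows "\<mu> \<in> pieri_set n k \<sigma>"
proof -
  have "\<mu> j = \<sigma> j" if "n < j" for j
    using permutes_not_in[OF assms(1), of j] permutes_not_in[OF assms(2), of j] that by simp
  moreover have "allowed k 1 n \<sigma> c (\<mu> c)" if "1 \<le> c" "c \<le> n" for c
    using assms that by (simp add: allowed_def)
  ultimately show ?thesis using assms(1) by (simp add: pieri_part_def)
qed

text \<open>The delicate bound is that of position a by some \<sigma> j with a < j \<le> k. If the
  new value \<mu> b had reached \<sigma> j, then \<mu> j < \<mu> b by the invariant, so \<mu> j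
  would lie strictly between \<mu> a and \<mu> b, and the exchange would not be a cover.\<close>

lemma chain_inv_step:
  assumes \<sigma>: "\<sigma> permutes {1..n}" and inv: "chain_inv n k \<sigma> r \<mu>" and before: "transp_before r (a, b)"
    and ab: "1 \<le> a" "a \<le> k" "k < b" "b \<le> n" and cov: "bruhat_covers n \<mu> (\<mu> \<circ> transpose a b)"
  shows "chain_inv n k \<sigma> (a, b) (\<mu> \<circ> transpose a b)"
proof -
  from ab have kn: "k \<le> n" by simp
  have mem: "\<mu> \<in> pieri_set n k \<sigma>" using inv by (simp add: chain_inv_def)
  note \<mu> = pieri_setD[OF mem kn]
  note ne = permutes_eq_iff[OF \<mu>(1)] and ne\<sigma> = permutes_eq_iff[OF \<sigma>]
  have fixed: "\<mu> j = \<sigma> j" if "k < j" "j < b" for j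
    using inv before that by (auto simp: chain_inv_def transp_before_def)
  have below: "\<mu> j < \<sigma> j'" if "1 \<le> j" "j \<le> k" "k < j'" "j' < b" "\<sigma> j < \<sigma> j'" for j j'
  proof -
    have "j' < snd r" using before that(4) by (auto simp: transp_before_def)
    then show ?thesis using inv that by (simp add: chain_inv_def)
  qed
  \<comment> \<open>In a new block, position b is untouched and the bounds by untouched positions
    apply; within the same block, a comes after \<open>fst r\<close> and the last part of the
    invariant applies.\<close>
  have below': "\<mu> j < \<mu> b" if "a \<le> j" "j \<le> k" "\<sigma> j \<le> \<mu> b" for j
  proof (cases "b < snd r")
    case True
    then have "\<mu> b = \<sigma> b" using inv ab by (simp add: chain_inv_def)
    moreover have "\<sigma> j \<noteq> \<sigma> b" using ne\<sigma>[of j b] that ab by auto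
    ultimately show ?thesis using inv that ab True by (auto simp: chain_inv_def)
  next
    case False
    then have "b = snd r" "fst r < a" using before by (auto simp: transp_before_def)
    then show ?thesis using inv that by (auto simp: chain_inv_def)
  qed
  have lt: "\<mu> a < \<mu> b" and gap: "\<And>j. a < j \<Longrightarrow> j < b \<Longrightarrow> \<not> (\<mu> a < \<mu> j \<and> \<mu> j < \<mu> b)"
    using cov ab \<mu>(1) by (auto simp: bruhat_covers_transpose_iff)
  have between: "\<mu> j < \<mu> a \<or> \<mu> b < \<mu> j" if "a < j" "j < b" for j
    using gap[OF that] ne[of j a] ne[of j b] that by (metis nat_neq_iff)
  let ?\<mu> = "\<mu> \<circ> transpose a b"
  have \<mu>': "?\<mu> a = \<mu> b" "?\<mu> b = \<mu> a" "\<And>j. j \<noteq> a \<Longrightarrow> j \<noteq> b \<Longrightarrow> ?\<mu> j = \<mu> j"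
    by (simp_all add: transpose_apply_other)
  have "?\<mu> \<in> pieri_set n k \<sigma>"
  proof (rule pieri_setI[OF _ \<sigma>])
    show "?\<mu> permutes {1..n}" using ab \<mu>(1) by (intro permutes_comp_transpose) auto
    show "\<sigma> c \<le> ?\<mu> c" if "1 \<le> c" "c \<le> k" for c
      using \<mu>(2)[OF that] lt \<mu>' ab that by (cases "c = a") auto
    show "?\<mu> c < \<sigma> j" if c: "1 \<le> c" "c < j" "j \<le> k" "\<sigma> c < \<sigma> j" for c j
    proof (cases "c = a")
      case True
      have "\<not> \<sigma> j \<le> \<mu> b"
      proof
        assume "\<sigma> j \<le> \<mu> b"
        then have "\<mu> j < \<mu> b" using below'[of j] True c by simp
        moreover have "\<mu> a < \<mu> j" using \<mu>(3)[of c j] \<mu>(2)[of j] c True by simp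
        ultimately show False using between[of j] c True ab by auto
      qed
      then show ?thesis using True \<mu>' by simp
    next
      case False
      then show ?thesis using \<mu>(3)[OF c] \<mu>'(3)[of c] c ab by simp
    qed
    show "?\<mu> d \<le> \<sigma> d" if "k < d" "d \<le> n" for d
      using \<mu>(4)[OF that] lt \<mu>' ab that by (cases "d = b") auto
    show "\<sigma> j < ?\<mu> d" if d: "k < j" "j < d" "d \<le> n" "\<sigma> j < \<sigma> d" for j d
    proof (cases "d = b")
      case True
      then have "\<mu> j < \<mu> b" using \<mu>(5)[OF d] fixed[of j] d by simp
      then show ?thesis using between[of j] fixed[of j] d True ab \<mu>' by auto
    next
      case False
      then show ?thesis using \<mu>(5)[OF d] \<mu>'(3)[of d] d ab by simp
    qed
  qed
  moreover have "?\<mu> j = \<sigma> j" if "k < j" "j < b" for j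
    using fixed[OF that] \<mu>'(3)[of j] that ab by simp
  moreover have "?\<mu> j < \<sigma> j'" if j: "1 \<le> j" "j \<le> k" "k < j'" "j' < b" "\<sigma> j < \<sigma> j'" for j j'
  proof (cases "j = a")
    case True
    then show ?thesis using below[OF j] fixed[of j'] between[of j'] j \<mu>' ab by auto
  next
    case False
    then show ?thesis using below[OF j] \<mu>'(3)[of j] j ab by simp
  qed
  moreover have "?\<mu> j < ?\<mu> b" if j: "a < j" "j \<le> k" "\<sigma> j \<le> ?\<mu> b" for j
  proof -
    have "\<mu> j < \<mu> b" using below'[of j] j lt \<mu>' by simp
    then show ?thesis using between[of j] j ab \<mu>' by auto
  qed
  ultimately show ?thesis by (simp add: chain_inv_def)
qed

lemma saturated_chain_in_pieri_set:
  assumes "\<sigma> permutes {1..n}" "chain_inv n k \<sigma> r \<mu>" "saturated_chain n \<mu> rs"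
    and "sorted_wrt transp_before (r # rs)" "set rs \<subseteq> {1..k} \<times> {k<..n}"
  shows "transp_prod \<mu> rs \<in> pieri_set n k \<sigma>"
  using assms(2-5)
proof (induction rs arbitrary: r \<mu>)
  case Nil
  then show ?case by (simp add: chain_inv_def)
next
  case (Cons s rs)
  obtain a b where s: "s = (a, b)" by fastforce
  have "chain_inv n k \<sigma> (a, b) (\<mu> \<circ> transpose a b)"
    using Cons.prems s by (intro chain_inv_step[OF assms(1) Cons.prems(1)]) auto
  then have "transp_prod (\<mu> \<circ> transpose a b) rs \<in> pieri_set n k \<sigma>"
    by (rule Cons.IH) (use Cons.prems s in \<open>simp_all del: comp_apply\<close>)
  then show ?case by (simp add: s)
qed

lemma sorted_wrt_nths: "sorted_wrt P xs \<Longrightarrow> sorted_wrt P (nths xs J)"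
  by (induction xs arbitrary: J) (auto simp: nths_Cons dest: in_set_nthsD)

lemma pieri_set_self: "\<sigma> permutes {1..n} \<Longrightarrow> \<sigma> \<in> pieri_set n k \<sigma>"
  by (rule pieri_setI) auto

lemma admissible_in_pieri_set:
  assumes "\<sigma> permutes {1..n}" "k \<le> n" "admissible n k \<sigma> J"
  shows "transp_prod \<sigma> (nths (transp_list n k) J) \<in> pieri_set n k \<sigma>"
proof -
  \<comment> \<open>A fictitious transposition preceding the whole list: n + 1 makes every position
    beyond k count as untouched, and the first component k empties the last part of the
    invariant.\<close>
  have "chain_inv n k \<sigma> (k, Suc n) \<sigma>"
    using pieri_set_self[OF assms(1)] by (auto simp: chain_inv_def)
  moreover have sub: "set (nths (transp_list n k) J) \<subseteq> {1..k} \<times> {k<..n}"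
    using transp_list_sorted[OF assms(2)] set_nths_subset by fast
  moreover from sub have "sorted_wrt transp_before ((k, Suc n) # nths (transp_list n k) J)"
    using sorted_wrt_nths transp_list_sorted[OF assms(2)] by (fastforce simp: transp_before_def)
  ultimately show ?thesis
    using assms by (intro saturated_chain_in_pieri_set) (auto simp: admissible_def)
qed

lemma perm_length_saturated_chain:
  "saturated_chain n \<sigma> rs \<Longrightarrow> perm_length n (transp_prod \<sigma> rs) = perm_length n \<sigma> + length rs"
proof (induction rs arbitrary: \<sigma>)
  case (Cons r rs)
  obtain a b where "r = (a, b)" by fastforce
  moreover from this have "perm_length n (transp_prod (\<sigma> \<circ> transpose a b) rs) = perm_length n (\<sigma> \<circ> transpose a b) + length rs"
    by (intro Cons.IH) (use Cons.prems in \<open>simp del: comp_apply\<close>)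
  ultimately show ?case using Cons.prems by (simp add: bruhat_covers_def)
qed simp

lemma greedy_chain_nths:
  "\<exists>J. J \<subseteq> {..<length rs} \<and> saturated_chain n \<sigma> (nths rs J) \<and> greedy_chain n \<sigma> rs = transp_prod \<sigma> (nths rs J)"
proof (induction rs arbitrary: \<sigma>)
  case Nil
  then show ?case by simp
next
  case (Cons r rs)
  obtain a b where r: "r = (a, b)" by fastforce
  have Suc: "{j. Suc j \<in> insert 0 (Suc ` J)} = J" "{j. Suc j \<in> Suc ` J} = J" for J by auto
  show ?case
  proof (cases "bruhat_covers n \<sigma> (\<sigma> \<circ> transpose a b)")
    case True
    obtain J where "J \<subseteq> {..<length rs}" "saturated_chain n (\<sigma> \<circ> transpose a b) (nths rs J)"
      "greedy_chain n (\<sigma> \<circ> transpose a b) rs = transp_prod (\<sigma> \<circ> transpose a b) (nths rs J)"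
      using Cons by blast
    then show ?thesis
      using True by (intro exI[of _ "insert 0 (Suc ` J)"]) (auto simp: r nths_Cons Suc)
  next
    case False
    obtain J where "J \<subseteq> {..<length rs}" "saturated_chain n \<sigma> (nths rs J)"
      "greedy_chain n \<sigma> rs = transp_prod \<sigma> (nths rs J)"
      using Cons by blast
    then show ?thesis
      using False by (intro exI[of _ "Suc ` J"]) (auto simp: r nths_Cons Suc)
  qed
qed

lemma bruhat_le_eq_or_less: "bruhat_le n \<sigma> \<mu> \<Longrightarrow> \<sigma> = \<mu> \<or> perm_length n \<sigma> < perm_length n \<mu>"
  unfolding bruhat_le_def by (induction rule: rtranclp_induct) (auto simp: bruhat_step_def)

text \<open>Every admissible chain ends in the set, hence below the greedy end point, which is
  itself the end of an admissible chain. Length counts the transpositions used, so a subset of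
  maximal cardinality cannot end lower than the greedy one and ends at the same permutation,
  whichever maximiser \<open>ARG_MAX\<close> selects.\<close>

lemma eta_greedy:
  assumes "\<sigma> permutes {1..n}" "k \<le> n"
  shows "eta n k \<sigma> = greedy_chain n \<sigma> (transp_list n k)"
    and "eta n k \<sigma> \<in> pieri_set n k \<sigma>"
proof -
  let ?L = "transp_list n k" and ?w = "\<lambda>J. transp_prod \<sigma> (nths (transp_list n k) J)"
  obtain J where J: "admissible n k \<sigma> J" "greedy_chain n \<sigma> ?L = ?w J"
    using greedy_chain_nths[of ?L n \<sigma>] by (auto simp: admissible_def)
  have len: "perm_length n (?w J) = perm_length n \<sigma> + card J" if "admissible n k \<sigma> J" for J
  proof -
    have "{i. i < length ?L \<and> i \<in> J} = J" using that by (auto simp: admissible_def)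
    then show ?thesis
      using that perm_length_saturated_chain by (simp add: admissible_def length_nths)
  qed
  define M where "M = (ARG_MAX card J. admissible n k \<sigma> J)"
  have "card J < Suc (length ?L)" if "admissible n k \<sigma> J" for J
    using that card_mono[of "{..<length ?L}" J] by (auto simp: admissible_def)
  then have M: "admissible n k \<sigma> M" "card J \<le> card M"
    using arg_max_nat_lemma[of "admissible n k \<sigma>" J card] J(1) unfolding M_def by blast+
  have mem: "?w M \<in> pieri_set n k \<sigma>"
    using admissible_in_pieri_set[OF assms M(1)] .
  then have "bruhat_le n (?w M) (greedy_chain n \<sigma> ?L)"
    using assms by (intro pieri_set_le_greedy) auto
  then have "?w M = greedy_chain n \<sigma> ?L"
    using bruhat_le_eq_or_less len[OF M(1)] len[OF J(1)] J(2) M(2) by fastforce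
  moreover have "eta n k \<sigma> = ?w M" by (simp add: eta_def M_def)
  ultimately show "eta n k \<sigma> = greedy_chain n \<sigma> ?L" "eta n k \<sigma> \<in> pieri_set n k \<sigma>"
    using mem by auto
qed

text \<open>
  From an element other than \<open>\<sigma>\<close> one can descend inside the set, starting from the leftmost
  position \<open>c \<le> k\<close> whose value exceeds that of \<open>\<sigma>\<close>.
\<close>

lemma pieri_set_descend:
  assumes \<sigma>: "\<sigma> permutes {1..n}" and kn: "k \<le> n" and \<nu>: "\<nu> \<in> pieri_set n k \<sigma>" and "\<nu> \<noteq> \<sigma>"
  obtains c e where "1 \<le> c" "c < e" "e \<le> n" "\<nu> e < \<nu> c" "\<nu> \<circ> transpose c e \<in> pieri_set n k \<sigma>"
proof -
  note D = pieri_setD[OF \<nu> kn]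
  have "\<exists>c. 1 \<le> c \<and> c \<le> k \<and> \<nu> c \<noteq> \<sigma> c"
  proof (rule ccontr)
    assume "\<not> ?thesis"
    then have "\<sigma> = \<nu>"
      using D by (intro permutes_eqI_le[where T = "{k<..n}", OF D(1) \<sigma>]) auto
    with \<open>\<nu> \<noteq> \<sigma>\<close> show False by simp
  qed
  then obtain c where c: "1 \<le> c" "c \<le> k" "\<nu> c \<noteq> \<sigma> c"
    and least: "\<And>e. e < c \<Longrightarrow> \<not> (1 \<le> e \<and> e \<le> k \<and> \<nu> e \<noteq> \<sigma> e)"
    using exists_least_iff[of "\<lambda>c. 1 \<le> c \<and> c \<le> k \<and> \<nu> c \<noteq> \<sigma> c"] by blast
  have less: "\<sigma> c < \<nu> c" using D(2)[of c] c by simp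
  \<comment> \<open>Pigeonhole on the positions T where \<nu> takes values in [\<sigma> c, \<nu> c):
    without such an e, \<sigma> would map T onto the same interval, so c would lie in T although
    \<nu> c is excluded. The last condition on e ensures that \<nu> c may stand there.\<close>
  have "\<exists>e. c < e \<and> e \<le> n \<and> \<sigma> c \<le> \<nu> e \<and> \<nu> e < \<nu> c \<and> (e \<le> k \<or> \<nu> c \<le> \<sigma> e)"
  proof (rule ccontr)
    assume none: "\<not> ?thesis"
    define T where "T = {e. \<sigma> c \<le> \<nu> e \<and> \<nu> e < \<nu> c}"
    have vals: "{\<sigma> c..<\<nu> c} \<subseteq> {1..n}"
      using permutes_in_image[OF D(1), of c] permutes_in_image[OF \<sigma>, of c] c kn by auto
    have img: "\<nu> ` T = {\<sigma> c..<\<nu> c}"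
    proof
      show "{\<sigma> c..<\<nu> c} \<subseteq> \<nu> ` T"
      proof
        fix v assume v: "v \<in> {\<sigma> c..<\<nu> c}"
        then have "pos \<nu> v \<in> T" "\<nu> (pos \<nu> v) = v"
          by (simp_all add: T_def permutes_inverses(1)[OF D(1)])
        then show "v \<in> \<nu> ` T" by (metis imageI)
      qed
    qed (auto simp: T_def)
    have T: "T \<subseteq> {1..n}"
    proof
      fix e assume "e \<in> T"
      then have "\<nu> e \<in> {1..n}" using img vals by blast
      then show "e \<in> {1..n}" by (simp only: permutes_in_image[OF D(1)])
    qed
    then have "finite T" using finite_subset by blast
    have "\<sigma> ` T \<subseteq> {\<sigma> c..<\<nu> c}"
    proof
      fix v assume "v \<in> \<sigma> ` T"
      then obtain e where e: "e \<in> T" "v = \<sigma> e" by blast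
      then have en: "1 \<le> e" "e \<le> n" "\<sigma> c \<le> \<nu> e" "\<nu> e < \<nu> c" using T by (auto simp: T_def)
      show "v \<in> {\<sigma> c..<\<nu> c}"
      proof (cases "e < c")
        case True
        then have "\<nu> e = \<sigma> e" using least[of e] c en by simp
        then show ?thesis using e en by simp
      next
        case False
        then have "c < e" using en by (cases "e = c") auto
        then have "k < e" "\<sigma> e < \<nu> c" using none en by (meson not_le)+
        then show ?thesis using e en D(4)[of e] by simp
      qed
    qed
    moreover have "card (\<sigma> ` T) = card (\<nu> ` T)"
      by (simp add: card_image permutes_inj_on[OF D(1)] permutes_inj_on[OF \<sigma>])
    ultimately have "\<sigma> ` T = {\<sigma> c..<\<nu> c}"
      by (intro card_subset_eq) (simp_all add: img)
    then have "\<sigma> c \<in> \<sigma> ` T" using less by simp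
    then have "c \<in> T" using permutes_eq_iff[OF \<sigma>] by auto
    then show False by (simp add: T_def)
  qed
  then obtain e where e: "c < e" "e \<le> n" "\<sigma> c \<le> \<nu> e" "\<nu> e < \<nu> c" "e \<le> k \<or> \<nu> c \<le> \<sigma> e" by blast
  have "allowed k 1 n \<sigma> c (\<nu> e)"
    using e c D(3)[of c] by (auto simp: allowed_le dest: less_trans)
  moreover have "allowed k 1 n \<sigma> e (\<nu> c)"
  proof (cases "e \<le> k")
    case True
    have "\<nu> c < \<sigma> j" if "e < j" "j \<le> k" "\<sigma> e < \<sigma> j" for j
      using D(3)[of e j] D(3)[of c j] that e c by simp
    moreover have "\<sigma> e \<le> \<nu> c" using D(2)[of e] True e c by simp
    ultimately show ?thesis using True c e by (simp add: allowed_le)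
  next
    case False
    have "\<sigma> j < \<nu> c" if "k < j" "j < e" "\<sigma> j < \<sigma> e" for j
      using D(5)[of j e] that e by simp
    then show ?thesis using False e by (simp add: allowed_gt)
  qed
  ultimately have "\<nu> \<circ> transpose c e \<in> pieri_set n k \<sigma>"
    using c e kn by (intro pieri_part_swap[OF \<nu>]) auto
  with that c e show thesis by blast
qed

section \<open>Minimum, convexity and identification with the interval\<close>

lemma pieri_set_ge:
  assumes "\<sigma> permutes {1..n}" "k \<le> n" "\<nu> \<in> pieri_set n k \<sigma>"
  shows "bruhat_le n \<sigma> \<nu>"
  using assms(3)
proof (induction "perm_length n \<nu>" arbitrary: \<nu> rule: less_induct)
  case less
  show ?case
  proof (cases "\<nu> = \<sigma>")
    case False
    obtain c e where ce: "1 \<le> c" "c < e" "e \<le> n" "\<nu> e < \<nu> c" "\<nu> \<circ> transpose c e \<in> pieri_set n k \<sigma>"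
      using pieri_set_descend[OF assms(1,2) less.prems False] by blast
    let ?\<nu> = "\<nu> \<circ> transpose c e"
    have "?\<nu> permutes {1..n}" using ce(5) by (simp add: pieri_part_def)
    moreover have "?\<nu> c < ?\<nu> e" using ce by simp
    ultimately have "perm_length n ?\<nu> < perm_length n \<nu>" "bruhat_le n ?\<nu> \<nu>"
      using perm_length_less_transpose[of ?\<nu> n c e] bruhat_le_transpose[of ?\<nu> n c e] ce by auto
    then show ?thesis using less.hyps ce(5) bruhat_le_trans by blast
  qed simp
qed

text \<open>The rank function of the usual criterion for the Bruhat order. It is written as a sum of
  indicators so that termwise comparison, and the case of equality in it, are available.\<close>

definition rank_count :: "(nat \<Rightarrow> nat) \<Rightarrow> nat set \<Rightarrow> nat \<Rightarrow> nat" where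
  "rank_count \<sigma> A q = (\<Sum>i\<in>A. if q \<le> \<sigma> i then 1 else 0)"

lemma rank_count_step:
  assumes "\<sigma> permutes {1..n}" "1 \<le> a" "a < b" "b \<le> n" "\<sigma> a < \<sigma> b"
  shows "rank_count \<sigma> {1..p} q \<le> rank_count (\<sigma> \<circ> transpose a b) {1..p} q"
proof (cases "b \<le> p")
  case True
  have "rank_count (\<sigma> \<circ> transpose a b) {1..p} q = rank_count \<sigma> {1..p} q"
    unfolding rank_count_def
    by (rule sum.reindex_bij_witness[where i = "transpose a b" and j = "transpose a b"])
       (use assms True in \<open>auto simp: transpose_def\<close>)
  then show ?thesis by simp
next
  case False
  then show ?thesis
    unfolding rank_count_def using assms by (intro sum_mono) (auto simp: transpose_def)
qed

text \<open>The total does not depend on \<sigma>, so growth on initial segments means decrease on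
  tails.\<close>

lemma rank_count_total:
  assumes "\<sigma> permutes {1..n}" "p \<le> n"
  shows "rank_count \<sigma> {1..p} q + rank_count \<sigma> {p<..n} q = (\<Sum>v\<in>{1..n}. if q \<le> v then 1 else 0)"
proof -
  have "{1..n} = {1..p} \<union> {p<..n}" using assms(2) by auto
  then have "rank_count \<sigma> {1..p} q + rank_count \<sigma> {p<..n} q = rank_count \<sigma> {1..n} q"
    unfolding rank_count_def by (subst sum.union_disjoint[symmetric]) auto
  also have "\<dots> = (\<Sum>v\<in>{1..n}. if q \<le> v then 1 else 0)"
    unfolding rank_count_def using sum.permute[OF assms(1), of "\<lambda>v. if q \<le> v then 1 else (0::nat)"]
    by (simp add: comp_def)
  finally show ?thesis .
qed

lemma bruhat_le_rank_count:
  assumes "bruhat_le n \<sigma> \<mu>" "\<sigma> permutes {1..n}"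
  shows "\<mu> permutes {1..n} \<and> rank_count \<sigma> {1..p} q \<le> rank_count \<mu> {1..p} q"
  using assms(1) unfolding bruhat_le_def
proof (induction rule: rtranclp_induct)
  case base
  then show ?case using assms(2) by simp
next
  case (step \<mu> \<nu>)
  then have \<mu>: "\<mu> permutes {1..n}" by simp
  obtain a b where ab: "1 \<le> a" "a < b" "b \<le> n" "\<nu> = \<mu> \<circ> transpose a b" "perm_length n \<mu> < perm_length n \<nu>"
    using step(2) by (auto simp: bruhat_step_def)
  then have "\<mu> a < \<mu> b" using perm_length_transpose_less_iff[OF \<mu>] by simp
  then show ?case
    using rank_count_step[OF \<mu> ab(1-3), of p q] permutes_comp_transpose[OF \<mu>, of a b] ab step.IH by (auto simp del: comp_apply)
qed

lemma rank_count_tail_mono: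
  assumes "bruhat_le n \<sigma> \<mu>" "\<sigma> permutes {1..n}" "p \<le> n"
  shows "rank_count \<mu> {p<..n} q \<le> rank_count \<sigma> {p<..n} q"
  using bruhat_le_rank_count[OF assms(1,2), of p q] rank_count_total[OF assms(2,3), of q]
    rank_count_total[of \<mu> n p q] assms(3) by simp

lemma rank_count_eq_pointwise:
  assumes "rank_count \<sigma> A q = rank_count \<nu> A q" "finite A" "\<And>i. i \<in> A \<Longrightarrow> \<sigma> i \<le> \<nu> i" "i \<in> A"
  shows "q \<le> \<sigma> i \<longleftrightarrow> q \<le> \<nu> i"
proof -
  have "(if q \<le> \<sigma> i then 1 else (0::nat)) = (if q \<le> \<nu> i then 1 else 0)"
    by (rule sum_mono_inv[OF assms(1)[unfolded rank_count_def] _ assms(4,2)])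
       (use assms(3) in \<open>auto intro: order_trans\<close>)
  then show ?thesis by (auto split: if_splits)
qed

text \<open>For b \<le> k the bounds on w say that w and \<sigma> have equally many values \<ge>
  \<sigma> b in positions before b, and \<nu> is squeezed between them. Comparing counts up to b
  itself gives \<sigma> b \<le> \<nu> b; equality of the counts before b then holds termwise and
  gives the upper bounds. Beyond k the same works with tails and values > \<sigma> d.\<close>

lemma pieri_set_convex:
  assumes \<sigma>: "\<sigma> permutes {1..n}" and kn: "k \<le> n" and w: "w \<in> pieri_set n k \<sigma>"
    and le: "bruhat_le n \<sigma> \<nu>" "bruhat_le n \<nu> w"
  shows "\<nu> \<in> pieri_set n k \<sigma>"
proof -
  have \<nu>: "\<nu> permutes {1..n}" using bruhat_le_rank_count[OF le(1) \<sigma>] by blast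
  note W = pieri_setD[OF w kn]
  have head: "rank_count \<nu> {1..b - 1} (\<sigma> b) = rank_count \<sigma> {1..b - 1} (\<sigma> b)" if "1 \<le> b" "b \<le> k" for b
  proof -
    have "\<sigma> b \<le> w i \<longleftrightarrow> \<sigma> b \<le> \<sigma> i" if "1 \<le> i" "i < b" for i
      using W(2)[of i] W(3)[of i b] that \<open>b \<le> k\<close> by fastforce
    then have "rank_count w {1..b - 1} (\<sigma> b) = rank_count \<sigma> {1..b - 1} (\<sigma> b)"
      unfolding rank_count_def using that by (intro sum.cong) auto
    then show ?thesis
      using bruhat_le_rank_count[OF le(1) \<sigma>] bruhat_le_rank_count[OF le(2) \<nu>] by (metis le_antisym)
  qed
  have tail: "rank_count \<nu> {d<..n} (Suc (\<sigma> d)) = rank_count \<sigma> {d<..n} (Suc (\<sigma> d))" if "k < d" "d \<le> n" for d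
  proof -
    have "Suc (\<sigma> d) \<le> w i \<longleftrightarrow> Suc (\<sigma> d) \<le> \<sigma> i" if "d < i" "i \<le> n" for i
      using W(4)[of i] W(5)[of d i] that \<open>k < d\<close> by fastforce
    then have "rank_count w {d<..n} (Suc (\<sigma> d)) = rank_count \<sigma> {d<..n} (Suc (\<sigma> d))"
      unfolding rank_count_def by (intro sum.cong) auto
    then show ?thesis
      using rank_count_tail_mono[OF le(1) \<sigma> that(2)] rank_count_tail_mono[OF le(2) \<nu> that(2)] by (metis le_antisym)
  qed
  have lower: "\<sigma> b \<le> \<nu> b" if b: "1 \<le> b" "b \<le> k" for b
  proof -
    have "{1..b} = insert b {1..b - 1}" "b \<notin> {1..b - 1}" using b by auto
    then have "rank_count \<rho> {1..b} (\<sigma> b) = (if \<sigma> b \<le> \<rho> b then 1 else 0) + rank_count \<rho> {1..b - 1} (\<sigma> b)" for \<rho>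
      by (simp add: rank_count_def)
    then show ?thesis
      using bruhat_le_rank_count[OF le(1) \<sigma>, of b "\<sigma> b"] head[OF b] by (auto split: if_splits)
  qed
  have upper: "\<nu> d \<le> \<sigma> d" if d: "k < d" "d \<le> n" for d
  proof -
    have "{d - 1<..n} = insert d {d<..n}" "d \<notin> {d<..n}" using d by auto
    then have "rank_count \<rho> {d - 1<..n} (Suc (\<sigma> d)) =
        (if Suc (\<sigma> d) \<le> \<rho> d then 1 else 0) + rank_count \<rho> {d<..n} (Suc (\<sigma> d))" for \<rho>
      by (simp add: rank_count_def)
    moreover have "d - 1 \<le> n" using d by simp
    ultimately show ?thesis
      using rank_count_tail_mono[OF le(1) \<sigma>, of "d - 1" "Suc (\<sigma> d)"] tail[OF d] by (auto split: if_splits)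
  qed
  show ?thesis
  proof (rule pieri_setI[OF \<nu> \<sigma> lower _ upper])
    show "\<nu> c < \<sigma> j" if "1 \<le> c" "c < j" "j \<le> k" "\<sigma> c < \<sigma> j" for c j
      using rank_count_eq_pointwise[OF head[of j, symmetric], of c] lower that by fastforce
    show "\<sigma> j < \<nu> d" if "k < j" "j < d" "d \<le> n" "\<sigma> j < \<sigma> d" for j d
      using rank_count_eq_pointwise[OF tail[of j], of d] upper that by fastforce
  qed
qed

lemma bruhat_interval_eta:
  assumes "\<sigma> permutes {1..n}" "k \<le> n"
  shows "bruhat_interval n \<sigma> (eta n k \<sigma>) = pieri_set n k \<sigma>"
proof
  show "bruhat_interval n \<sigma> (eta n k \<sigma>) \<subseteq> pieri_set n k \<sigma>"
    using pieri_set_convex[OF assms eta_greedy(2)[OF assms]] by (auto simp: bruhat_interval_def)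
  show "pieri_set n k \<sigma> \<subseteq> bruhat_interval n \<sigma> (eta n k \<sigma>)"
    using pieri_set_ge[OF assms] pieri_set_le_greedy[OF assms(1,2) order_refl]
    by (auto simp: bruhat_interval_def eta_greedy(1)[OF assms] pieri_part_def)
qed

section \<open>Recursion for the intervals\<close>

text \<open>Here p, q are the positions of i, i+1 in \<tau>, and P, Q those in \<nu>, with i to the
  left in both. The hypotheses characterise these positions by equivalences, which makes the results
  applicable to the dual permutations as well.\<close>

context
  fixes n k i p q P Q :: nat and \<tau> \<sigma> \<nu> \<nu>' :: "nat \<Rightarrow> nat"
  assumes \<tau>: "\<tau> permutes {1..n}" and \<sigma>: "\<sigma> permutes {1..n}"
    and \<nu>: "\<nu> permutes {1..n}" and \<nu>': "\<nu>' permutes {1..n}"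
    and kn: "k \<le> n" and pq: "1 \<le> p" "p < q" "q \<le> n" and PQ: "1 \<le> P" "P < Q" "Q \<le> n"
    and \<tau>i: "\<And>c. \<tau> c = i \<longleftrightarrow> c = p" and \<tau>Suc: "\<And>c. \<tau> c = Suc i \<longleftrightarrow> c = q"
    and \<nu>i: "\<And>c. \<nu> c = i \<longleftrightarrow> c = P" and \<nu>Suc: "\<And>c. \<nu> c = Suc i \<longleftrightarrow> c = Q"
    and \<sigma>_eq: "\<sigma> = transpose i (Suc i) \<circ> \<tau>" and \<nu>'_eq: "\<nu>' = transpose i (Suc i) \<circ> \<nu>"
begin

lemma swapped_values:
  "\<sigma> p = Suc i" "\<sigma> q = i" "\<And>c. c \<noteq> p \<Longrightarrow> c \<noteq> q \<Longrightarrow> \<sigma> c = \<tau> c"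
  "\<And>c. \<sigma> c = Suc i \<longleftrightarrow> c = p" "\<And>c. \<sigma> c = i \<longleftrightarrow> c = q"
  "\<nu>' P = Suc i" "\<nu>' Q = i" "\<And>c. c \<noteq> P \<Longrightarrow> c \<noteq> Q \<Longrightarrow> \<nu>' c = \<nu> c"
  "\<And>c. \<nu>' c = Suc i \<longleftrightarrow> c = P" "\<And>c. \<nu>' c = i \<longleftrightarrow> c = Q"
  "\<tau> p = i" "\<tau> q = Suc i" "\<nu> P = i" "\<nu> Q = Suc i"
  using \<tau>i \<tau>Suc \<nu>i \<nu>Suc pq(2) PQ(2) by (auto simp: \<sigma>_eq \<nu>'_eq transpose_def)

text \<open>Comparisons at positions \<le> k tell i from i+1 only through a bound equal to i+1, and
  those beyond k only through a bound equal to i. In the crossed case \<tau> has neither value on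
  the side in question.\<close>

lemma pieri_set_cross_invariant:
  assumes "p \<le> k" "k < q"
  shows "\<nu> \<in> pieri_set n k \<tau> \<longleftrightarrow> \<nu>' \<in> pieri_set n k \<tau>"
proof -
  have le: "\<tau> c \<le> \<nu> c \<longleftrightarrow> \<tau> c \<le> \<nu>' c" "\<nu> c < \<tau> j \<longleftrightarrow> \<nu>' c < \<tau> j" if "c \<le> k" "j \<le> k" for c j
    using swapped_values(6,7) swapped_values(8)[of c] \<nu>i[of c] \<nu>Suc[of c] \<tau>Suc[of c] \<tau>Suc[of j] that assms
    by (cases "c = P"; cases "c = Q"; auto)+
  have gt: "\<nu> d \<le> \<tau> d \<longleftrightarrow> \<nu>' d \<le> \<tau> d" "\<tau> j < \<nu> d \<longleftrightarrow> \<tau> j < \<nu>' d" if "k < d" "k < j" for d j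
    using swapped_values(6,7) swapped_values(8)[of d] \<nu>i[of d] \<nu>Suc[of d] \<tau>i[of d] \<tau>i[of j] that assms
    by (cases "d = P"; cases "d = Q"; auto)+
  show ?thesis
  proof
    assume "\<nu> \<in> pieri_set n k \<tau>"
    note D = pieri_setD[OF this kn]
    show "\<nu>' \<in> pieri_set n k \<tau>"
      by (rule pieri_setI[OF \<nu>' \<tau>]) (use D le gt in auto)
  next
    assume "\<nu>' \<in> pieri_set n k \<tau>"
    note D = pieri_setD[OF this kn]
    show "\<nu> \<in> pieri_set n k \<tau>"
      by (rule pieri_setI[OF \<nu> \<tau>]) (use D le gt in auto)
  qed
qed

text \<open>The bounds of \<tau> and \<sigma> differ by one, at p and at q. In the borderline cases
  \<nu>' has i at or left of p, or i+1 at or right of q; as i+1 stands left of i in \<nu>', some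
  other bound is then violated.\<close>

lemma pieri_set_cross:
  assumes "p \<le> k" "k < q"
  shows "\<nu>' \<in> pieri_set n k \<tau> \<longleftrightarrow> \<nu>' \<in> pieri_set n k \<sigma>"
proof
  note v = swapped_values
  assume "\<nu>' \<in> pieri_set n k \<tau>"
  note D = pieri_setD[OF this kn]
  have "p \<noteq> Q"
  proof
    assume "p = Q"
    then have "\<tau> P < i" using D(2)[of P] PQ assms \<tau>i[of P] \<tau>Suc[of P] v(6) by auto
    then show False using D(3)[of P p] PQ \<open>p = Q\<close> assms v by auto
  qed
  then have p: "Suc i \<le> \<nu>' p" using D(2)[of p] pq assms v(10)[of p] v(11) by simp
  have "q \<noteq> P"
  proof
    assume "q = P"
    then have "Suc i < \<tau> Q" using D(4)[of Q] PQ assms \<tau>i[of Q] \<tau>Suc[of Q] v(7) by auto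
    then show False using D(5)[of q Q] PQ \<open>q = P\<close> assms v by auto
  qed
  then have q: "\<nu>' q \<le> i" using D(4)[of q] pq assms v(9)[of q] v(12) by simp
  show "\<nu>' \<in> pieri_set n k \<sigma>"
  proof (rule pieri_setI[OF \<nu>' \<sigma>])
    show "\<sigma> c \<le> \<nu>' c" if "1 \<le> c" "c \<le> k" for c
      using D(2)[OF that] p v(1) v(3)[of c] that assms by (cases "c = p") auto
    show "\<nu>' d \<le> \<sigma> d" if "k < d" "d \<le> n" for d
      using D(4)[OF that] q v(2) v(3)[of d] that assms by (cases "d = q") auto
    show "\<nu>' c < \<sigma> j" if "1 \<le> c" "c < j" "j \<le> k" "\<sigma> c < \<sigma> j" for c j
      using D(3)[of c j] that v(1,11) v(3)[of c] v(3)[of j] \<tau>i[of c] assms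
      by (cases "c = p"; cases "j = p"; auto)
    show "\<sigma> j < \<nu>' d" if "k < j" "j < d" "d \<le> n" "\<sigma> j < \<sigma> d" for j d
      using D(5)[of j d] that v(2,12) v(3)[of j] v(3)[of d] \<tau>Suc[of d] assms
      by (cases "j = q"; cases "d = q"; auto)
  qed
next
  note v = swapped_values
  assume "\<nu>' \<in> pieri_set n k \<sigma>"
  note D = pieri_setD[OF this kn]
  have Q: "\<not> Q < p"
  proof
    assume "Q < p"
    then have "\<sigma> P < i" using D(2)[of P] PQ assms v(4)[of P] v(5)[of P] v(6) by auto
    then show False using D(3)[of P p] PQ \<open>Q < p\<close> assms v by auto
  qed
  have P: "\<not> q < P"
  proof
    assume "q < P"
    then have "Suc i < \<sigma> Q" using D(4)[of Q] PQ assms v(4)[of Q] v(5)[of Q] v(7) by auto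
    then show False using D(5)[of q Q] PQ \<open>q < P\<close> assms v by auto
  qed
  show "\<nu>' \<in> pieri_set n k \<tau>"
  proof (rule pieri_setI[OF \<nu>' \<tau>])
    show "\<tau> c \<le> \<nu>' c" if "1 \<le> c" "c \<le> k" for c
      using D(2)[OF that] v(1,11) v(3)[of c] that assms by (cases "c = p") auto
    show "\<nu>' d \<le> \<tau> d" if "k < d" "d \<le> n" for d
      using D(4)[OF that] v(2,12) v(3)[of d] that assms by (cases "d = q") auto
    show "\<nu>' c < \<tau> j" if c: "1 \<le> c" "c < j" "j \<le> k" "\<tau> c < \<tau> j" for c j
    proof (cases "j = p")
      case True
      then have "\<nu>' c < Suc i" using D(3)[of c j] c v(1,11) v(3)[of c] assms by auto
      moreover have "\<nu>' c \<noteq> i" using v(10)[of c] Q True c by auto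
      ultimately show ?thesis using True v(11) by simp
    next
      case False
      then show ?thesis
        using D(3)[of c j] c v(1,11) v(3)[of c] v(3)[of j] \<tau>Suc[of j] assms by (cases "c = p") auto
    qed
    show "\<tau> j < \<nu>' d" if d: "k < j" "j < d" "d \<le> n" "\<tau> j < \<tau> d" for j d
    proof (cases "j = q")
      case True
      then have "i < \<nu>' d" using D(5)[of j d] d v(2,12) v(3)[of d] assms by auto
      moreover have "\<nu>' d \<noteq> Suc i" using v(9)[of d] P True d by auto
      ultimately show ?thesis using True v(12) by simp
    next
      case False
      then show ?thesis
        using D(5)[of j d] d v(2,12) v(3)[of j] v(3)[of d] \<tau>i[of j] assms by (cases "d = q") auto
    qed
  qed
qed

text \<open>The bounds at p and q leave only the value i for position p. Then i+1 stands further
  left in \<nu>', where the bound from p forbids it.\<close>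

lemma pieri_set_same_descent:
  assumes "q \<le> k"
  shows "\<nu>' \<notin> pieri_set n k \<tau>"
proof
  note v = swapped_values
  assume "\<nu>' \<in> pieri_set n k \<tau>"
  note D = pieri_setD[OF this kn]
  have "\<nu>' p = i" using D(2)[of p] D(3)[of p q] pq assms v(11,12) by auto
  then have "p = Q" using v(10) by simp
  then have "\<tau> P < i" using D(2)[of P] PQ pq assms \<tau>i[of P] \<tau>Suc[of P] v(6) by auto
  then show False using D(3)[of P p] PQ pq \<open>p = Q\<close> assms v(6,11) by auto
qed

text \<open>Passing from \<nu> to \<nu>' can only violate a bound equal to i+1 at positions \<le> k,
  which \<sigma> has at p alone, and this requires P < p. Beyond k a violation requires the bound i,
  which \<sigma> has at q \<le> k.\<close>

lemma pieri_set_same_up: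
  assumes "q \<le> k" "\<nu> \<in> pieri_set n k \<sigma>"
  shows "\<nu>' \<in> pieri_set n k \<sigma>"
proof -
  note v = swapped_values
  note D = pieri_setD[OF assms(2) kn]
  have P: "\<not> P < p"
  proof
    assume "P < p"
    then have "\<sigma> P < i" using D(2)[of P] PQ pq assms(1) v(5)[of P] v(13) by auto
    then show False using D(3)[of P q] PQ pq \<open>P < p\<close> assms(1) v(2,13) by auto
  qed
  then have "p \<noteq> Q" using PQ by simp
  show ?thesis
  proof (rule pieri_setI[OF \<nu>' \<sigma>])
    show "\<sigma> c \<le> \<nu>' c" if "1 \<le> c" "c \<le> k" for c
      using D(2)[OF that] v(4)[of c] v(6,7) v(8)[of c] v(13,14) \<open>p \<noteq> Q\<close> by (cases "c = P"; cases "c = Q"; auto)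
    show "\<nu>' d \<le> \<sigma> d" if "k < d" "d \<le> n" for d
      using D(4)[OF that] v(5)[of d] v(6,7) v(8)[of d] v(13,14) that assms(1) by (cases "d = P"; cases "d = Q"; auto)
    show "\<nu>' c < \<sigma> j" if "1 \<le> c" "c < j" "j \<le> k" "\<sigma> c < \<sigma> j" for c j
      using D(3)[OF that] v(4)[of j] v(6,7) v(8)[of c] v(13,14) P that by (cases "c = P"; cases "c = Q"; auto)
    show "\<sigma> j < \<nu>' d" if "k < j" "j < d" "d \<le> n" "\<sigma> j < \<sigma> d" for j d
      using D(5)[OF that] v(5)[of j] v(6,7) v(8)[of d] v(13,14) that assms(1) by (cases "d = P"; cases "d = Q"; auto)
  qed
qed

text \<open>Membership for \<tau> forces \<nu> p = i. The lower bound i+1 that \<sigma> has at p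
  therefore excludes \<nu> and admits \<nu>'.\<close>

lemma pieri_set_same_ascent_imp:
  assumes "q \<le> k" "\<nu> \<in> pieri_set n k \<tau>"
  shows "\<nu>' \<in> pieri_set n k \<sigma> \<and> \<nu> \<notin> pieri_set n k \<sigma>"
proof
  note v = swapped_values
  note D = pieri_setD[OF assms(2) kn]
  have "\<nu> p = i" using D(2)[of p] D(3)[of p q] pq assms(1) v(11,12) by auto
  then have P: "P = p" using \<nu>i by simp
  show "\<nu> \<notin> pieri_set n k \<sigma>"
    using pieri_setD(2)[OF _ kn, of \<nu> \<sigma> p] \<open>\<nu> p = i\<close> v(1) pq assms(1) by auto
  show "\<nu>' \<in> pieri_set n k \<sigma>"
  proof (rule pieri_setI[OF \<nu>' \<sigma>])
    show "\<sigma> c \<le> \<nu>' c" if "1 \<le> c" "c \<le> k" for c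
    proof -
      consider "c = p" | "c = q" | "c \<noteq> p" "c \<noteq> q" by blast
      then show ?thesis
      proof cases
        case 1
        then show ?thesis using v(1,6) P by simp
      next
        case 2
        then show ?thesis using D(2)[OF that] v(2,7,12) v(8)[of q] P pq by (cases "q = Q") auto
      next
        case 3
        then show ?thesis
          using D(2)[OF that] v(3)[of c] v(7,14) v(8)[of c] \<tau>Suc[of c] P by (cases "c = Q") auto
      qed
    qed
    show "\<nu>' d \<le> \<sigma> d" if "k < d" "d \<le> n" for d
      using D(4)[OF that] v(3)[of d] v(6,7) v(8)[of d] v(13,14) P that pq assms(1) by (cases "d = Q") auto
    show "\<sigma> j < \<nu>' d" if "k < j" "j < d" "d \<le> n" "\<sigma> j < \<sigma> d" for j d
      using D(5)[of j d] v(3)[of j] v(3)[of d] v(5)[of j] v(6,7) v(8)[of d] v(13,14) P that pq assms(1) by (cases "d = Q") auto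
    show "\<nu>' c < \<sigma> j" if c: "1 \<le> c" "c < j" "j \<le> k" "\<sigma> c < \<sigma> j" for c j
    proof -
      consider "c = p" | "c = q" | "c \<noteq> p" "c \<noteq> q" "j = p" | "c \<noteq> p" "c \<noteq> q" "j = q" | "c \<noteq> p" "c \<noteq> q" "j \<noteq> p" "j \<noteq> q" by blast
      then show ?thesis
      proof cases
        case 1
        then show ?thesis using c v(1,6) P by simp
      next
        case 2
        then have "Suc i < \<sigma> j" using c v(2) v(4)[of j] pq by auto
        then show ?thesis using D(3)[of c j] 2 c v(3)[of j] v(7,12) v(8)[of q] P pq by (cases "q = Q") auto
      next
        case 3
        then show ?thesis using D(3)[of c p] c v(1,11) v(3)[of c] \<tau>i[of c] v(6,7) v(8)[of c] P PQ by (cases "c = Q") auto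
      next
        case 4
        then have "\<nu> c < Suc i" using D(3)[of c q] c v(2,12) v(3)[of c] by auto
        then show ?thesis using 4 v(2) v(8)[of c] v(14) \<nu>i[of c] P by (cases "c = Q") auto
      next
        case 5
        then show ?thesis using D(3)[of c j] c v(3)[of c] v(3)[of j] v(6,7) v(8)[of c] v(13,14) P by (cases "c = Q") auto
      qed
    qed
  qed
qed

text \<open>Only a lower bound i+1 at P can separate \<nu> from \<nu>' in the set of \<sigma>, so P
  = p; the other bounds of \<tau> then follow from those of \<sigma>.\<close>

lemma pieri_set_same_ascent_if:
  assumes "q \<le> k" "\<nu>' \<in> pieri_set n k \<sigma>" "\<nu> \<notin> pieri_set n k \<sigma>"
  shows "\<nu> \<in> pieri_set n k \<tau>"
proof -
  note v = swapped_values
  note D = pieri_setD[OF assms(2) kn]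
  have P: "P = p"
  proof (rule ccontr)
    assume "P \<noteq> p"
    have Q: "\<not> Q < p"
    proof
      assume "Q < p"
      then have "\<sigma> Q < i" using D(2)[of Q] PQ pq assms(1) v(5)[of Q] v(7) by auto
      then show False using D(3)[of Q q] PQ pq \<open>Q < p\<close> assms(1) v(2,7) by auto
    qed
    have "\<nu> \<in> pieri_set n k \<sigma>"
    proof (rule pieri_setI[OF \<nu> \<sigma>])
      show "\<sigma> c \<le> \<nu> c" if "1 \<le> c" "c \<le> k" for c
        using D(2)[OF that] v(4)[of c] v(6,7) v(8)[of c] v(13,14) \<open>P \<noteq> p\<close> by (cases "c = P"; cases "c = Q"; auto)
      show "\<nu> d \<le> \<sigma> d" if "k < d" "d \<le> n" for d
        using D(4)[OF that] v(5)[of d] v(6,7) v(8)[of d] v(13,14) that assms(1) by (cases "d = P"; cases "d = Q"; auto)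
      show "\<nu> c < \<sigma> j" if "1 \<le> c" "c < j" "j \<le> k" "\<sigma> c < \<sigma> j" for c j
        using D(3)[OF that] v(4)[of j] v(6,7) v(8)[of c] v(13,14) Q that by (cases "c = P"; cases "c = Q"; auto)
      show "\<sigma> j < \<nu> d" if "k < j" "j < d" "d \<le> n" "\<sigma> j < \<sigma> d" for j d
        using D(5)[OF that] v(5)[of j] v(6,7) v(8)[of d] v(13,14) that assms(1) by (cases "d = P"; cases "d = Q"; auto)
    qed
    with assms(3) show False ..
  qed
  show ?thesis
  proof (rule pieri_setI[OF \<nu> \<tau>])
    show "\<tau> c \<le> \<nu> c" if "1 \<le> c" "c \<le> k" for c
    proof -
      consider "c = p" | "c = q" | "c \<noteq> p" "c \<noteq> q" by blast
      then show ?thesis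
      proof cases
        case 1
        then show ?thesis using v(11,13) P by simp
      next
        case 2
        then show ?thesis
          using D(2)[OF that] v(2,12,14) v(8)[of q] \<nu>i[of q] P pq by (cases "q = Q") auto
      next
        case 3
        then show ?thesis
          using D(2)[OF that] v(3)[of c] v(7,14) v(8)[of c] P by (cases "c = Q") auto
      qed
    qed
    show "\<nu> d \<le> \<tau> d" if "k < d" "d \<le> n" for d
      using D(4)[OF that] v(3)[of d] v(5)[of d] v(6,7) v(8)[of d] v(13,14) P that pq assms(1) by (cases "d = Q") auto
    show "\<tau> j < \<nu> d" if "k < j" "j < d" "d \<le> n" "\<tau> j < \<tau> d" for j d
      using D(5)[of j d] v(3)[of j] v(3)[of d] v(6,7) v(8)[of d] v(13,14) P that pq assms(1) by (cases "d = Q") auto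
    show "\<nu> c < \<tau> j" if c: "1 \<le> c" "c < j" "j \<le> k" "\<tau> c < \<tau> j" for c j
    proof -
      consider "c = p" | "c = q" | "c \<noteq> p" "c \<noteq> q" "j = p" | "c \<noteq> p" "c \<noteq> q" "j = q" | "c \<noteq> p" "c \<noteq> q" "j \<noteq> p" "j \<noteq> q" by blast
      then show ?thesis
      proof cases
        case 1
        then show ?thesis using c v(11,13) P by simp
      next
        case 2
        then have "Suc i < \<tau> j" using c v(12) by simp
        then show ?thesis using D(3)[of c j] 2 c v(2,14) v(3)[of j] v(8)[of q] P pq by (cases "q = Q") auto
      next
        case 3
        then have "\<nu>' c < Suc i" using D(3)[of c p] c v(1,11) v(3)[of c] by auto
        then show ?thesis using 3 v(11) v(8)[of c] \<nu>i[of c] P PQ c by (cases "c = Q") auto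
      next
        case 4
        then have "\<nu>' c < i" using D(3)[of c q] c v(2,12) v(3)[of c] \<tau>i[of c] by auto
        then show ?thesis using 4 v(7,12) v(8)[of c] P by (cases "c = Q") auto
      next
        case 5
        then show ?thesis using D(3)[of c j] c v(3)[of c] v(3)[of j] v(6,7) v(8)[of c] v(13,14) P \<tau>Suc[of j] by (cases "c = Q") auto
      qed
    qed
  qed
qed

end

text \<open>
  Conjugation by the longest permutation reverses positions and values and exchanges \<open>k\<close> with
  \<open>n - k\<close>; it reduces the case of two positions beyond \<open>k\<close> to that of two positions up to \<open>k\<close>.
\<close>

definition dual_perm :: "nat \<Rightarrow> (nat \<Rightarrow> nat) \<Rightarrow> nat \<Rightarrow> nat" where
  "dual_perm n \<sigma> = longest_perm n \<circ> \<sigma> \<circ> longest_perm n"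

lemma longest_perm_invol [simp]: "longest_perm n (longest_perm n v) = v"
  by (auto simp: longest_perm_def)

lemma longest_perm_in: "v \<in> {1..n} \<Longrightarrow> longest_perm n v = n + 1 - v"
  by (simp add: longest_perm_def)

lemma dual_perm_permutes: "\<sigma> permutes {1..n} \<Longrightarrow> dual_perm n \<sigma> permutes {1..n}"
  unfolding dual_perm_def by (intro permutes_compose longest_perm_permutes)

lemma dual_perm_invol [simp]: "dual_perm n (dual_perm n \<sigma>) = \<sigma>"
  by (simp add: dual_perm_def fun_eq_iff)

lemma dual_perm_eq_iff: "dual_perm n \<sigma> c = longest_perm n v \<longleftrightarrow> \<sigma> (longest_perm n c) = v"
  by (metis comp_apply dual_perm_def longest_perm_invol)

lemma dual_perm_in:
  "\<sigma> permutes {1..n} \<Longrightarrow> c \<in> {1..n} \<Longrightarrow> dual_perm n \<sigma> c = n + 1 - \<sigma> (n + 1 - c)"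
proof -
  assume *: "\<sigma> permutes {1..n}" "c \<in> {1..n}"
  then have "n + 1 - c \<in> {1..n}" by auto
  then have "\<sigma> (n + 1 - c) \<in> {1..n}" using permutes_in_image[OF *(1)] by blast
  then show ?thesis using * by (simp add: dual_perm_def longest_perm_in del: atLeastAtMost_iff)
qed

lemma dual_perm_transpose:
  assumes "1 \<le> i" "i < n"
  shows "dual_perm n (transpose i (Suc i) \<circ> \<sigma>) = transpose (n - i) (Suc (n - i)) \<circ> dual_perm n \<sigma>"
proof
  fix c
  have "longest_perm n (transpose i (Suc i) v) = transpose (n - i) (Suc (n - i)) (longest_perm n v)" for v
    using assms by (auto simp: longest_perm_def transpose_def)
  then show "dual_perm n (transpose i (Suc i) \<circ> \<sigma>) c = (transpose (n - i) (Suc (n - i)) \<circ> dual_perm n \<sigma>) c"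
    by (simp add: dual_perm_def)
qed

text \<open>Reversal turns the bounds beyond k into those for the first n - k positions and vice
  versa, so the two halves of the description change places.\<close>

lemma pieri_set_dual_imp:
  assumes \<sigma>: "\<sigma> permutes {1..n}" and kn: "k \<le> n" and \<nu>: "\<nu> \<in> pieri_set n k \<sigma>"
  shows "dual_perm n \<nu> \<in> pieri_set n (n - k) (dual_perm n \<sigma>)"
proof -
  note D = pieri_setD[OF \<nu> kn]
  have range: "1 \<le> \<rho> c" "\<rho> c \<le> n" if "\<rho> permutes {1..n}" "1 \<le> c" "c \<le> n" for \<rho> c
    using permutes_in_image[OF that(1), of c] that by auto
  have dual: "dual_perm n \<rho> c = n + 1 - \<rho> (n + 1 - c)" if "\<rho> permutes {1..n}" "1 \<le> c" "c \<le> n" for \<rho> c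
    using dual_perm_in[OF that(1), of c] that by simp
  note r\<sigma> = range[OF \<sigma>] and r\<nu> = range[OF D(1)] and d\<sigma> = dual[OF \<sigma>] and d\<nu> = dual[OF D(1)]
  show ?thesis
  proof (rule pieri_setI[OF dual_perm_permutes[OF D(1)] dual_perm_permutes[OF \<sigma>]])
    show "dual_perm n \<sigma> c \<le> dual_perm n \<nu> c" if "1 \<le> c" "c \<le> n - k" for c
    proof -
      have "k < n + 1 - c" "n + 1 - c \<le> n" "c \<le> n" using that kn by auto
      then show ?thesis using D(4)[of "n + 1 - c"] d\<sigma>[of c] d\<nu>[of c] that by (simp add: diff_le_mono2)
    qed
    show "dual_perm n \<nu> d \<le> dual_perm n \<sigma> d" if "n - k < d" "d \<le> n" for d
    proof -
      have "1 \<le> n + 1 - d" "n + 1 - d \<le> k" "1 \<le> d" using that kn by auto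
      then show ?thesis using D(2)[of "n + 1 - d"] d\<sigma>[of d] d\<nu>[of d] that by (simp add: diff_le_mono2)
    qed
    show "dual_perm n \<nu> c < dual_perm n \<sigma> j"
      if "1 \<le> c" "c < j" "j \<le> n - k" "dual_perm n \<sigma> c < dual_perm n \<sigma> j" for c j
    proof -
      have "k < n + 1 - j" "n + 1 - j < n + 1 - c" "n + 1 - c \<le> n" "c \<le> n" "j \<le> n" "1 \<le> j"
        "1 \<le> n + 1 - j" "1 \<le> n + 1 - c" "n + 1 - j \<le> n"
        using that kn by auto
      note idx = this
      have e: "dual_perm n \<sigma> c = n + 1 - \<sigma> (n + 1 - c)" "dual_perm n \<sigma> j = n + 1 - \<sigma> (n + 1 - j)"
        "dual_perm n \<nu> c = n + 1 - \<nu> (n + 1 - c)"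
        using d\<sigma> d\<nu> idx that(1) by blast+
      have "\<sigma> (n + 1 - j) < \<sigma> (n + 1 - c)" using that(4) unfolding e by linarith
      then have "\<sigma> (n + 1 - j) < \<nu> (n + 1 - c)" using D(5) idx by blast
      moreover have "\<sigma> (n + 1 - j) \<le> n" using r\<sigma>(2) idx by blast
      ultimately show ?thesis unfolding e by (simp add: diff_less_mono2)
    qed
    show "dual_perm n \<sigma> j < dual_perm n \<nu> d"
      if "n - k < j" "j < d" "d \<le> n" "dual_perm n \<sigma> j < dual_perm n \<sigma> d" for j d
    proof -
      have "1 \<le> n + 1 - d" "n + 1 - d < n + 1 - j" "n + 1 - j \<le> k" "1 \<le> j" "1 \<le> d" "j \<le> n"
        "1 \<le> n + 1 - j" "n + 1 - d \<le> n" "n + 1 - j \<le> n"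
        using that kn by auto
      note idx = this
      have e: "dual_perm n \<sigma> d = n + 1 - \<sigma> (n + 1 - d)" "dual_perm n \<sigma> j = n + 1 - \<sigma> (n + 1 - j)"
        "dual_perm n \<nu> d = n + 1 - \<nu> (n + 1 - d)"
        using d\<sigma> d\<nu> idx that(3) by blast+
      have "\<sigma> (n + 1 - d) < \<sigma> (n + 1 - j)" using that(4) unfolding e by linarith
      then have "\<nu> (n + 1 - d) < \<sigma> (n + 1 - j)" using D(3) idx by blast
      moreover have "\<nu> (n + 1 - d) \<le> n" using r\<nu>(2) idx by blast
      ultimately show ?thesis unfolding e by (simp add: diff_less_mono2)
    qed
  qed
qed

lemma pieri_set_dual:
  assumes "\<sigma> permutes {1..n}" "k \<le> n"
  shows "dual_perm n \<nu> \<in> pieri_set n (n - k) (dual_perm n \<sigma>) \<longleftrightarrow> \<nu> \<in> pieri_set n k \<sigma>"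
  using pieri_set_dual_imp[OF assms] assms
    pieri_set_dual_imp[OF dual_perm_permutes[OF assms(1)], of "n - k" "dual_perm n \<nu>"] by auto

text \<open>Tailored to the sums: s_i \<nu> never contributes for \<tau>, and \<nu> contributes
  exactly when s_i \<nu> is the only member of the pair in the set of \<sigma>. The remaining
  possibilities for \<sigma>, both or none, cancel or are empty.\<close>

lemma pieri_set_same_side:
  fixes \<tau> \<nu> :: "nat \<Rightarrow> nat"
  assumes \<tau>: "\<tau> permutes {1..n}" and \<nu>: "\<nu> permutes {1..n}" and kn: "k \<le> n" and i: "1 \<le> i" "i < n"
    and pos: "pos \<tau> i < pos \<tau> (Suc i)" "pos \<nu> i < pos \<nu> (Suc i)"
    and side: "pos \<tau> (Suc i) \<le> k \<or> k < pos \<tau> i"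
  defines "\<sigma> \<equiv> transpose i (Suc i) \<circ> \<tau>" and "\<nu>' \<equiv> transpose i (Suc i) \<circ> \<nu>"
  shows "\<nu>' \<notin> pieri_set n k \<tau>"
    and "\<nu> \<in> pieri_set n k \<tau> \<longleftrightarrow> \<nu>' \<in> pieri_set n k \<sigma> \<and> \<nu> \<notin> pieri_set n k \<sigma>"
    and "\<nu> \<in> pieri_set n k \<sigma> \<Longrightarrow> \<nu>' \<in> pieri_set n k \<sigma>"
proof -
  have \<sigma>: "\<sigma> permutes {1..n}" and \<nu>': "\<nu>' permutes {1..n}"
    unfolding \<sigma>_def \<nu>'_def using \<tau> \<nu> i by (auto intro!: transpose_comp_permutes simp del: comp_apply)
  have val: "\<rho> c = v \<longleftrightarrow> c = pos \<rho> v" if "\<rho> permutes {1..n}" for \<rho> c v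
    using permutes_inverses[OF that] by auto
  have range: "1 \<le> pos \<rho> i \<and> pos \<rho> (Suc i) \<le> n \<and> 1 \<le> pos \<rho> (Suc i) \<and> pos \<rho> i \<le> n" if "\<rho> permutes {1..n}" for \<rho>
    using pos_in[OF that, of i] pos_in[OF that, of "Suc i"] i by auto
  have "\<nu>' \<notin> pieri_set n k \<tau> \<and> (\<nu> \<in> pieri_set n k \<tau> \<longleftrightarrow> \<nu>' \<in> pieri_set n k \<sigma> \<and> \<nu> \<notin> pieri_set n k \<sigma>)
      \<and> (\<nu> \<in> pieri_set n k \<sigma> \<longrightarrow> \<nu>' \<in> pieri_set n k \<sigma>)"
  proof (cases "pos \<tau> (Suc i) \<le> k")
    case True
    have prems: "1 \<le> pos \<tau> i" "pos \<tau> i < pos \<tau> (Suc i)" "pos \<tau> (Suc i) \<le> n"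
      "1 \<le> pos \<nu> i" "pos \<nu> i < pos \<nu> (Suc i)" "pos \<nu> (Suc i) \<le> n"
      using pos range[OF \<tau>] range[OF \<nu>] by auto
    note * = \<tau> \<sigma> \<nu> \<nu>' kn prems val[OF \<tau>] val[OF \<tau>] val[OF \<nu>] val[OF \<nu>] \<sigma>_def[THEN meta_eq_to_obj_eq] \<nu>'_def[THEN meta_eq_to_obj_eq]
    show ?thesis
      using pieri_set_same_descent[OF * True] pieri_set_same_up[OF * True]
        pieri_set_same_ascent_imp[OF * True] pieri_set_same_ascent_if[OF * True] by blast
  next
    case False
    then have side: "k < pos \<tau> i" using side by simp
    let ?d = "dual_perm n" and ?w = "longest_perm n"
    \<comment> \<open>Reversal sends i+1 to n - i and i to n - i + 1, and it also reverses
      positions, so the smaller of the two values still stands first.\<close>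
    have w: "?w (Suc i) = n - i" "?w i = Suc (n - i)" using i by (auto simp: longest_perm_def)
    have val': "?d \<rho> c = n - i \<longleftrightarrow> c = ?w (pos \<rho> (Suc i))" "?d \<rho> c = Suc (n - i) \<longleftrightarrow> c = ?w (pos \<rho> i)"
      if "\<rho> permutes {1..n}" for \<rho> c
    proof -
      have flip: "?w x = y \<longleftrightarrow> x = ?w y" for x y by (metis longest_perm_invol)
      show "?d \<rho> c = n - i \<longleftrightarrow> c = ?w (pos \<rho> (Suc i))"
        using dual_perm_eq_iff[of n \<rho> c "Suc i"] by (simp only: w val[OF that] flip)
      show "?d \<rho> c = Suc (n - i) \<longleftrightarrow> c = ?w (pos \<rho> i)"
        using dual_perm_eq_iff[of n \<rho> c i] by (simp only: w val[OF that] flip)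
    qed
    have wpos: "?w (pos \<rho> i) = n + 1 - pos \<rho> i" "?w (pos \<rho> (Suc i)) = n + 1 - pos \<rho> (Suc i)"
      if "\<rho> permutes {1..n}" for \<rho>
      using range[OF that] by (auto simp: longest_perm_in)
    have prems: "1 \<le> ?w (pos \<tau> (Suc i))" "?w (pos \<tau> (Suc i)) < ?w (pos \<tau> i)" "?w (pos \<tau> i) \<le> n"
      "1 \<le> ?w (pos \<nu> (Suc i))" "?w (pos \<nu> (Suc i)) < ?w (pos \<nu> i)" "?w (pos \<nu> i) \<le> n"
      using pos range[OF \<tau>] range[OF \<nu>] unfolding wpos[OF \<tau>] wpos[OF \<nu>] by auto
    have "n - k \<le> n" by simp
    note * = dual_perm_permutes[OF \<tau>] dual_perm_permutes[OF \<sigma>] dual_perm_permutes[OF \<nu>] dual_perm_permutes[OF \<nu>']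
      this prems val'(1)[OF \<tau>] val'(2)[OF \<tau>] val'(1)[OF \<nu>] val'(2)[OF \<nu>]
      dual_perm_transpose[OF i, of \<tau>, folded \<sigma>_def] dual_perm_transpose[OF i, of \<nu>, folded \<nu>'_def]
    have side': "?w (pos \<tau> i) \<le> n - k" using side range[OF \<tau>] unfolding wpos[OF \<tau>] by auto
    show ?thesis
      using pieri_set_same_descent[OF * side'] pieri_set_same_up[OF * side']
        pieri_set_same_ascent_imp[OF * side'] pieri_set_same_ascent_if[OF * side']
      unfolding pieri_set_dual[OF \<tau> kn] pieri_set_dual[OF \<sigma> kn] by blast
  qed
  then show "\<nu>' \<notin> pieri_set n k \<tau>"
    "\<nu> \<in> pieri_set n k \<tau> \<longleftrightarrow> \<nu>' \<in> pieri_set n k \<sigma> \<and> \<nu> \<notin> pieri_set n k \<sigma>"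
    "\<nu> \<in> pieri_set n k \<sigma> \<Longrightarrow> \<nu>' \<in> pieri_set n k \<sigma>" by blast+
qed

lemma pieri_set_cross_side:
  fixes \<tau> \<nu> :: "nat \<Rightarrow> nat"
  assumes \<tau>: "\<tau> permutes {1..n}" and \<nu>: "\<nu> permutes {1..n}" and kn: "k \<le> n" and i: "1 \<le> i" "i < n"
    and pos: "pos \<nu> i < pos \<nu> (Suc i)" and side: "pos \<tau> i \<le> k" "k < pos \<tau> (Suc i)"
  defines "\<sigma> \<equiv> transpose i (Suc i) \<circ> \<tau>" and "\<nu>' \<equiv> transpose i (Suc i) \<circ> \<nu>"
  shows "\<nu> \<in> pieri_set n k \<tau> \<longleftrightarrow> \<nu>' \<in> pieri_set n k \<sigma>"
    and "\<nu>' \<in> pieri_set n k \<tau> \<longleftrightarrow> \<nu>' \<in> pieri_set n k \<sigma>"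
proof -
  have \<sigma>: "\<sigma> permutes {1..n}" and \<nu>': "\<nu>' permutes {1..n}"
    unfolding \<sigma>_def \<nu>'_def using \<tau> \<nu> i by (auto intro!: transpose_comp_permutes simp del: comp_apply)
  have val: "\<rho> c = v \<longleftrightarrow> c = pos \<rho> v" if "\<rho> permutes {1..n}" for \<rho> c v
    using permutes_inverses[OF that] by auto
  have prems: "1 \<le> pos \<tau> i" "pos \<tau> i < pos \<tau> (Suc i)" "pos \<tau> (Suc i) \<le> n"
      "1 \<le> pos \<nu> i" "pos \<nu> i < pos \<nu> (Suc i)" "pos \<nu> (Suc i) \<le> n"
    using pos side pos_in[OF \<tau>, of i] pos_in[OF \<tau>, of "Suc i"] pos_in[OF \<nu>, of i] pos_in[OF \<nu>, of "Suc i"] i by auto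
  note * = \<tau> \<sigma> \<nu> \<nu>' kn prems val[OF \<tau>] val[OF \<tau>] val[OF \<nu>] val[OF \<nu>] \<sigma>_def[THEN meta_eq_to_obj_eq] \<nu>'_def[THEN meta_eq_to_obj_eq]
  show "\<nu> \<in> pieri_set n k \<tau> \<longleftrightarrow> \<nu>' \<in> pieri_set n k \<sigma>" "\<nu>' \<in> pieri_set n k \<tau> \<longleftrightarrow> \<nu>' \<in> pieri_set n k \<sigma>"
    using pieri_set_cross_invariant[OF * side] pieri_set_cross[OF * side] by blast+
qed

text \<open>Only the parity of the exponent matters; a sum of lengths avoids truncated
  subtraction.\<close>

definition pieri_sum :: "nat \<Rightarrow> nat \<Rightarrow> (nat \<Rightarrow> nat) \<Rightarrow> laurent" where
  "pieri_sum n k \<sigma> = (\<Sum>\<nu>\<in>pieri_set n k \<sigma>. (-1) ^ (perm_length n \<nu> + perm_length n \<sigma>) * groth n \<nu>)"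

lemma pos_transpose_comp:
  "\<sigma> permutes {1..n} \<Longrightarrow> pos (transpose i (Suc i) \<circ> \<sigma>) v = pos \<sigma> (transpose i (Suc i) v)"
  by (simp add: o_inv_distrib permutes_bij)

text \<open>Groups permutations into pairs \<nu>, s_i \<nu>, represented by the member with i left
  of i+1, since the operator in y sends both Grothendieck polynomials of a pair to G_\<nu>.\<close>

lemma sum_over_ascents:
  fixes f :: "(nat \<Rightarrow> nat) \<Rightarrow> 'a::comm_monoid_add"
  assumes A: "\<And>\<nu>. \<nu> \<in> A \<Longrightarrow> \<nu> permutes {1..n}" and i: "1 \<le> i" "i < n"
  shows "sum f A = (\<Sum>\<nu> | \<nu> permutes {1..n} \<and> pos \<nu> i < pos \<nu> (Suc i).
    (if \<nu> \<in> A then f \<nu> else 0) + (if transpose i (Suc i) \<circ> \<nu> \<in> A then f (transpose i (Suc i) \<circ> \<nu>) else 0))"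
proof -
  let ?L = "\<lambda>\<nu>. transpose i (Suc i) \<circ> \<nu>"
  let ?P = "{\<nu>. \<nu> permutes {1..n}}" and ?U = "{\<nu>. \<nu> permutes {1..n} \<and> pos \<nu> i < pos \<nu> (Suc i)}"
  have fin: "finite ?P" by (rule finite_permutations) simp
  have LL: "?L (?L \<nu>) = \<nu>" for \<nu> by (simp add: comp_assoc[symmetric])
  have L: "?L \<nu> permutes {1..n}" if "\<nu> permutes {1..n}" for \<nu>
    using that i by (intro transpose_comp_permutes) auto
  have ne: "pos \<nu> i \<noteq> pos \<nu> (Suc i)" if "\<nu> permutes {1..n}" for \<nu>
    by (metis n_not_Suc_n permutes_inverses(1)[OF that])
  let ?g = "\<lambda>\<nu>. if \<nu> \<in> A then f \<nu> else 0"
  have "sum f A = sum f (?P \<inter> A)" using A by (intro sum.cong) auto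
  also have "\<dots> = sum ?g ?P" using fin by (rule sum.inter_restrict)
  also have "\<dots> = sum ?g ?U + sum ?g (?P - ?U)"
    by (rule sum.subset_diff[THEN trans, OF _ fin]) (auto simp: add.commute)
  also have "sum ?g (?P - ?U) = sum (\<lambda>\<nu>. ?g (?L \<nu>)) ?U"
  proof (rule sum.reindex_bij_witness[where i = ?L and j = ?L])
    show "?L \<nu> \<in> ?U" if "\<nu> \<in> ?P - ?U" for \<nu>
      using that ne[of \<nu>] L[of \<nu>] by (auto simp: pos_transpose_comp simp del: comp_apply)
    show "?L \<nu> \<in> ?P - ?U" if "\<nu> \<in> ?U" for \<nu>
      using that L[of \<nu>] by (auto simp: pos_transpose_comp simp del: comp_apply)
  qed (simp_all add: LL del: comp_apply)
  finally show ?thesis by (simp add: sum.distrib)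
qed

lemma swap_var_neg_one_power: "swap_var u v ((-1) ^ m) = (-1) ^ m"
  using swap_var_diff[of u v 0 1] by (simp add: swap_var_power)

text \<open>The members of a pair carry opposite signs and have the same image G_\<nu>. On the same
  side, D thus keeps exactly the pairs with one member present. In the crossed case the terms
  G_\<nu>, being fixed by D, drop out of D - id, and each s_i \<nu> in the set of \<sigma> yields
  the two terms of a full pair in the set of \<tau>.\<close>

lemma demazure_pieri_sum:
  assumes \<tau>: "\<tau> permutes {1..n}" and i: "1 \<le> i" "i < n" and asc: "pos \<tau> i < pos \<tau> (Suc i)" and kn: "k \<le> n"
  defines "\<sigma> \<equiv> transpose i (Suc i) \<circ> \<tau>"
  shows "pos \<tau> (Suc i) \<le> k \<or> k < pos \<tau> i \<Longrightarrow>
      demazure (Y (Suc i)) (Y i) (pieri_sum n k \<sigma>) = pieri_sum n k \<tau>"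
    and "pos \<tau> i \<le> k \<Longrightarrow> k < pos \<tau> (Suc i) \<Longrightarrow>
      demazure (Y (Suc i)) (Y i) (pieri_sum n k \<sigma>) - pieri_sum n k \<sigma> = pieri_sum n k \<tau>"
proof -
  let ?L = "\<lambda>\<nu>. transpose i (Suc i) \<circ> \<nu>" and ?D = "demazure (Y (Suc i)) (Y i)"
  let ?U = "{\<nu>. \<nu> permutes {1..n} \<and> pos \<nu> i < pos \<nu> (Suc i)}"
  \<comment> \<open>The sign of \<nu> relative to \<tau>. Since s_i lengthens both permutations by
    one, it is also the sign of s_i \<nu> relative to \<sigma>.\<close>
  let ?e = "\<lambda>\<nu>. (-1) ^ (perm_length n \<nu> + perm_length n \<tau>) :: laurent"
  have ne: "Y (Suc i) \<noteq> Y i" by simp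
  have L\<sigma>: "perm_length n \<sigma> = Suc (perm_length n \<tau>)"
    unfolding \<sigma>_def by (rule perm_length_left_transpose[OF \<tau> i asc])
  have LL: "?L (?L \<nu>) = \<nu>" for \<nu> by (simp add: comp_assoc[symmetric])
  have len: "perm_length n (?L \<nu>) = Suc (perm_length n \<nu>)"
    and D1: "?D (groth n \<nu>) = groth n \<nu>" and D2: "?D (groth n (?L \<nu>)) = groth n \<nu>" if "\<nu> \<in> ?U" for \<nu>
  proof -
    from that have \<nu>: "\<nu> permutes {1..n}" "pos \<nu> i < pos \<nu> (Suc i)" by auto
    show "perm_length n (?L \<nu>) = Suc (perm_length n \<nu>)" by (rule perm_length_left_transpose[OF \<nu>(1) i \<nu>(2)])
    show "?D (groth n \<nu>) = groth n \<nu>" using demazure_Y_groth[OF \<nu>(1) i] \<nu>(2) by simp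
    have "?L \<nu> permutes {1..n}" using \<nu> i by (intro transpose_comp_permutes) auto
    from demazure_Y_groth[OF this i] show "?D (groth n (?L \<nu>)) = groth n \<nu>"
      using \<nu> by (simp add: pos_transpose_comp LL del: comp_apply)
  qed
  have perm: "\<nu> permutes {1..n}" if "\<nu> \<in> pieri_set n k \<rho>" for \<nu> \<rho>
    using that by (simp add: pieri_part_def)
  have sum\<tau>: "pieri_sum n k \<tau> = (\<Sum>\<nu>\<in>?U. (if \<nu> \<in> pieri_set n k \<tau> then ?e \<nu> * groth n \<nu> else 0)
      - (if ?L \<nu> \<in> pieri_set n k \<tau> then ?e \<nu> * groth n (?L \<nu>) else 0))"
    unfolding pieri_sum_def by (subst sum_over_ascents[OF perm i]) (auto intro!: sum.cong simp: len simp del: comp_apply)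
  have sum\<sigma>: "pieri_sum n k \<sigma> = (\<Sum>\<nu>\<in>?U. (if ?L \<nu> \<in> pieri_set n k \<sigma> then ?e \<nu> * groth n (?L \<nu>) else 0)
      - (if \<nu> \<in> pieri_set n k \<sigma> then ?e \<nu> * groth n \<nu> else 0))"
    unfolding pieri_sum_def by (subst sum_over_ascents[OF perm i]) (auto intro!: sum.cong simp: len L\<sigma> simp del: comp_apply)
  have D\<sigma>: "?D (pieri_sum n k \<sigma>) = (\<Sum>\<nu>\<in>?U. (if ?L \<nu> \<in> pieri_set n k \<sigma> then ?e \<nu> * groth n \<nu> else 0)
      - (if \<nu> \<in> pieri_set n k \<sigma> then ?e \<nu> * groth n \<nu> else 0))"
    unfolding sum\<sigma> demazure_sum[OF ne]
    by (intro sum.cong refl) (auto simp: demazure_diff demazure_mult_symmetric swap_var_neg_one_power D1 D2 simp del: comp_apply)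
  show "?D (pieri_sum n k \<sigma>) = pieri_sum n k \<tau>" if "pos \<tau> (Suc i) \<le> k \<or> k < pos \<tau> i"
    unfolding D\<sigma> sum\<tau>
  proof (rule sum.cong[OF refl])
    fix \<nu> assume "\<nu> \<in> ?U"
    then have \<nu>: "\<nu> permutes {1..n}" "pos \<nu> i < pos \<nu> (Suc i)" by auto
    show "(if ?L \<nu> \<in> pieri_set n k \<sigma> then ?e \<nu> * groth n \<nu> else 0) - (if \<nu> \<in> pieri_set n k \<sigma> then ?e \<nu> * groth n \<nu> else 0) =
        (if \<nu> \<in> pieri_set n k \<tau> then ?e \<nu> * groth n \<nu> else 0) - (if ?L \<nu> \<in> pieri_set n k \<tau> then ?e \<nu> * groth n (?L \<nu>) else 0)"
      using pieri_set_same_side[OF \<tau> \<nu>(1) kn i asc \<nu>(2) that, folded \<sigma>_def] by auto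
  qed
  show "?D (pieri_sum n k \<sigma>) - pieri_sum n k \<sigma> = pieri_sum n k \<tau>" if "pos \<tau> i \<le> k" "k < pos \<tau> (Suc i)"
    unfolding D\<sigma> sum\<tau> unfolding sum\<sigma> sum_subtractf[symmetric]
  proof (rule sum.cong[OF refl])
    fix \<nu> assume "\<nu> \<in> ?U"
    then have \<nu>: "\<nu> permutes {1..n}" "pos \<nu> i < pos \<nu> (Suc i)" by auto
    show "(if ?L \<nu> \<in> pieri_set n k \<sigma> then ?e \<nu> * groth n \<nu> else 0) - (if \<nu> \<in> pieri_set n k \<sigma> then ?e \<nu> * groth n \<nu> else 0) -
        ((if ?L \<nu> \<in> pieri_set n k \<sigma> then ?e \<nu> * groth n (?L \<nu>) else 0) - (if \<nu> \<in> pieri_set n k \<sigma> then ?e \<nu> * groth n \<nu> else 0)) =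
        (if \<nu> \<in> pieri_set n k \<tau> then ?e \<nu> * groth n \<nu> else 0) - (if ?L \<nu> \<in> pieri_set n k \<tau> then ?e \<nu> * groth n (?L \<nu>) else 0)"
      using pieri_set_cross_side[OF \<tau> \<nu>(1) kn i \<nu>(2) that, folded \<sigma>_def] by auto
  qed
qed

section \<open>The formula, by descent from the longest permutation\<close>

lemma pieri_set_longest:
  assumes "k \<le> n"
  shows "pieri_set n k (longest_perm n) = {longest_perm n}"
proof -
  have "\<nu> = longest_perm n" if "\<nu> \<in> pieri_set n k (longest_perm n)" for \<nu>
  proof -
    have "bruhat_le n (longest_perm n) \<nu>"
      by (rule pieri_set_ge[OF longest_perm_permutes assms that])
    moreover have "\<not> bruhat_step n (longest_perm n) \<mu>" for \<mu>
    proof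
      assume "bruhat_step n (longest_perm n) \<mu>"
      then obtain a b where ab: "1 \<le> a" "a < b" "b \<le> n"
        "perm_length n (longest_perm n) < perm_length n (longest_perm n \<circ> transpose a b)"
        by (auto simp: bruhat_step_def)
      then have "longest_perm n a < longest_perm n b"
        using perm_length_transpose_less_iff[OF longest_perm_permutes] by blast
      then show False using ab by (simp add: longest_perm_def)
    qed
    ultimately show ?thesis
      unfolding bruhat_le_def by (metis converse_rtranclpE)
  qed
  then show ?thesis using pieri_set_self[OF longest_perm_permutes] by blast
qed

text \<open>The inverse of the numerator, placed beside the sum so that the other side contains the
  y only through G.\<close>

definition y_inverse_prod :: "nat \<Rightarrow> (nat \<Rightarrow> nat) \<Rightarrow> laurent" where
  "y_inverse_prod k \<sigma> = (\<Prod>c = 1..k. var_pow (Y (\<sigma> c)) (-1))"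

lemma y_prod_inverse: "(\<Prod>c = 1..k. var (Y (\<sigma> c))) * y_inverse_prod k \<sigma> = 1"
  unfolding y_inverse_prod_def prod.distrib[symmetric] by simp

lemma y_closed:
  assumes "\<sigma> permutes {1..n}" "k \<le> n"
  shows "(\<Prod>c = 1..k. var_pow (Y (\<sigma> c)) e) \<in> laurent_on (vars n)"
proof (rule laurent_on_prod)
  fix c assume "c \<in> {1..k}"
  then have "\<sigma> c \<in> {1..n}" using permutes_in_image[OF assms(1), of c] assms(2) by simp
  then show "var_pow (Y (\<sigma> c)) e \<in> laurent_on (vars n)" by (simp add: var_pow_closed)
qed

text \<open>The theorem divided by the product of the y. At a left ascent i of \<tau>, applying D to
  the instance for s_i \<tau> gives the instance for \<tau>, and D preserves the ideal.\<close>

lemma groth_pieri_sum: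
  assumes "\<sigma> permutes {1..n}" "k \<le> n"
  shows "groth n \<sigma> * (\<Prod>i = 1..k. var_pow (X i) (-1)) - y_inverse_prod k \<sigma> * pieri_sum n k \<sigma> \<in> sym_ideal n"
  using assms(1)
proof (induction rule: perm_length_induct)
  case (longer \<tau>)
  note \<tau> = longer.hyps
  let ?X = "\<Prod>i = 1..k. var_pow (X i) (-1)"
  show ?case
  proof (cases "\<tau> = longest_perm n")
    case True
    have eq: "(\<Prod>i = 1..k. var (Y (n + 1 - i)) * var_pow (X i) (-1)) = (\<Prod>c = 1..k. var (Y (\<tau> c))) * ?X"
      unfolding prod.distrib[symmetric] by (rule prod.cong) (use assms(2) in \<open>auto simp: True longest_perm_def\<close>)
    have "pieri_sum n k \<tau> = groth_top n"
      by (simp add: pieri_sum_def True pieri_set_longest[OF assms(2)] groth_longest)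
    moreover have "- y_inverse_prod k \<tau> \<in> laurent_on (vars n)"
      unfolding y_inverse_prod_def by (intro laurent_on_uminus y_closed \<tau> assms)
    from sym_ideal_mult[OF this groth_top_prod[OF assms(2)]]
    have "groth_top n * (((\<Prod>c = 1..k. var (Y (\<tau> c))) * y_inverse_prod k \<tau>) * ?X) - y_inverse_prod k \<tau> * groth_top n \<in> sym_ideal n"
      unfolding eq by (simp add: algebra_simps)
    ultimately show ?thesis
      unfolding y_prod_inverse by (simp add: True groth_longest)
  next
    case False
    obtain i where i: "1 \<le> i" "i < n" "pos \<tau> i < pos \<tau> (Suc i)"
      using exists_left_ascent[OF \<tau> False] by blast
    let ?D = "demazure (Y (Suc i)) (Y i)" and ?t = "transpose i (Suc i)"
    define \<sigma> where "\<sigma> = ?t \<circ> \<tau>"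
    have ne: "Y (Suc i) \<noteq> Y i" by simp
    have \<sigma>: "\<sigma> permutes {1..n}" unfolding \<sigma>_def using \<tau> i by (intro transpose_comp_permutes) auto
    have "perm_length n \<tau> < perm_length n \<sigma>"
      unfolding \<sigma>_def using perm_length_left_transpose[OF \<tau> i] by simp
    note IH = longer.IH[OF \<sigma> this]
    have sX: "swap_var (Y (Suc i)) (Y i) ?X = ?X"
      by (simp add: swap_var_prod transpose_apply_other)
    have sY: "swap_var (Y (Suc i)) (Y i) (var_pow (Y v) e) = var_pow (Y (?t v)) e" for v e
      by (auto simp: transpose_def)
    have "?t \<circ> \<sigma> = \<tau>" by (simp add: \<sigma>_def comp_assoc[symmetric])
    then have D\<sigma>: "?D (groth n \<sigma>) = groth n \<tau>"
      using demazure_Y_groth[OF \<sigma> i(1,2)] i(3) by (simp add: \<sigma>_def pos_transpose_comp[OF \<tau>] del: comp_apply)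
    have DX: "?D (groth n \<sigma> * ?X) = groth n \<tau> * ?X"
      using demazure_mult_symmetric[OF ne sX, of "groth n \<sigma>"] by (simp add: D\<sigma> mult.commute)
    have vp: "\<tau> (pos \<tau> v) = v" for v by (rule permutes_inverses(1)[OF \<tau>])
    have v: "\<sigma> c = \<tau> c" if "c \<noteq> pos \<tau> i" "c \<noteq> pos \<tau> (Suc i)" for c
    proof -
      have "\<tau> c \<noteq> i" "\<tau> c \<noteq> Suc i" using that permutes_inverses(2)[OF \<tau>, of c] by auto
      then show ?thesis by (simp add: \<sigma>_def transpose_def)
    qed
    have "?D (y_inverse_prod k \<sigma> * pieri_sum n k \<sigma>) = y_inverse_prod k \<tau> * pieri_sum n k \<tau>"
    proof (cases "pos \<tau> i \<le> k \<and> k < pos \<tau> (Suc i)")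
      case False
      let ?p = "pos \<tau> i" and ?q = "pos \<tau> (Suc i)"
      have side: "?q \<le> k \<or> k < ?p" using False by auto
      have "\<sigma> = \<tau> \<circ> transpose ?p ?q"
        unfolding \<sigma>_def using transpose_comp_eq_comp_transpose[OF permutes_inj[OF \<tau>], of ?p ?q] by (simp add: vp)
      then have st: "\<sigma> c = \<tau> (transpose ?p ?q c)" for c by simp
      have "1 \<le> ?p" using pos_in[OF \<tau>, of i] i by simp
      have y: "y_inverse_prod k \<sigma> = y_inverse_prod k \<tau>"
      proof (cases "?q \<le> k")
        case True
        show ?thesis
          unfolding y_inverse_prod_def st
          by (rule prod.reindex_bij_witness[where i = "transpose ?p ?q" and j = "transpose ?p ?q"])
            (use True i(3) \<open>1 \<le> ?p\<close> in \<open>auto simp: transpose_def\<close>)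
      next
        case False
        then have "k < ?p" "k < ?q" using side i(3) by auto
        then show ?thesis
          unfolding y_inverse_prod_def by (intro prod.cong refl) (simp add: v)
      qed
      \<comment> \<open>Exchanging y_i and y_(i+1) turns the product for \<sigma> into that for
        \<tau>. These are equal here, so the product is symmetric and D passes it.\<close>
      have "swap_var (Y (Suc i)) (Y i) (y_inverse_prod k \<sigma>) = y_inverse_prod k \<tau>"
        unfolding y_inverse_prod_def swap_var_prod sY by (simp add: \<sigma>_def)
      then have "swap_var (Y (Suc i)) (Y i) (y_inverse_prod k \<tau>) = y_inverse_prod k \<tau>"
        by (simp add: y)
      from demazure_mult_symmetric[OF ne this, of "pieri_sum n k \<sigma>"] show ?thesis
        by (simp add: y demazure_pieri_sum(1)[OF \<tau> i assms(2) side, folded \<sigma>_def])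
    next
      case True
      let ?p = "pos \<tau> i" and ?q = "pos \<tau> (Suc i)"
      define R where "R = (\<Prod>c\<in>{1..k} - {?p}. var_pow (Y (\<tau> c)) (-1))"
      have p: "?p \<in> {1..k}" using pos_in[OF \<tau>, of i] i True by simp
      have "\<sigma> ?p = Suc i" by (simp add: \<sigma>_def vp)
      moreover have "(\<Prod>c\<in>{1..k} - {?p}. var_pow (Y (\<sigma> c)) (-1)) = R"
        unfolding R_def using True by (intro prod.cong refl) (auto simp: v)
      ultimately have y\<sigma>: "y_inverse_prod k \<sigma> = R * var_pow (Y (Suc i)) (-1)"
        unfolding y_inverse_prod_def by (subst prod.remove[OF _ p]) (auto simp: mult.commute)
      have y\<tau>: "y_inverse_prod k \<tau> = R * var_pow (Y i) (-1)"
        unfolding y_inverse_prod_def R_def by (subst prod.remove[OF _ p]) (auto simp: vp mult.commute)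
      have "?t (\<tau> c) = \<tau> c" if "c \<in> {1..k} - {?p}" for c
        using that v[of c] True by (auto simp: \<sigma>_def)
      then have sR: "swap_var (Y (Suc i)) (Y i) R = R"
        unfolding R_def swap_var_prod sY by (intro prod.cong refl) simp
      show ?thesis
        \<comment> \<open>The factor 1/y_(i+1) becomes 1/y_i and leaves D - id on the sum, which is
          the crossed recursion.\<close>
        unfolding y\<sigma> y\<tau> mult.assoc demazure_mult_symmetric[OF ne sR] demazure_inverse_var[OF ne]
        unfolding \<sigma>_def using demazure_pieri_sum(2)[OF \<tau> i assms(2)] True by simp
    qed
    then show ?thesis
      using demazure_Y_sym_ideal[OF i(1,2) IH] by (simp only: demazure_diff[OF ne] DX)
  qed
qed

theorem theorem1p3:
  fixes n k :: nat and \<sigma> :: "nat \<Rightarrow> nat"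
  assumes "\<sigma> permutes {1..n}" and "1 \<le> k" and "k < n"
  shows "laurent_cong n
     (groth n \<sigma> * (\<Prod>i = 1..k. var_pow (Y (\<sigma> i)) 1 * var_pow (X i) (-1)))
     (\<Sum>\<mu>\<in>bruhat_interval n \<sigma> (eta n k \<sigma>).
        (-1) ^ (perm_length n \<mu> - perm_length n \<sigma>) * groth n \<mu>)"
proof -
  let ?y = "\<Prod>i = 1..k. var (Y (\<sigma> i))" and ?X = "\<Prod>i = 1..k. var_pow (X i) (-1)"
  have kn: "k \<le> n" using assms by simp
  have sign: "(-1) ^ (perm_length n \<mu> - perm_length n \<sigma>) = ((-1) ^ (perm_length n \<mu> + perm_length n \<sigma>) :: laurent)"
    if "\<mu> \<in> pieri_set n k \<sigma>" for \<mu>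
  proof -
    have "perm_length n \<sigma> \<le> perm_length n \<mu>"
      using bruhat_le_eq_or_less[OF pieri_set_ge[OF assms(1) kn that]] by auto
    then have "perm_length n \<mu> + perm_length n \<sigma> = (perm_length n \<mu> - perm_length n \<sigma>) + 2 * perm_length n \<sigma>" by simp
    then show ?thesis by (simp only: power_add power_mult) simp
  qed
  have "(\<Sum>\<mu>\<in>bruhat_interval n \<sigma> (eta n k \<sigma>). (-1) ^ (perm_length n \<mu> - perm_length n \<sigma>) * groth n \<mu>) = pieri_sum n k \<sigma>"
    unfolding bruhat_interval_eta[OF assms(1) kn] pieri_sum_def by (intro sum.cong refl) (simp add: sign)
  \<comment> \<open>Multiplying back by the product of the y, which cancels its inverse in front of
    the sum.\<close>
  moreover have "?y * (groth n \<sigma> * ?X - y_inverse_prod k \<sigma> * pieri_sum n k \<sigma>) \<in> sym_ideal n"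
    by (rule sym_ideal_mult[OF y_closed[OF assms(1) kn] groth_pieri_sum[OF assms(1) kn]])
  then have "groth n \<sigma> * (?y * ?X) - (?y * y_inverse_prod k \<sigma>) * pieri_sum n k \<sigma> \<in> sym_ideal n"
    by (simp add: algebra_simps)
  ultimately show ?thesis
    by (simp add: laurent_cong_def prod.distrib y_prod_inverse)
qed

end
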